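(* Let $V=\Lambda^2(\mathbb{C}^4)$ with the basis $v_1,\dots,v_6$ specified in the context, let $X^{rtt}(\mathfrak{so}_6)$ be the RTT extended orthogonal Yangian with $6\times6$ generator matrix $T(u)$ (acting on $V$ in this basis), and let $Y^{rtt}(\mathfrak{gl}_4)$ be the RTT Yangian with $4\times 4$ generator matrix $\mathsf{T}(u)$. (a) The assignment $$T(u)\mapsto \frac{1-\mathrm{P}}{2}\cdot\mathsf{T}_1(u+1)\mathsf{T}_2(u)=\mathsf{T}_2(u)\mathsf{T}_1(u+1)\cdot\frac{1-\mathrm{P}}{2}$$ (the right-hand side being viewed as an operator on $V=\frac{1-\mathrm{P}}{2}(\mathbb{C}^4\otimes\mathbb{C}^4)$ with coefficients in $Y^{rtt}(\mathfrak{gl}_4)[[u^{-1}]]$) gives rise to an algebra isomorphism $\phi\colon X^{rtt}(\mathfrak{so}_6)\to Y^{rtt}(\mathfrak{gl}_4)$. (b) The restriction of $\phi$ to the subalgebra $Y^{rtt}(\mathfrak{so}_6)$ of $X^{rtt}(\mathfrak{so}_6)$ gives rise to an algebra isomorphism $\phi\colon Y^{rtt}(\mathfrak{so}_6)\to Y^{rtt}(\mathfrak{sl}_4)$.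
   Context: $Y^{rtt}(\mathfrak{gl}_4)$ is the associative $\mathbb{C}$-algebra generated by $\mathsf{t}^{(r)}_{ij}$ ($1\le i,j\le4$, $r\ge1$) with relation $\mathsf{R}(u-v)\mathsf{T}_1(u)\mathsf{T}_2(v)=\mathsf{T}_2(v)\mathsf{T}_1(u)\mathsf{R}(u-v)$, where $\mathsf{T}(u)=(\mathsf{t}_{ij}(u))$, $\mathsf{t}_{ij}(u)=\delta_{ij}+\sum_{r\ge1}\mathsf{t}^{(r)}_{ij}u^{-r}$, $\mathsf{R}(u)=\mathrm{I}-\mathrm{P}/u$, and $\mathrm{P}$ is the permutation operator on $\mathbb{C}^4\otimes\mathbb{C}^4$; subscripts $1,2$ indicate the tensor factor. Let $\mathsf{v}_1,\dots,\mathsf{v}_4$ be the standard basis of $\mathbb{C}^4$. $\Lambda^2(\mathbb{C}^4)\subset\mathbb{C}^4\otimes\mathbb{C}^4$ is the image of $(1-\mathrm{P})/2$, with basis $v_1=\mathsf{v}_1\wedge\mathsf{v}_2$, $v_2=\mathsf{v}_1\wedge\mathsf{v}_3$, $v_3=\mathsf{v}_2\wedge\mathsf{v}_3$, $v_4=\mathsf{v}_1\wedge\mathsf{v}_4$, $v_5=\mathsf{v}_4\wedge\mathsf{v}_2$, $v_6=\mathsf{v}_3\wedge\mathsf{v}_4$, where $a\wedge b$ is proportional (with a fixed nonzero constant) to $a\otimes b-b\otimes a$. $X^{rtt}(\mathfrak{so}_6)$ is the associative $\mathbb{C}$-algebra generated by $t^{(r)}_{kl}$ ($1\le k,l\le6$,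 $r\ge1$) with relation $R(u-v)T_1(u)T_2(v)=T_2(v)T_1(u)R(u-v)$, where $T(u)=(t_{kl}(u))$, $t_{kl}(u)=\delta_{kl}+\sum_{r\ge1}t_{kl}^{(r)}u^{-r}$, $R(u)=\mathrm{I}-\frac{P}{u}+\frac{Q}{u-2}$ on $V\otimes V$, $P$ the permutation operator and $Q=\sum_{i,j=1}^6e_{ij}\otimes e_{i'j'}$ with $i'=7-i$ ($e_{ij}$ the matrix units in the basis $v_1,\dots,v_6$). For $f(u)\in1+u^{-1}\mathbb{C}[[u^{-1}]]$ there are automorphisms $\mu_f\colon T(u)\mapsto f(u)T(u)$ of $X^{rtt}(\mathfrak{so}_6)$ and $\mu_f\colon\mathsf{T}(u)\mapsto f(u)\mathsf{T}(u)$ of $Y^{rtt}(\mathfrak{gl}_4)$; $Y^{rtt}(\mathfrak{so}_6)\subset X^{rtt}(\mathfrak{so}_6)$ and $Y^{rtt}(\mathfrak{sl}_4)\subset Y^{rtt}(\mathfrak{gl}_4)$ are the subalgebras of elements fixed by all $\mu_f$. *)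

theory Defs
  imports
    "HOL-Analysis.Analysis"
    "HOL-Library.Poly_Mapping"
    "HOL-Computational_Algebra.Formal_Laurent_Series"
begin

unbundle no fps_syntax

subsection \<open>Associative unital algebras over the complex numbers\<close>

class complex_algebra_1 = ring_1 +
  fixes scaleC :: "complex \<Rightarrow> 'a \<Rightarrow> 'a"  (infixr \<open>*\<^sub>C\<close> 75)
  assumes scaleC_add_right: "a *\<^sub>C (x + y) = a *\<^sub>C x + a *\<^sub>C y"
    and scaleC_add_left: "(a + b) *\<^sub>C x = a *\<^sub>C x + b *\<^sub>C x"
    and scaleC_scaleC: "a *\<^sub>C b *\<^sub>C x = (a * b) *\<^sub>C x"
    and scaleC_one: "1 *\<^sub>C x = x"
    and scaleC_mult_left: "(a *\<^sub>C x) * y = a *\<^sub>C (x * y)"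
    and scaleC_mult_right: "x * (a *\<^sub>C y) = a *\<^sub>C (x * y)"

definition of_complex :: "complex \<Rightarrow> 'a::complex_algebra_1" where
  "of_complex c = c *\<^sub>C 1"

definition algebra_hom_on ::
    "'a::complex_algebra_1 set \<Rightarrow> ('a \<Rightarrow> 'b::complex_algebra_1) \<Rightarrow> bool" where
  "algebra_hom_on A h \<longleftrightarrow>
     h 1 = 1 \<and>
     (\<forall>x\<in>A. \<forall>y\<in>A. h (x + y) = h x + h y) \<and>
     (\<forall>x\<in>A. \<forall>y\<in>A. h (x * y) = h x * h y) \<and>
     (\<forall>c. \<forall>x\<in>A. h (c *\<^sub>C x) = c *\<^sub>C h x)"

definition algebra_iso_on ::
    "'a::complex_algebra_1 set \<Rightarrow> 'b::complex_algebra_1 set \<Rightarrow> ('a \<Rightarrow> 'b) \<Rightarrow> bool" where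
  "algebra_iso_on A B h \<longleftrightarrow> algebra_hom_on A h \<and> bij_betw h A B"

subsection \<open>Free algebras and two-sided ideals\<close>

text \<open>The free algebra on a type of generators is the monoid algebra of the monoid of words.
  Words are wrapped lists, because \<^type>\<open>poly_mapping\<close> writes the monoid additively.\<close>

datatype 'g word = Word (letters: "'g list")

instantiation word :: (type) monoid_add
begin

definition "0 = Word []"
definition "v + w = Word (letters v @ letters w)"

instance
  by standard (simp_all add: zero_word_def plus_word_def)

end

type_synonym 'g free_algebra = "'g word \<Rightarrow>\<^sub>0 complex"

inductive_set two_sided_ideal :: "'a::ring_1 set \<Rightarrow> 'a set" for S where
  zero: "0 \<in> two_sided_ideal S"
| generator: "s \<in> S \<Longrightarrow> a * s * b \<in> two_sided_ideal S"
| add: "x \<in> two_sided_ideal S \<Longrightarrow> y \<in> two_sided_ideal S \<Longrightarrow> x + y \<in> two_sided_ideal S"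

lemma two_sided_ideal_mult_left: "x \<in> two_sided_ideal S \<Longrightarrow> a * x \<in> two_sided_ideal S"
proof (induction rule: two_sided_ideal.induct)
  case (generator s b c)
  then show ?case
    using two_sided_ideal.generator[of s S "a * b" c] by (simp add: mult.assoc)
qed (auto simp: distrib_left intro: two_sided_ideal.intros)

lemma two_sided_ideal_mult_right: "x \<in> two_sided_ideal S \<Longrightarrow> x * a \<in> two_sided_ideal S"
proof (induction rule: two_sided_ideal.induct)
  case (generator s b c)
  then show ?case
    using two_sided_ideal.generator[of s S b "c * a"] by (simp add: mult.assoc)
qed (auto simp: distrib_right intro: two_sided_ideal.intros)

lemma two_sided_ideal_uminus: "x \<in> two_sided_ideal S \<Longrightarrow> - x \<in> two_sided_ideal S"
  using two_sided_ideal_mult_left[of x S "- 1"] by simp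

definition ideal_cong :: "'a::ring_1 set \<Rightarrow> 'a \<Rightarrow> 'a \<Rightarrow> bool" where
  "ideal_cong S x y \<longleftrightarrow> x - y \<in> two_sided_ideal S"

lemma equivp_ideal_cong: "equivp (ideal_cong S)"
proof (rule equivpI)
  show "reflp (ideal_cong S)"
    by (auto simp: reflp_def ideal_cong_def intro: two_sided_ideal.zero)
  show "symp (ideal_cong S)"
    by (auto simp: symp_def ideal_cong_def dest: two_sided_ideal_uminus)
  show "transp (ideal_cong S)"
  proof (rule transpI)
    fix x y z assume "ideal_cong S x y" "ideal_cong S y z"
    then have "(x - y) + (y - z) \<in> two_sided_ideal S"
      unfolding ideal_cong_def by (rule two_sided_ideal.add)
    then show "ideal_cong S x z" by (simp add: ideal_cong_def)
  qed
qed

lemma ideal_cong_refl: "ideal_cong S x x"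
  by (rule equivp_reflp[OF equivp_ideal_cong])

lemma ideal_cong_add:
  assumes "ideal_cong S x x'" "ideal_cong S y y'"
  shows "ideal_cong S (x + y) (x' + y')"
  using two_sided_ideal.add[OF assms[unfolded ideal_cong_def]]
  by (simp add: ideal_cong_def algebra_simps)

lemma ideal_cong_uminus: "ideal_cong S x x' \<Longrightarrow> ideal_cong S (- x) (- x')"
  using two_sided_ideal_uminus[of "x - x'" S] by (simp add: ideal_cong_def)

lemma ideal_cong_diff:
  assumes "ideal_cong S x x'" "ideal_cong S y y'"
  shows "ideal_cong S (x - y) (x' - y')"
  using ideal_cong_add[OF assms(1) ideal_cong_uminus[OF assms(2)]] by simp

lemma ideal_cong_mult:
  assumes "ideal_cong S x x'" "ideal_cong S y y'"
  shows "ideal_cong S (x * y) (x' * y')"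
proof -
  have "(x - x') * y + x' * (y - y') \<in> two_sided_ideal S"
    using assms unfolding ideal_cong_def
    by (intro two_sided_ideal.add two_sided_ideal_mult_left two_sided_ideal_mult_right)
  then show ?thesis by (simp add: ideal_cong_def algebra_simps)
qed

definition free_scalar :: "complex \<Rightarrow> 'g free_algebra" where
  "free_scalar c = Poly_Mapping.single 0 c"

lemma free_scalar_add: "free_scalar (a + b) = free_scalar a + free_scalar b"
  by (simp add: free_scalar_def single_add)

lemma free_scalar_mult: "free_scalar (a * b) = free_scalar a * free_scalar b"
  by (simp add: free_scalar_def mult_single)

lemma free_scalar_one: "free_scalar 1 = 1"
  by (simp add: free_scalar_def)

lemma free_scalar_central: "x * free_scalar c = free_scalar c * x"
proof (induction x rule: update_induct)
  case const
  show ?case by simp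
next
  case (update f a b)
  have "Poly_Mapping.update a b f = f + Poly_Mapping.single a b"
    using update(1)
    by (intro poly_mapping_eqI)
       (auto simp: Poly_Mapping.update.rep_eq lookup_add lookup_single when_def in_keys_iff)
  moreover have "Poly_Mapping.single a b * free_scalar c = free_scalar c * Poly_Mapping.single a b"
    by (simp add: free_scalar_def mult_single mult.commute)
  ultimately show ?case
    using update(3) by (simp only: distrib_left distrib_right)
qed

lemma free_scalar_left_commute: "x * (free_scalar c * y) = free_scalar c * (x * y)"
  by (metis free_scalar_central mult.assoc)

subsection \<open>RTT relations\<close>

text \<open>Series in the inverse of a spectral parameter $u$ are formal power series in the variable
  $u^{-1}$. An element of \<^typ>\<open>'a fls fls\<close> is a Laurent series in $u^{-1}$ (outer variable) whose
  coefficients are Laurent series in $v^{-1}$ (inner variable); rational functions of $u - v$ are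
  expanded there, that is, for $|u| > |v|$.\<close>

definition series_u :: "'a::ring_1 fps \<Rightarrow> 'a fls fls" where
  "series_u f = fps_to_fls (Abs_fps (\<lambda>n. fls_const (fps_nth f n)))"

definition series_v :: "'a::ring_1 fps \<Rightarrow> 'a fls fls" where
  "series_v f = fls_const (fps_to_fls f)"

text \<open>The expansion of $(u - w)^{-1}$ as $\sum_{n \ge 1} w^{n-1} u^{-n}$, where $w$ does not
  involve $u$. The inner \<^const>\<open>fls_X_inv\<close> is $v$ itself.\<close>

definition inverse_u_minus :: "'a::ring_1 fls \<Rightarrow> 'a fls fls" where
  "inverse_u_minus w = fps_to_fls (Abs_fps (\<lambda>n. if n = 0 then 0 else w ^ (n - 1)))"

text \<open>Operators on a tensor square are matrices indexed by pairs.\<close>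

definition perm_op :: "'a::ring_1 ^ ('n::finite \<times> 'n) ^ ('n \<times> 'n)" where
  "perm_op = (\<chi> p q. if fst p = snd q \<and> snd p = fst q then 1 else 0)"

text \<open>The index type \<^typ>\<open>6\<close> is arithmetic modulo $6$, with elements $1,\dots,6$ where $6 = 0$;
  hence \<^term>\<open>7 - i\<close> is the involution exchanging $1,6$ and $2,5$ and $3,4$.
  The operator below is $\sum_{i,j} e_{ij} \otimes e_{i'j'}$.\<close>

definition Q_op :: "'a::ring_1 ^ (6 \<times> 6) ^ (6 \<times> 6)" where
  "Q_op = (\<chi> p q. if snd p = 7 - fst p \<and> snd q = 7 - fst q then 1 else 0)"

text \<open>The two operators below are $R(u - v)$; the factor of $Q$ is $(u - v - 2)^{-1}$.\<close>

definition R_gl4 :: "'a::ring_1 fls fls ^ (4 \<times> 4) ^ (4 \<times> 4)" where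
  "R_gl4 = mat 1 - map_matrix ((*) (inverse_u_minus fls_X_inv)) perm_op"

definition R_so6 :: "'a::ring_1 fls fls ^ (6 \<times> 6) ^ (6 \<times> 6)" where
  "R_so6 = mat 1 - map_matrix ((*) (inverse_u_minus fls_X_inv)) perm_op
                 + map_matrix ((*) (inverse_u_minus (fls_X_inv + 2))) Q_op"

definition tensor1 :: "'a::ring_1 ^ 'n::finite ^ 'n \<Rightarrow> 'a ^ ('n \<times> 'n) ^ ('n \<times> 'n)" where
  "tensor1 M = (\<chi> p q. if snd p = snd q then M $ fst p $ fst q else 0)"

definition tensor2 :: "'a::ring_1 ^ 'n::finite ^ 'n \<Rightarrow> 'a ^ ('n \<times> 'n) ^ ('n \<times> 'n)" where
  "tensor2 M = (\<chi> p q. if fst p = fst q then M $ snd p $ snd q else 0)"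

definition rtt_defect ::
    "'a::ring_1 fls fls ^ ('n::finite \<times> 'n) ^ ('n \<times> 'n) \<Rightarrow> 'a fps ^ 'n ^ 'n
      \<Rightarrow> 'a fls fls ^ ('n \<times> 'n) ^ ('n \<times> 'n)" where
  "rtt_defect R T =
     R ** tensor1 (map_matrix series_u T) ** tensor2 (map_matrix series_v T)
     - tensor2 (map_matrix series_v T) ** tensor1 (map_matrix series_u T) ** R"

definition rtt_relations ::
    "'a::ring_1 fls fls ^ ('n::finite \<times> 'n) ^ ('n \<times> 'n) \<Rightarrow> 'a fps ^ 'n ^ 'n \<Rightarrow> 'a set" where
  "rtt_relations R T = {fls_nth (fls_nth (rtt_defect R T $ p $ q) m) n | p q m n. True}"

text \<open>The letter \<^term>\<open>(i, j, s)\<close> stands for the generator $t_{ij}^{(s+1)}$.\<close>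

definition free_T :: "('n::finite \<times> 'n \<times> nat) free_algebra fps ^ 'n ^ 'n" where
  "free_T = (\<chi> i j. Abs_fps (\<lambda>r. case r of
      0 \<Rightarrow> (if i = j then 1 else 0)
    | Suc s \<Rightarrow> Poly_Mapping.single (Word [(i, j, s)]) 1))"

subsection \<open>Base change along ring homomorphisms; the relations generate a proper ideal\<close>

definition fps_map :: "('a \<Rightarrow> 'b) \<Rightarrow> 'a fps \<Rightarrow> 'b fps" where
  "fps_map h f = Abs_fps (\<lambda>n. h (fps_nth f n))"

lemma fps_map_nth [simp]: "fps_nth (fps_map h f) n = h (fps_nth f n)"
  by (simp add: fps_map_def)

definition fls_map :: "('a::zero \<Rightarrow> 'b::zero) \<Rightarrow> 'a fls \<Rightarrow> 'b fls" where
  "fls_map h f = Abs_fls (\<lambda>n. h (fls_nth f n))"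

lemma fls_map_nth:
  assumes "h 0 = 0"
  shows "fls_nth (fls_map h f) n = h (fls_nth f n)"
  unfolding fls_map_def
  by (subst nth_Abs_fls_lower_bound[of "fls_subdegree f"]) (simp_all add: assms)

lemma fls_times_nth_bounds:
  fixes f g :: "'a::ring_1 fls"
  assumes "a \<le> fls_subdegree f" "b \<le> fls_subdegree g"
  shows "fls_nth (f * g) n = (\<Sum>i=a..n - b. fls_nth f i * fls_nth g (n - i))"
  unfolding fls_times_nth(2)
proof (rule sum.mono_neutral_left)
  show "\<forall>i\<in>{a..n - b} - {fls_subdegree f..n - fls_subdegree g}. fls_nth f i * fls_nth g (n - i) = 0"
  proof
    fix i assume "i \<in> {a..n - b} - {fls_subdegree f..n - fls_subdegree g}"
    then have "i < fls_subdegree f \<or> n - i < fls_subdegree g" by auto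
    then show "fls_nth f i * fls_nth g (n - i) = 0" by auto
  qed
qed (use assms in auto)

locale ring_1_hom =
  fixes h :: "'a::ring_1 \<Rightarrow> 'b::ring_1"
  assumes hom_one: "h 1 = 1"
    and hom_add: "h (x + y) = h x + h y"
    and hom_mult: "h (x * y) = h x * h y"
begin

lemma hom_zero: "h 0 = 0"
  using hom_add[of 0 0] by simp

lemma hom_uminus: "h (- x) = - h x"
  using hom_add[of x "- x"] by (simp add: hom_zero eq_neg_iff_add_eq_0 add.commute)

lemma hom_diff: "h (x - y) = h x - h y"
  using hom_add[of x "- y"] by (simp add: hom_uminus)

lemma hom_sum: "h (sum f A) = (\<Sum>x\<in>A. h (f x))"
  by (induction A rule: infinite_finite_induct) (simp_all add: hom_zero hom_add)

lemma hom_power: "h (x ^ n) = h x ^ n"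
  by (induction n) (simp_all add: hom_one hom_mult)

lemma map_matrix_mult: "map_matrix h (A ** B) = map_matrix h A ** map_matrix h B"
  by (simp add: vec_eq_iff matrix_matrix_mult_def hom_sum hom_mult)

lemma map_matrix_diff: "map_matrix h (A - B) = map_matrix h A - map_matrix h B"
  by (simp add: vec_eq_iff hom_diff)

lemma map_matrix_add: "map_matrix h (A + B) = map_matrix h A + map_matrix h B"
  by (simp add: vec_eq_iff hom_add)

lemma map_matrix_scale: "map_matrix h (map_matrix ((*) c) A) = map_matrix ((*) (h c)) (map_matrix h A)"
  by (simp add: vec_eq_iff hom_mult)

lemma map_matrix_one: "map_matrix h (mat 1) = mat 1"
  by (simp add: vec_eq_iff mat_def hom_one hom_zero)

lemma map_matrix_perm_op: "map_matrix h perm_op = perm_op"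
  by (simp add: vec_eq_iff perm_op_def hom_one hom_zero)

lemma map_matrix_Q_op: "map_matrix h Q_op = Q_op"
  by (simp add: vec_eq_iff Q_op_def hom_one hom_zero)

lemma map_matrix_tensor1: "map_matrix h (tensor1 A) = tensor1 (map_matrix h A)"
  by (simp add: vec_eq_iff tensor1_def hom_zero)

lemma map_matrix_tensor2: "map_matrix h (tensor2 A) = tensor2 (map_matrix h A)"
  by (simp add: vec_eq_iff tensor2_def hom_zero)

lemma ring_1_hom_fls_map: "ring_1_hom (fls_map h)"
proof
  show "fls_map h 1 = 1"
    by (rule fls_eqI) (simp add: fls_map_nth hom_zero hom_one)
next
  fix f g :: "'a fls"
  show "fls_map h (f + g) = fls_map h f + fls_map h g"
    by (rule fls_eqI) (simp add: fls_map_nth hom_zero hom_add)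
  define a where "a = min (fls_subdegree f) (fls_subdegree (fls_map h f))"
  define b where "b = min (fls_subdegree g) (fls_subdegree (fls_map h g))"
  show "fls_map h (f * g) = fls_map h f * fls_map h g"
  proof (rule fls_eqI)
    fix n
    have "fls_nth (fls_map h (f * g)) n = h (\<Sum>i=a..n - b. fls_nth f i * fls_nth g (n - i))"
      by (simp only: fls_map_nth[of h, OF hom_zero], subst fls_times_nth_bounds[of a _ b])
         (simp_all add: a_def b_def)
    also have "\<dots> = (\<Sum>i=a..n - b. fls_nth (fls_map h f) i * fls_nth (fls_map h g) (n - i))"
      by (simp add: fls_map_nth[of h, OF hom_zero] hom_sum hom_mult)
    also have "\<dots> = fls_nth (fls_map h f * fls_map h g) n"
      by (subst fls_times_nth_bounds[of a _ b]) (simp_all add: a_def b_def)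
    finally show "fls_nth (fls_map h (f * g)) n = fls_nth (fls_map h f * fls_map h g) n" .
  qed
qed

lemma ring_1_hom_fls_map_fls_map: "ring_1_hom (fls_map (fls_map h))"
  by (rule ring_1_hom.ring_1_hom_fls_map[OF ring_1_hom_fls_map])

lemma fls_map_nth' [simp]: "fls_nth (fls_map h f) n = h (fls_nth f n)"
  by (rule fls_map_nth[of h, OF hom_zero])

lemma fls_map_fls_map_nth [simp]: "fls_nth (fls_map (fls_map h) F) n = fls_map h (fls_nth F n)"
  by (rule fls_map_nth[of "fls_map h", OF ring_1_hom.hom_zero[OF ring_1_hom_fls_map]])

lemma fls_map_series_u: "fls_map (fls_map h) (series_u f) = series_u (fps_map h f)"
  by (intro fls_eqI) (simp add: series_u_def hom_zero)

lemma fls_map_series_v: "fls_map (fls_map h) (series_v f) = series_v (fps_map h f)"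
  by (intro fls_eqI) (simp add: series_v_def hom_zero)

lemma fls_map_X_inv: "fls_map h fls_X_inv = fls_X_inv"
  by (intro fls_eqI) (simp add: hom_zero hom_one)

lemma fls_map_two: "fls_map h 2 = 2"
proof -
  interpret H: ring_1_hom "fls_map h" by (rule ring_1_hom_fls_map)
  have "fls_map h (1 + 1) = 1 + 1" by (simp only: H.hom_add H.hom_one)
  then show ?thesis by simp
qed

lemma fls_map_inverse_u_minus:
  "fls_map (fls_map h) (inverse_u_minus w) = inverse_u_minus (fls_map h w)"
proof -
  interpret H: ring_1_hom "fls_map h" by (rule ring_1_hom_fls_map)
  show ?thesis
    by (rule fls_eqI) (simp add: inverse_u_minus_def H.hom_zero H.hom_power)
qed

lemma map_matrix_R_gl4: "map_matrix (fls_map (fls_map h)) R_gl4 = R_gl4"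
proof -
  interpret H: ring_1_hom "fls_map (fls_map h)" by (rule ring_1_hom_fls_map_fls_map)
  show ?thesis
    by (simp add: R_gl4_def H.map_matrix_diff H.map_matrix_one H.map_matrix_scale
        H.map_matrix_perm_op fls_map_inverse_u_minus fls_map_X_inv)
qed

lemma map_matrix_R_so6: "map_matrix (fls_map (fls_map h)) R_so6 = R_so6"
proof -
  interpret H1: ring_1_hom "fls_map h" by (rule ring_1_hom_fls_map)
  interpret H: ring_1_hom "fls_map (fls_map h)" by (rule ring_1_hom_fls_map_fls_map)
  show ?thesis
    by (simp add: R_so6_def H.map_matrix_diff H.map_matrix_add H.map_matrix_one H.map_matrix_scale
        H.map_matrix_perm_op H.map_matrix_Q_op fls_map_inverse_u_minus fls_map_X_inv
        H1.hom_add fls_map_two)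
qed

lemma map_matrix_rtt_defect:
  "map_matrix (fls_map (fls_map h)) (rtt_defect R T) =
     rtt_defect (map_matrix (fls_map (fls_map h)) R) (map_matrix (fps_map h) T)"
proof -
  interpret H: ring_1_hom "fls_map (fls_map h)" by (rule ring_1_hom_fls_map_fls_map)
  have u: "map_matrix (fls_map (fls_map h)) (map_matrix series_u T) =
      map_matrix series_u (map_matrix (fps_map h) T)"
    by (simp add: vec_eq_iff fls_map_series_u)
  have v: "map_matrix (fls_map (fls_map h)) (map_matrix series_v T) =
      map_matrix series_v (map_matrix (fps_map h) T)"
    by (simp add: vec_eq_iff fls_map_series_v)
  show ?thesis
    by (simp only: rtt_defect_def H.map_matrix_diff H.map_matrix_mult H.map_matrix_tensor1
        H.map_matrix_tensor2 u v)
qed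

lemma hom_rtt_relations:
  assumes "map_matrix (fls_map (fls_map h)) R = R'"
    and "s \<in> rtt_relations R T"
  shows "h s \<in> rtt_relations R' (map_matrix (fps_map h) T)"
proof -
  obtain p q m n where s: "s = fls_nth (fls_nth (rtt_defect R T $ p $ q) m) n"
    using assms(2) by (auto simp: rtt_relations_def)
  have "h s = fls_nth (fls_nth (map_matrix (fls_map (fls_map h)) (rtt_defect R T) $ p $ q) m) n"
    by (simp add: s)
  then show ?thesis
    unfolding map_matrix_rtt_defect assms(1) rtt_relations_def by blast
qed

lemma hom_two_sided_ideal:
  assumes "\<And>s. s \<in> S \<Longrightarrow> h s = 0" and "x \<in> two_sided_ideal S"
  shows "h x = 0"
  using assms(2) by induction (simp_all add: hom_zero hom_add hom_mult assms(1))

end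

lemma rtt_relations_one:
  fixes R :: "'a::ring_1 fls fls ^ ('b::finite \<times> 'b) ^ ('b \<times> 'b)"
  shows "rtt_relations R (mat 1) \<subseteq> {0}"
proof -
  have "series_u 0 = (0 :: 'a fls fls)" "series_u 1 = (1 :: 'a fls fls)"
    by (rule fls_eqI; simp add: series_u_def nat_eq_iff)+
  then have u: "map_matrix series_u (mat 1) = (mat 1 :: 'a fls fls ^ 'b ^ 'b)"
    by (simp add: vec_eq_iff mat_def)
  have "series_v 0 = (0 :: 'a fls fls)" "series_v 1 = (1 :: 'a fls fls)"
    by (simp_all add: series_v_def)
  then have v: "map_matrix series_v (mat 1) = (mat 1 :: 'a fls fls ^ 'b ^ 'b)"
    by (simp add: vec_eq_iff mat_def)
  have "tensor1 (mat 1) = (mat 1 :: 'a fls fls ^ ('b \<times> 'b) ^ ('b \<times> 'b))"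
    "tensor2 (mat 1) = (mat 1 :: 'a fls fls ^ ('b \<times> 'b) ^ ('b \<times> 'b))"
    by (auto simp: vec_eq_iff mat_def tensor1_def tensor2_def)
  then show ?thesis
    by (auto simp: rtt_relations_def rtt_defect_def u v)
qed

text \<open>The counit $T(u) \mapsto 1$, that is, the coefficient of the empty word. It kills the
  relations, so the quotients below satisfy $0 \neq 1$, as \<^class>\<open>ring_1\<close> demands.\<close>

definition free_counit :: "'g free_algebra \<Rightarrow> complex" where
  "free_counit x = Poly_Mapping.lookup x 0"

lemma ring_1_hom_free_counit: "ring_1_hom free_counit"
proof
  fix x y :: "'g free_algebra"
  have "(0 = v + w) = (v = 0 \<and> w = 0)" for v w :: "'g word"
    by (cases v; cases w) (auto simp: zero_word_def plus_word_def)
  then have "Poly_Mapping.lookup x v * (\<Sum>w. Poly_Mapping.lookup y w when 0 = v + w)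
      = (Poly_Mapping.lookup x v * Poly_Mapping.lookup y 0 when v = 0)" for v
    by (cases "v = 0") simp_all
  then show "free_counit (x * y) = free_counit x * free_counit y"
    by (simp add: free_counit_def lookup_mult)
qed (simp_all add: free_counit_def lookup_add lookup_one)

lemma free_counit_free_T: "map_matrix (fps_map free_counit) free_T = mat 1"
  by (auto simp: vec_eq_iff fps_eq_iff free_T_def mat_def free_counit_def lookup_one lookup_single
      zero_word_def when_def split: nat.split)

lemma not_ideal_cong_zero_one:
  fixes R :: "('n::finite \<times> 'n \<times> nat) free_algebra fls fls ^ ('n \<times> 'n) ^ ('n \<times> 'n)"
  assumes "map_matrix (fls_map (fls_map free_counit)) R = R'"
  shows "\<not> ideal_cong (rtt_relations R free_T) 0 1"
proof
  interpret ring_1_hom "free_counit :: ('n \<times> 'n \<times> nat) free_algebra \<Rightarrow> complex"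
    by (rule ring_1_hom_free_counit)
  assume "ideal_cong (rtt_relations R free_T) 0 1"
  then have "0 - 1 \<in> two_sided_ideal (rtt_relations R free_T)"
    by (simp only: ideal_cong_def)
  then have "free_counit (0 - 1 :: ('n \<times> 'n \<times> nat) free_algebra) = 0"
  proof (rule hom_two_sided_ideal[rotated])
    fix s assume "s \<in> rtt_relations R free_T"
    then show "free_counit s = 0"
      using hom_rtt_relations[OF assms] rtt_relations_one[of R'] by (fastforce simp: free_counit_free_T)
  qed
  then show False by (simp add: hom_uminus hom_one)
qed

subsection \<open>The Yangians\<close>

quotient_type Y_gl4 = "(4 \<times> 4 \<times> nat) free_algebra" / "ideal_cong (rtt_relations R_gl4 free_T)"
  by (rule equivp_ideal_cong)

quotient_type X_so6 = "(6 \<times> 6 \<times> nat) free_algebra" / "ideal_cong (rtt_relations R_so6 free_T)"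
  by (rule equivp_ideal_cong)

instantiation Y_gl4 :: complex_algebra_1
begin

lift_definition zero_Y_gl4 :: Y_gl4 is 0 .
lift_definition one_Y_gl4 :: Y_gl4 is 1 .
lift_definition plus_Y_gl4 :: "Y_gl4 \<Rightarrow> Y_gl4 \<Rightarrow> Y_gl4" is "(+)" by (rule ideal_cong_add)
lift_definition minus_Y_gl4 :: "Y_gl4 \<Rightarrow> Y_gl4 \<Rightarrow> Y_gl4" is "(-)" by (rule ideal_cong_diff)
lift_definition uminus_Y_gl4 :: "Y_gl4 \<Rightarrow> Y_gl4" is uminus by (rule ideal_cong_uminus)
lift_definition times_Y_gl4 :: "Y_gl4 \<Rightarrow> Y_gl4 \<Rightarrow> Y_gl4" is "(*)" by (rule ideal_cong_mult)
lift_definition scaleC_Y_gl4 :: "complex \<Rightarrow> Y_gl4 \<Rightarrow> Y_gl4" is "\<lambda>c x. free_scalar c * x"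
  by (rule ideal_cong_mult[OF ideal_cong_refl])

instance
proof
  fix a b :: complex and x y z :: Y_gl4
  show "x + y + z = x + (y + z)" "x + y = y + x" "0 + x = x" "- x + x = 0" "x - y = x + - y"
    by (transfer; simp add: ideal_cong_refl add_ac)+
  show "x * y * z = x * (y * z)" "1 * x = x" "x * 1 = x"
    by (transfer; simp add: ideal_cong_refl mult.assoc)+
  show "(x + y) * z = x * z + y * z" "x * (y + z) = x * y + x * z"
    by (transfer; simp add: ideal_cong_refl distrib_left distrib_right)+
  show "a *\<^sub>C (x + y) = a *\<^sub>C x + a *\<^sub>C y" "(a + b) *\<^sub>C x = a *\<^sub>C x + b *\<^sub>C x"
    by (transfer; simp add: ideal_cong_refl distrib_left distrib_right free_scalar_add)+
  show "a *\<^sub>C b *\<^sub>C x = (a * b) *\<^sub>C x" "1 *\<^sub>C x = x" "(a *\<^sub>C x) * y = a *\<^sub>C (x * y)"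
    by (transfer; simp add: ideal_cong_refl mult.assoc free_scalar_mult free_scalar_one)+
  show "x * (a *\<^sub>C y) = a *\<^sub>C (x * y)"
    by transfer (metis ideal_cong_refl free_scalar_left_commute)
  show "(0 :: Y_gl4) \<noteq> 1"
    by transfer (rule not_ideal_cong_zero_one[OF ring_1_hom.map_matrix_R_gl4[OF ring_1_hom_free_counit]])
qed

end

instantiation X_so6 :: complex_algebra_1
begin

lift_definition zero_X_so6 :: X_so6 is 0 .
lift_definition one_X_so6 :: X_so6 is 1 .
lift_definition plus_X_so6 :: "X_so6 \<Rightarrow> X_so6 \<Rightarrow> X_so6" is "(+)" by (rule ideal_cong_add)
lift_definition minus_X_so6 :: "X_so6 \<Rightarrow> X_so6 \<Rightarrow> X_so6" is "(-)" by (rule ideal_cong_diff)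
lift_definition uminus_X_so6 :: "X_so6 \<Rightarrow> X_so6" is uminus by (rule ideal_cong_uminus)
lift_definition times_X_so6 :: "X_so6 \<Rightarrow> X_so6 \<Rightarrow> X_so6" is "(*)" by (rule ideal_cong_mult)
lift_definition scaleC_X_so6 :: "complex \<Rightarrow> X_so6 \<Rightarrow> X_so6" is "\<lambda>c x. free_scalar c * x"
  by (rule ideal_cong_mult[OF ideal_cong_refl])

instance
proof
  fix a b :: complex and x y z :: X_so6
  show "x + y + z = x + (y + z)" "x + y = y + x" "0 + x = x" "- x + x = 0" "x - y = x + - y"
    by (transfer; simp add: ideal_cong_refl add_ac)+
  show "x * y * z = x * (y * z)" "1 * x = x" "x * 1 = x"
    by (transfer; simp add: ideal_cong_refl mult.assoc)+
  show "(x + y) * z = x * z + y * z" "x * (y + z) = x * y + x * z"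
    by (transfer; simp add: ideal_cong_refl distrib_left distrib_right)+
  show "a *\<^sub>C (x + y) = a *\<^sub>C x + a *\<^sub>C y" "(a + b) *\<^sub>C x = a *\<^sub>C x + b *\<^sub>C x"
    by (transfer; simp add: ideal_cong_refl distrib_left distrib_right free_scalar_add)+
  show "a *\<^sub>C b *\<^sub>C x = (a * b) *\<^sub>C x" "1 *\<^sub>C x = x" "(a *\<^sub>C x) * y = a *\<^sub>C (x * y)"
    by (transfer; simp add: ideal_cong_refl mult.assoc free_scalar_mult free_scalar_one)+
  show "x * (a *\<^sub>C y) = a *\<^sub>C (x * y)"
    by transfer (metis ideal_cong_refl free_scalar_left_commute)
  show "(0 :: X_so6) \<noteq> 1"
    by transfer (rule not_ideal_cong_zero_one[OF ring_1_hom.map_matrix_R_so6[OF ring_1_hom_free_counit]])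
qed

end

text \<open>The generator matrices, with entries in $1 + u^{-1} \mathcal{A}[[u^{-1}]]$ on the diagonal
  and in $u^{-1} \mathcal{A}[[u^{-1}]]$ off it.\<close>

definition T_gl4 :: "Y_gl4 fps ^ 4 ^ 4" where
  "T_gl4 = map_matrix (fps_map abs_Y_gl4) free_T"

definition T_so6 :: "X_so6 fps ^ 6 ^ 6" where
  "T_so6 = map_matrix (fps_map abs_X_so6) free_T"

subsection \<open>The subalgebras fixed by the scaling automorphisms\<close>

text \<open>\<^term>\<open>scaling_automorphism T f h\<close>: \<^term>\<open>h\<close> is the automorphism $T(u) \mapsto f(u) T(u)$.\<close>

definition scaling_automorphism ::
    "'a::complex_algebra_1 fps ^ 'n::finite ^ 'n \<Rightarrow> complex fps \<Rightarrow> ('a \<Rightarrow> 'a) \<Rightarrow> bool" where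
  "scaling_automorphism T f h \<longleftrightarrow>
     algebra_iso_on UNIV UNIV h \<and>
     (\<forall>i j. fps_map h (T $ i $ j) = fps_map of_complex f * T $ i $ j)"

definition scaling_invariants :: "'a::complex_algebra_1 fps ^ 'n::finite ^ 'n \<Rightarrow> 'a set" where
  "scaling_invariants T =
     {x. \<forall>f h. fps_nth f 0 = 1 \<and> scaling_automorphism T f h \<longrightarrow> h x = x}"

definition Y_sl4 :: "Y_gl4 set" where
  "Y_sl4 = scaling_invariants T_gl4"

definition Y_so6 :: "X_so6 set" where
  "Y_so6 = scaling_invariants T_so6"

subsection \<open>The exterior square\<close>

text \<open>Substitution of $u + 1$ for $u$: $u^{-1}$ is replaced by
  $(u + 1)^{-1} = \sum_{n \ge 1} (-1)^{n-1} u^{-n}$.\<close>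

definition shift_one :: "'a::ring_1 fps \<Rightarrow> 'a fps" where
  "shift_one f = fps_compose f (Abs_fps (\<lambda>n. if n = 0 then 0 else (- 1) ^ (n - 1)))"

definition constant_series :: "complex \<Rightarrow> 'a::complex_algebra_1 fps" where
  "constant_series c = fps_const (of_complex c)"

definition antisymmetrizer :: "complex ^ (4 \<times> 4) ^ (4 \<times> 4)" where
  "antisymmetrizer = map_matrix ((*) (1 / 2)) (mat 1 - perm_op)"

text \<open>The scalar \<^term>\<open>c\<close> is the (arbitrary, nonzero) normalisation of the wedge product.\<close>

definition wedge :: "complex \<Rightarrow> 4 \<Rightarrow> 4 \<Rightarrow> complex ^ (4 \<times> 4)" where
  "wedge c a b = c *s (axis (a, b) 1 - axis (b, a) 1)"

definition wedge_basis :: "complex \<Rightarrow> 6 \<Rightarrow> complex ^ (4 \<times> 4)" where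
  "wedge_basis c k =
    (if k = 1 then wedge c 1 2
     else if k = 2 then wedge c 1 3
     else if k = 3 then wedge c 2 3
     else if k = 4 then wedge c 1 4
     else if k = 5 then wedge c 4 2
     else wedge c 3 4)"

definition wedge_basis_series ::
    "complex \<Rightarrow> 6 \<Rightarrow> 'a::complex_algebra_1 fps ^ (4 \<times> 4)" where
  "wedge_basis_series c k = (\<chi> p. constant_series (wedge_basis c k $ p))"

text \<open>\<^term>\<open>M\<close> preserves the exterior square (tensored with the coefficient ring) and acts on it by
  the matrix \<^term>\<open>N\<close> in the chosen basis: $M v_l = \sum_k v_k N_{kl}$.\<close>

definition acts_on_exterior_square_by ::
    "complex \<Rightarrow> 'a::complex_algebra_1 fps ^ (4 \<times> 4) ^ (4 \<times> 4) \<Rightarrow> 'a fps ^ 6 ^ 6 \<Rightarrow> bool" where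
  "acts_on_exterior_square_by c M N \<longleftrightarrow>
     (\<forall>l. M *v wedge_basis_series c l = (\<Sum>k\<in>UNIV. N $ k $ l *s wedge_basis_series c k))"

definition fused_left :: "Y_gl4 fps ^ (4 \<times> 4) ^ (4 \<times> 4)" where
  "fused_left = map_matrix constant_series antisymmetrizer
     ** tensor1 (map_matrix shift_one T_gl4) ** tensor2 T_gl4"

definition fused_right :: "Y_gl4 fps ^ (4 \<times> 4) ^ (4 \<times> 4)" where
  "fused_right = tensor2 T_gl4 ** tensor1 (map_matrix shift_one T_gl4)
     ** map_matrix constant_series antisymmetrizer"

end

theory Submission
  imports Defs
begin

text \<open>Fusion: the product of the four $R$-matrices of $\mathfrak{gl}_4$ at shifted arguments,
  restricted to $\Lambda^2 \otimes \Lambda^2$, is a multiple of the $R$-matrix of $\mathfrak{so}_6$,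
  where $Q$ is $6$ times the antisymmetrizer of the fourfold tensor power. Hence $\phi$ is a
  homomorphism. It is onto because the coefficient of $u^{-r}$ in a $2 \times 2$ quantum minor is
  linear in the $t_{ij}^{(r)}$ up to terms with smaller superscripts, and this linear part can be
  inverted.

  For injectivity, choose preimages of the $t_{ij}^{(r)}$. The residue of the RTT relation at
  $u - v = 2$ shows that, up to smaller superscripts, the $36$ generators of each degree are combinations
  of $16$ of them, and commutators have lower degree, so $X^{rtt}(\mathfrak{so}_6)$ is spanned by one
  product of preimages for each multiset of indices. Their images are linearly independent: act on a
  tensor product of evaluation modules, with the evaluation parameters as variables and with the
  unitised matrix algebra at each site, and compare the terms of highest degree in the parameters.

  Part (b) follows since $\phi$ turns $\mu_f$ into $\mu_g$ with $g(u) = f(u) f(u + 1)$, and every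
  $g$ arises from some $f$.\<close>

text \<open>The defining relation lives in iterated Laurent series, where u = v or u = v + 2 cannot
  be substituted. Its denominators are therefore cleared and it is pulled back to power series in
  u^{-1} and v^{-1}, on which such substitutions are ring homomorphisms. The coefficients do not
  commute, so this relies on the variables and the shift being central.

  No basis theorem for either Yangian is presupposed. On the orthogonal side a spanning set
  suffices, indexed by the labels of the gl_4 generators; independence is proved only for its image,
  and the two together give injectivity.

  The sites are unitised because on C^4 itself the matrix units satisfy relations such as E_11 + ...
  + E_44 = 1. Starting from the adjoined unit, each matrix unit reaches a state of its own. The
  relevant matrix entry then counts assignments of factors to sites: a natural number, so nothing
  cancels and only its positivity matters.\<close>

unbundle no Formal_Power_Series.fps_syntax

subsection \<open>Homomorphisms out of the Yangians\<close>

lemma scaleC_zero [simp]: "c *\<^sub>C (0::'a::complex_algebra_1) = 0"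
  using scaleC_add_right[of c 0 0] by simp

lemma scaleC_zero_left [simp]: "0 *\<^sub>C (x::'a::complex_algebra_1) = 0"
  using scaleC_add_left[of 0 0 x] by simp

lemma scaleC_minus_one: "(-1) *\<^sub>C (x::'a::complex_algebra_1) = - x"
  using scaleC_add_left[of 1 "-1" x] by (simp add: scaleC_one eq_neg_iff_add_eq_0 add.commute)

lemma of_complex_mult: "of_complex c * x = c *\<^sub>C x"
  by (simp add: of_complex_def scaleC_mult_left)

lemma mult_of_complex: "x * of_complex c = c *\<^sub>C x"
  by (simp add: of_complex_def scaleC_mult_right)

lemma of_complex_commute: "of_complex c * x = x * of_complex c"
  by (simp add: of_complex_mult mult_of_complex)

lemma ring_1_hom_of_complex: "ring_1_hom of_complex"
  by unfold_locales (simp_all add: of_complex_def scaleC_add_left scaleC_one scaleC_mult_left scaleC_scaleC)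

interpretation of_complex: ring_1_hom of_complex
  by (rule ring_1_hom_of_complex)

lemma of_complex_of_int: "of_complex (of_int n) = of_int n"
proof (induction n rule: int_induct[of _ 0])
  case base then show ?case by (simp add: of_complex_def)
next
  case (step1 i) then show ?case by (simp add: of_complex.hom_add of_complex.hom_one)
next
  case (step2 i) then show ?case by (simp add: of_complex.hom_diff of_complex.hom_one)
qed

locale alg_hom = ring_1_hom h for h :: "'a::complex_algebra_1 \<Rightarrow> 'b::complex_algebra_1" +
  assumes hom_scaleC: "h (c *\<^sub>C x) = c *\<^sub>C h x"
begin

lemma hom_of_complex: "h (of_complex c) = of_complex c"
  by (simp add: of_complex_def hom_scaleC hom_one)

lemma hom_prod_list: "h (prod_list xs) = prod_list (map h xs)"
  by (induction xs) (simp_all add: hom_one hom_mult)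

end

lemma algebra_hom_on_UNIV: "algebra_hom_on UNIV h \<longleftrightarrow> alg_hom h"
  by (auto simp: algebra_hom_on_def alg_hom_def alg_hom_axioms_def ring_1_hom_def)

lemma algebra_iso_on_UNIV: "algebra_iso_on UNIV UNIV h \<longleftrightarrow> alg_hom h \<and> bij h"
  by (simp add: algebra_iso_on_def algebra_hom_on_UNIV)

lemma alg_hom_comp: "alg_hom g \<Longrightarrow> alg_hom h \<Longrightarrow> alg_hom (g \<circ> h)"
  by (simp add: alg_hom_def alg_hom_axioms_def ring_1_hom_def)

lemma alg_hom_inv:
  assumes "alg_hom h" "bij h"
  shows "alg_hom (inv h)"
proof -
  interpret alg_hom h by fact
  have [simp]: "h (inv h y) = y" "inv h (h x) = x" for x y
    using assms(2) by (simp_all add: bij_is_surj surj_f_inv_f bij_is_inj)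
  show ?thesis
    by unfold_locales (rule injD[OF bij_is_inj[OF assms(2)]],
        simp add: hom_one hom_add hom_mult hom_scaleC)+
qed

definition free_eval :: "('g \<Rightarrow> 'b::complex_algebra_1) \<Rightarrow> 'g free_algebra \<Rightarrow> 'b" where
  "free_eval g x = (\<Sum>w\<in>Poly_Mapping.keys x. Poly_Mapping.lookup x w *\<^sub>C prod_list (map g (letters w)))"

lemma free_eval_superset:
  assumes "finite A" "Poly_Mapping.keys x \<subseteq> A"
  shows "free_eval g x = (\<Sum>w\<in>A. Poly_Mapping.lookup x w *\<^sub>C prod_list (map g (letters w)))"
  unfolding free_eval_def
  by (rule sum.mono_neutral_left) (use assms in \<open>auto simp: in_keys_iff\<close>)

lemma free_eval_single [simp]: "free_eval g (Poly_Mapping.single w c) = c *\<^sub>C prod_list (map g (letters w))"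
  by (simp add: free_eval_superset[of "{w}"])

lemma free_eval_add: "free_eval g (x + y) = free_eval g x + free_eval g y"
proof -
  let ?A = "Poly_Mapping.keys x \<union> Poly_Mapping.keys y"
  have "Poly_Mapping.keys (x + y) \<subseteq> ?A" by (rule Poly_Mapping.keys_add)
  then show ?thesis
    by (simp add: free_eval_superset[of ?A] lookup_add scaleC_add_left sum.distrib)
qed

lemma free_algebra_induct [case_names zero add single]:
  fixes x :: "'g free_algebra"
  assumes "P 0" "\<And>x y. P x \<Longrightarrow> P y \<Longrightarrow> P (x + y)" "\<And>w c. P (Poly_Mapping.single w c)"
  shows "P x"
proof (induction x rule: update_induct)
  case const
  show ?case by (rule assms)
next
  case (update f a b)
  have "Poly_Mapping.update a b f = f + Poly_Mapping.single a b"
    using update(1)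
    by (intro poly_mapping_eqI)
       (auto simp: Poly_Mapping.update.rep_eq lookup_add lookup_single when_def in_keys_iff)
  then show ?case using update(3) assms by simp
qed

lemma free_eval_mult: "free_eval g (x * y) = free_eval g x * free_eval g y"
proof (induction x rule: free_algebra_induct)
  case (single w c)
  show ?case
    by (induction y rule: free_algebra_induct)
      (simp_all add: distrib_left free_eval_add mult_single plus_word_def scaleC_mult_left
        scaleC_mult_right scaleC_scaleC mult.commute free_eval_def[of g 0])
qed (simp_all add: distrib_right free_eval_add free_eval_def[of g 0])

lemma ring_1_hom_free_eval: "ring_1_hom (free_eval g)"
proof
  show "free_eval g 1 = 1"
    by (simp flip: single_one add: zero_word_def scaleC_one)
qed (simp_all add: free_eval_add free_eval_mult)

lemma free_eval_scalar: "free_eval g (free_scalar c * x) = c *\<^sub>C free_eval g x"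
  by (simp add: free_eval_mult free_scalar_def zero_word_def scaleC_mult_left)

lemma free_eval_free_T:
  fixes T' :: "'b::complex_algebra_1 fps ^ 'n::finite ^ 'n"
  assumes "\<And>i j. fps_nth (T' $ i $ j) 0 = (if i = j then 1 else 0)"
  shows "map_matrix (fps_map (free_eval (\<lambda>(i, j, s). fps_nth (T' $ i $ j) (Suc s)))) free_T = T'"
proof -
  have "free_eval g 1 = 1" "free_eval g 0 = 0" for g :: "'n \<times> 'n \<times> nat \<Rightarrow> 'b"
    by (simp_all add: ring_1_hom.hom_one[OF ring_1_hom_free_eval] ring_1_hom.hom_zero[OF ring_1_hom_free_eval])
  then show ?thesis
    by (auto simp: vec_eq_iff fps_eq_iff free_T_def assms scaleC_one split: nat.split)
qed

lemma single_Word_prod: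
  "(Poly_Mapping.single (Word ws) 1 :: 'g free_algebra) = prod_list (map (\<lambda>g. Poly_Mapping.single (Word [g]) 1) ws)"
proof (induction ws)
  case (Cons g ws)
  have "(Poly_Mapping.single (Word (g # ws)) 1 :: 'g free_algebra)
      = Poly_Mapping.single (Word [g]) 1 * Poly_Mapping.single (Word ws) 1"
    by (simp add: mult_single plus_word_def)
  with Cons show ?case by simp
qed (simp flip: zero_word_def)

section \<open>The universal property of an algebra with RTT relations\<close>

lemma rtt_relations_subset_zero_iff:
  "rtt_relations R T \<subseteq> {0} \<longleftrightarrow> rtt_defect R T = 0"
proof
  assume *: "rtt_relations R T \<subseteq> {0}"
  have "fls_nth (fls_nth (rtt_defect R T $ p $ q) m) n = 0" for p q m n
    using * unfolding rtt_relations_def by blast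
  then show "rtt_defect R T = 0" by (simp add: vec_eq_iff fls_eq_iff)
qed (auto simp: rtt_relations_def)

lemma generator_in_ideal: "s \<in> S \<Longrightarrow> s \<in> two_sided_ideal S"
  using two_sided_ideal.generator[of s S 1 1] by simp

lemma free_eval_rtt_ideal:
  fixes R :: "('n::finite \<times> 'n \<times> nat) free_algebra fls fls ^ ('n \<times> 'n) ^ ('n \<times> 'n)"
    and T' :: "'b::complex_algebra_1 fps ^ 'n ^ 'n"
  assumes "\<And>i j. fps_nth (T' $ i $ j) 0 = (if i = j then 1 else 0)"
  defines "h \<equiv> free_eval (\<lambda>(i, j, s). fps_nth (T' $ i $ j) (Suc s))"
  assumes "rtt_defect (map_matrix (fls_map (fls_map h)) R) T' = 0"
    and "ideal_cong (rtt_relations R free_T) x y"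
  shows "h x = h y"
proof -
  interpret ring_1_hom h unfolding h_def by (rule ring_1_hom_free_eval)
  have "h (x - y) = 0"
  proof (rule hom_two_sided_ideal)
    show "x - y \<in> two_sided_ideal (rtt_relations R free_T)"
      using assms(4) by (simp add: ideal_cong_def)
    fix s assume "s \<in> rtt_relations R free_T"
    from hom_rtt_relations[OF refl this]
    show "h s = 0"
      using assms(3) rtt_relations_subset_zero_iff free_eval_free_T[of T', OF assms(1)]
      unfolding h_def by fastforce
  qed
  then show ?thesis by (simp add: hom_diff)
qed

text \<open>Common abstraction of the two quotient types. \<open>R\<close> and \<open>R'\<close> are
  the same R-matrix, with entries over the free algebra and over its quotient.\<close>

locale rtt_algebra = ring_1_hom abs
  for abs :: "('n::finite \<times> 'n \<times> nat) free_algebra \<Rightarrow> 'y::complex_algebra_1" +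
  fixes R :: "('n \<times> 'n \<times> nat) free_algebra fls fls ^ ('n \<times> 'n) ^ ('n \<times> 'n)"
    and R' :: "'y fls fls ^ ('n \<times> 'n) ^ ('n \<times> 'n)" and T :: "'y fps ^ 'n ^ 'n"
  assumes abs_surj: "\<exists>x. y = abs x"
    and abs_eq_iff: "abs x = abs x' \<longleftrightarrow> ideal_cong (rtt_relations R free_T) x x'"
    and abs_scaleC: "abs (free_scalar c * x) = c *\<^sub>C abs x"
    and map_R: "map_matrix (fls_map (fls_map abs)) R = R'"
    and T_eq: "T = map_matrix (fps_map abs) free_T"
begin

lemma rtt: "rtt_defect R' T = 0"
proof -
  have "abs s = 0" if "s \<in> rtt_relations R free_T" for s
    using that abs_eq_iff[of s 0] by (simp add: hom_zero ideal_cong_def generator_in_ideal)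
  then have z: "abs (fls_nth (fls_nth (rtt_defect R free_T $ p $ q) m) n) = 0" for p q m n
    unfolding rtt_relations_def by blast
  show ?thesis
    unfolding T_eq map_R[symmetric] map_matrix_rtt_defect[symmetric]
    by (simp add: vec_eq_iff fls_eq_iff z)
qed

text \<open>Evaluation of words descends to the quotient because it kills the defining relations.
  The image \<open>R''\<close> of the R-matrix is required to be the same for all ring
  homomorphisms, since the evaluation map is constructed only inside the proof; both R-matrices are
  built from integers and the variables, so this is harmless.\<close>

lemma lift:
  fixes T' :: "'b::complex_algebra_1 fps ^ 'n ^ 'n"
  assumes R: "\<And>h. ring_1_hom h \<Longrightarrow> map_matrix (fls_map (fls_map h)) R = R''"
    and T': "\<And>i j. fps_nth (T' $ i $ j) 0 = (if i = j then 1 else 0)" "rtt_defect R'' T' = 0"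
  obtains h where "alg_hom h" "map_matrix (fps_map h) T = T'"
proof -
  define g where "g = free_eval (\<lambda>(i, j, s). fps_nth (T' $ i $ j) (Suc s))"
  interpret G: ring_1_hom g unfolding g_def by (rule ring_1_hom_free_eval)
  have cong: "g x = g y" if "ideal_cong (rtt_relations R free_T) x y" for x y
    using free_eval_rtt_ideal[of T' R x y] T' that R[OF G.ring_1_hom_axioms]
    unfolding g_def by simp
  define h where "h y = g (inv abs y)" for y
  have h_abs: "h (abs x) = g x" for x
    unfolding h_def by (rule cong) (metis abs_eq_iff f_inv_into_f rangeI)
  have ind: "P y" if "\<And>x. P (abs x)" for P and y
    using that abs_surj by metis
  have "alg_hom h"
  proof
    show "h 1 = 1" by (metis hom_one h_abs G.hom_one)
    show "h (x + y) = h x + h y" for x y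
      by (rule ind[of _ x], rule ind[of _ y]) (simp add: h_abs G.hom_add flip: hom_add)
    show "h (x * y) = h x * h y" for x y
      by (rule ind[of _ x], rule ind[of _ y]) (simp add: h_abs G.hom_mult flip: hom_mult)
    show "h (c *\<^sub>C x) = c *\<^sub>C h x" for c x
      by (rule ind[of _ x]) (simp add: h_abs free_eval_scalar g_def flip: abs_scaleC)
  qed
  moreover have "map_matrix (fps_map h) T = map_matrix (fps_map g) free_T"
    by (simp add: T_eq vec_eq_iff fps_eq_iff h_abs)
  then have "map_matrix (fps_map h) T = T'"
    using free_eval_free_T[of T', OF T'(1)] by (simp add: g_def)
  ultimately show ?thesis by (rule that)
qed

lemma generators_induct [case_names zero add prod]:
  assumes "P 0" "\<And>x y. P x \<Longrightarrow> P y \<Longrightarrow> P (x + y)"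
    and "\<And>c ws. P (c *\<^sub>C prod_list (map (\<lambda>(i, j, s). fps_nth (T $ i $ j) (Suc s)) ws))"
  shows "P x"
proof -
  have "P (abs x)" for x
  proof (induction x rule: free_algebra_induct)
    case (single w c)
    have p: "abs (prod_list xs) = prod_list (map abs xs)" for xs
      by (induction xs) (simp_all add: hom_one hom_mult)
    have "abs (Poly_Mapping.single w c) = c *\<^sub>C abs (Poly_Mapping.single (Word (letters w)) 1)"
      by (simp add: free_scalar_def mult_single flip: abs_scaleC)
    also have "\<dots> = c *\<^sub>C prod_list (map (\<lambda>(i, j, s). fps_nth (T $ i $ j) (Suc s)) (letters w))"
      by (subst single_Word_prod, subst p) (simp add: o_def case_prod_unfold T_eq free_T_def)
    finally show ?case using assms(3) by simp
  qed (simp_all add: assms hom_zero hom_add)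
  then show ?thesis using abs_surj by metis
qed

lemma T_nth_0: "fps_nth (T $ i $ j) 0 = (if i = j then 1 else 0)"
  by (simp add: T_eq free_T_def hom_one hom_zero)

lemma hom_eqI:
  assumes "alg_hom g" "alg_hom h" "\<And>i j. fps_map g (T $ i $ j) = fps_map h (T $ i $ j)"
  shows "g x = h x"
proof -
  interpret g: alg_hom g by fact
  interpret h: alg_hom h by fact
  have "g (fps_nth (T $ i $ j) n) = h (fps_nth (T $ i $ j) n)" for i j n
    using arg_cong[OF assms(3), of "\<lambda>f. fps_nth f n" i j] by simp
  then show ?thesis
    by (induction x rule: generators_induct)
      (simp_all add: g.hom_zero h.hom_zero g.hom_add h.hom_add g.hom_scaleC h.hom_scaleC g.hom_prod_list h.hom_prod_list
        o_def case_prod_unfold)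
qed

end

interpretation gl4: rtt_algebra abs_Y_gl4 R_gl4 R_gl4 T_gl4
proof -
  interpret ring_1_hom abs_Y_gl4
    by unfold_locales (simp_all add: one_Y_gl4.abs_eq plus_Y_gl4.abs_eq times_Y_gl4.abs_eq)
  show "rtt_algebra abs_Y_gl4 R_gl4 R_gl4 T_gl4"
    by unfold_locales (metis Quotient3_abs_rep[OF Quotient3_Y_gl4],
        simp_all add: Y_gl4.abs_eq_iff scaleC_Y_gl4.abs_eq map_matrix_R_gl4 T_gl4_def)
qed

interpretation so6: rtt_algebra abs_X_so6 R_so6 R_so6 T_so6
proof -
  interpret ring_1_hom abs_X_so6
    by unfold_locales (simp_all add: one_X_so6.abs_eq plus_X_so6.abs_eq times_X_so6.abs_eq)
  show "rtt_algebra abs_X_so6 R_so6 R_so6 T_so6"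
    by unfold_locales (metis Quotient3_abs_rep[OF Quotient3_X_so6],
        simp_all add: X_so6.abs_eq_iff scaleC_X_so6.abs_eq map_matrix_R_so6 T_so6_def)
qed

subsection \<open>Series in one and two variables\<close>

lemma ring_1_hom_comp: "ring_1_hom g \<Longrightarrow> ring_1_hom h \<Longrightarrow> ring_1_hom (\<lambda>x. g (h x))"
  by (simp add: ring_1_hom_def)

lemma ring_1_hom_fps_const: "ring_1_hom fps_const"
  by unfold_locales auto

interpretation fps_const: ring_1_hom fps_const
  by (rule ring_1_hom_fps_const)

lemma ring_1_hom_fls_const: "ring_1_hom fls_const"
  by unfold_locales (auto simp: fls_plus_const fls_const_mult_const)

lemma ring_1_hom_fps_to_fls: "ring_1_hom fps_to_fls"
  by unfold_locales (auto simp: fls_plus_const fls_times_fps_to_fls)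

lemma (in ring_1_hom) ring_1_hom_fps_map: "ring_1_hom (fps_map h)"
  by unfold_locales
    (auto simp: fps_eq_iff hom_one hom_zero hom_add fps_mult_nth hom_sum hom_mult)

lemma series_u_alt: "series_u f = fps_to_fls (fps_map fls_const f)"
  by (simp add: series_u_def fps_map_def)

lemma ring_1_hom_series_u: "ring_1_hom series_u"
  unfolding series_u_alt[abs_def]
  by (rule ring_1_hom_comp[OF ring_1_hom_fps_to_fls ring_1_hom.ring_1_hom_fps_map[OF ring_1_hom_fls_const]])

lemma ring_1_hom_series_v: "ring_1_hom series_v"
  unfolding series_v_def[abs_def] by (rule ring_1_hom_comp[OF ring_1_hom_fls_const ring_1_hom_fps_to_fls])

text \<open>An identity free of denominators can be pulled back along this embedding to double power
  series, where the substitutions \<open>shift_v\<close> and \<open>diag\<close> are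
  defined.\<close>

definition fps2_to_fls2 :: "'a::ring_1 fps fps \<Rightarrow> 'a fls fls" where
  "fps2_to_fls2 F = fps_to_fls (fps_map fps_to_fls F)"

lemma ring_1_hom_fps2_to_fls2: "ring_1_hom fps2_to_fls2"
  unfolding fps2_to_fls2_def[abs_def]
  by (rule ring_1_hom_comp[OF ring_1_hom_fps_to_fls ring_1_hom.ring_1_hom_fps_map[OF ring_1_hom_fps_to_fls]])

interpretation fps2_to_fls2: ring_1_hom fps2_to_fls2
  by (rule ring_1_hom_fps2_to_fls2)

lemma inj_fps2_to_fls2: "fps2_to_fls2 F = fps2_to_fls2 G \<Longrightarrow> F = G"
  by (simp add: fps2_to_fls2_def fps_eq_iff fps_to_fls_eq_iff)

definition fps_u :: "'a::ring_1 fps \<Rightarrow> 'a fps fps" where "fps_u = fps_map fps_const"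

abbreviation fps_v :: "'a::ring_1 fps \<Rightarrow> 'a fps fps" where "fps_v \<equiv> fps_const"

text \<open>The variables below are $x = u^{-1}$ and $y = v^{-1}$.\<close>

abbreviation X2 :: "'a::ring_1 fps fps" where "X2 \<equiv> fps_X"
abbreviation Y2 :: "'a::ring_1 fps fps" where "Y2 \<equiv> fps_const fps_X"

lemma X2_central: "X2 * F = F * X2"
  by (rule fps_mult_fps_X_commute)

lemma fps_u_X: "fps_u fps_X = X2"
  by (auto simp: fps_u_def fps_eq_iff fps_X_def)

lemma fps2_to_fls2_u: "fps2_to_fls2 (fps_u f) = series_u f"
  by (simp add: fps2_to_fls2_def fps_u_def series_u_def fps_map_def)

lemma fps2_to_fls2_v: "fps2_to_fls2 (fps_v f) = series_v f"
  by (rule fls_eqI) (simp add: fps2_to_fls2_def series_v_def)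

lemma ring_1_hom_fps_u: "ring_1_hom fps_u"
  unfolding fps_u_def by (rule fps_const.ring_1_hom_fps_map)

interpretation fps_u: ring_1_hom fps_u by (rule ring_1_hom_fps_u)
interpretation series_u: ring_1_hom series_u by (rule ring_1_hom_series_u)
interpretation series_v: ring_1_hom series_v by (rule ring_1_hom_series_v)

subsection \<open>The shift of the spectral parameter\<close>

lemma sum_atMost_eq_0th: "(\<And>i. i \<noteq> 0 \<Longrightarrow> f i = 0) \<Longrightarrow> (\<Sum>i\<le>n. f i) = (f 0 :: 'a::comm_monoid_add)" for n :: nat
  by (induction n) auto

text \<open>The expansion of (u + 1)^{-1}. Its integer coefficients make it central over any
  coefficient ring.\<close>

definition shift_kernel :: "'a::ring_1 fps" where
  "shift_kernel = Abs_fps (\<lambda>n. if n = 0 then 0 else (- 1) ^ (n - 1))"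

lemma shift_kernel_eq: "(1 + fps_X) * shift_kernel = fps_X"
proof (rule fps_ext)
  fix n show "fps_nth ((1 + fps_X) * shift_kernel) n = fps_nth fps_X n"
    by (cases n rule: nat.exhaust; cases "n - 1") (simp_all add: shift_kernel_def distrib_right)
qed

lemma shift_kernel_central: "shift_kernel * f = f * shift_kernel"
proof -
  have "(-1) ^ n * (x::'a) = x * (-1) ^ n" for n x
    by (induction n) auto
  then have "fps_nth shift_kernel i * x = x * fps_nth shift_kernel i" for i and x :: 'a
    by (simp add: shift_kernel_def)
  then have "fps_nth (shift_kernel * f) n = fps_nth (f * shift_kernel) n" for n
    unfolding fps_mult_nth by (intro sum.reindex_bij_witness[of _ "\<lambda>i. n - i" "\<lambda>i. n - i"]) auto
  then show ?thesis by (rule fps_ext)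
qed

lemma shift_kernel_power_nth_eq_0: "n < i \<Longrightarrow> fps_nth (shift_kernel ^ i) n = 0"
  by (rule startsby_zero_power_prefix[THEN spec, THEN mp]) (simp_all add: shift_kernel_def)

lemma shift_kernel_power_nth_self: "fps_nth (shift_kernel ^ i) i = 1"
proof (induction i)
  case (Suc i)
  define h :: "'a fps" where "h = Abs_fps (\<lambda>n. (- 1) ^ n)"
  have k: "shift_kernel = fps_X * h"
    by (rule fps_ext) (simp add: shift_kernel_def h_def)
  have "fps_nth (shift_kernel ^ Suc i) (Suc i) = fps_nth (h * shift_kernel ^ i) i"
    by (simp add: k mult.assoc)
  also have "\<dots> = 1"
    unfolding fps_mult_nth atLeast0AtMost
    by (subst sum.atMost_shift) (simp add: h_def Suc shift_kernel_power_nth_eq_0)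
  finally show ?case .
qed simp

lemma shift_one_nth: "fps_nth (shift_one f) n = (\<Sum>i=0..n. fps_nth f i * fps_nth (shift_kernel ^ i) n)"
  by (simp add: shift_one_def fps_compose_nth shift_kernel_def)

lemma shift_one_nth_superset:
  "n \<le> m \<Longrightarrow> fps_nth (shift_one f) n = (\<Sum>i\<le>m. fps_nth f i * fps_nth (shift_kernel ^ i) n)"
  unfolding shift_one_nth atLeast0AtMost
  by (rule sum.mono_neutral_left) (auto simp: shift_kernel_power_nth_eq_0)

lemma shift_kernel_power_nth_central: "fps_nth (shift_kernel ^ i) n * x = x * fps_nth (shift_kernel ^ i) n"
proof -
  have "shift_kernel ^ i * fps_const x = fps_const x * shift_kernel ^ i"
    by (rule power_commuting_commutes) (rule shift_kernel_central)
  then show ?thesis by (metis fps_mult_left_const_nth fps_mult_right_const_nth)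
qed

text \<open>Substitution into power series over a noncommutative ring is not multiplicative in
  general. Here the coefficients of the powers of \<open>shift_kernel\<close> are central and can be
  moved past those of \<open>g\<close>, which turns both sides into the sum of f_i g_j
  \<open>shift_kernel ^ (i + j)\<close> over i + j \<le> n.\<close>

lemma ring_1_hom_shift_one: "ring_1_hom shift_one"
proof
  show "shift_one 1 = (1 :: 'a fps)"
    by (rule fps_ext) (simp add: shift_one_nth atLeast0AtMost, subst sum_atMost_eq_0th, auto)
  fix f g :: "'a fps"
  show "shift_one (f + g) = shift_one f + shift_one g"
    by (rule fps_ext) (simp add: shift_one_nth sum.distrib distrib_right)
  show "shift_one (f * g) = shift_one f * shift_one g"
  proof (rule fps_ext)
    fix n
    let ?k = "\<lambda>i. fps_nth (shift_kernel ^ i :: 'a fps)"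
    have e: "fps_nth f i * ?k i m * (fps_nth g j * ?k j l) = fps_nth f i * fps_nth g j * (?k i m * ?k j l)" for i j m l
      using shift_kernel_power_nth_central[of i m "fps_nth g j"] by (metis mult.assoc)
    \<comment> \<open>Both inner sums are extended to the common bound n, which adds only zeros, so
      that the order of summation can be exchanged.\<close>
    have "fps_nth (shift_one f * shift_one g) n
      = (\<Sum>m\<le>n. (\<Sum>i\<le>n. fps_nth f i * ?k i m) * (\<Sum>j\<le>n. fps_nth g j * ?k j (n - m)))"
      unfolding fps_mult_nth atLeast0AtMost
      by (intro sum.cong refl arg_cong2[where f = "(*)"] shift_one_nth_superset) auto
    also have "\<dots> = (\<Sum>m\<le>n. \<Sum>i\<le>n. \<Sum>j\<le>n. fps_nth f i * fps_nth g j * (?k i m * ?k j (n - m)))"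
      by (simp only: sum_product e)
    also have "\<dots> = (\<Sum>i\<le>n. \<Sum>j\<le>n. fps_nth f i * fps_nth g j * ?k (i + j) n)"
      by (subst sum.swap, rule sum.cong[OF refl], subst sum.swap)
        (simp add: power_add fps_mult_nth sum_distrib_left atLeast0AtMost)
    also have "\<dots> = (\<Sum>(i, j)\<in>{..n} \<times> {..n}. fps_nth f i * fps_nth g j * ?k (i + j) n)"
      by (simp add: sum.cartesian_product)
    also have "\<dots> = (\<Sum>(i, j)\<in>{(i, j). i + j \<le> n}. fps_nth f i * fps_nth g j * ?k (i + j) n)"
    proof (rule sum.mono_neutral_right)
      show "\<forall>x\<in>{..n} \<times> {..n} - {(i, j). i + j \<le> n}. (case x of (i, j) \<Rightarrow> fps_nth f i * fps_nth g j * ?k (i + j) n) = 0"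
      proof (clarify, goal_cases)
        case (1 i j)
        then show ?case
          using shift_kernel_power_nth_eq_0[of n "i + j", where ?'a = 'a] by (cases "n < i + j") auto
      qed
    qed auto
    also have "\<dots> = (\<Sum>k\<le>n. \<Sum>i\<le>k. fps_nth f i * fps_nth g (k - i) * ?k k n)"
      by (subst sum.triangle_reindex_eq) simp
    also have "\<dots> = fps_nth (shift_one (f * g)) n"
      by (simp add: shift_one_nth fps_mult_nth atLeast0AtMost sum_distrib_right)
    finally show "fps_nth (shift_one (f * g)) n = fps_nth (shift_one f * shift_one g) n" ..
  qed
qed

interpretation shift_one: ring_1_hom shift_one by (rule ring_1_hom_shift_one)

lemma shift_one_const: "shift_one (fps_const c) = fps_const c"
  by (rule fps_ext) (simp add: shift_one_nth atLeast0AtMost, subst sum_atMost_eq_0th, auto)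

lemma shift_one_X: "shift_one fps_X = shift_kernel"
  by (rule fps_ext) (auto simp: shift_one_nth fps_X_def if_distrib[of "\<lambda>x. x * _"] shift_kernel_def cong: if_cong)

lemma shift_one_X_eq: "(1 + fps_X) * shift_one fps_X = fps_X"
  by (simp add: shift_one_X shift_kernel_eq)

text \<open>Replaces v by v + 1 in the inner series. The map \<open>shift_one\<close>, applied to a
  double series, shifts the outer variable u.\<close>

definition shift_v :: "'a::ring_1 fps fps \<Rightarrow> 'a fps fps" where "shift_v = fps_map shift_one"

lemma ring_1_hom_shift_v: "ring_1_hom shift_v"
  unfolding shift_v_def by (rule ring_1_hom.ring_1_hom_fps_map[OF ring_1_hom_shift_one])

interpretation shift_v: ring_1_hom shift_v by (rule ring_1_hom_shift_v)

definition diag :: "'a::ring_1 fps fps \<Rightarrow> 'a fps" where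
  "diag F = Abs_fps (\<lambda>n. \<Sum>i\<le>n. fps_nth (fps_nth F i) (n - i))"

text \<open>Setting u = v is multiplicative over any ring because both variables commute with the
  coefficients; the proof only regroups a sum over exponents of fixed total.\<close>

lemma ring_1_hom_diag: "ring_1_hom diag"
proof
  show "diag 1 = (1 :: 'a fps)"
    by (rule fps_ext) (simp add: diag_def, subst sum_atMost_eq_0th, auto)
  fix F G :: "'a fps fps"
  show "diag (F + G) = diag F + diag G"
    by (rule fps_ext) (simp add: diag_def sum.distrib)
  show "diag (F * G) = diag F * diag G"
  proof (rule fps_ext)
    fix n
    let ?t = "\<lambda>a b c d. fps_nth (fps_nth F a) b * fps_nth (fps_nth G c) d"
    have "fps_nth (diag (F * G)) n = (\<Sum>i\<le>n. \<Sum>a\<le>i. \<Sum>b\<le>n - i. ?t a b (i - a) (n - i - b))"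
      by (simp add: diag_def fps_mult_nth fps_sum_nth atLeast0AtMost)
    also have "\<dots> = (\<Sum>m\<le>n. \<Sum>a\<le>m. \<Sum>c\<le>n - m. ?t a (m - a) c (n - m - c))"
      unfolding sum.Sigma[OF finite_atMost ballI[OF finite_atMost]] sum.Sigma[OF finite_atMost ballI[OF finite_SigmaI[OF finite_atMost finite_atMost]]]
      by (rule sum.reindex_bij_witness[of _ "\<lambda>(m, a, c). (a + c, a, m - a)" "\<lambda>(i, a, b). (a + b, a, i - a)"])
        (auto simp: algebra_simps)
    also have "\<dots> = fps_nth (diag F * diag G) n"
      by (simp add: diag_def fps_mult_nth atLeast0AtMost sum_product)
    finally show "fps_nth (diag (F * G)) n = fps_nth (diag F * diag G) n" .
  qed
qed

interpretation diag: ring_1_hom diag by (rule ring_1_hom_diag)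

lemma shift_one_fps_u: "shift_one (fps_u f) = fps_u (shift_one f)"
proof -
  have *: "fps_nth (shift_kernel ^ i :: 'a fps fps) n = fps_const (fps_nth (shift_kernel ^ i) n)" for i n
  proof -
    have "fps_u shift_kernel = (shift_kernel :: 'a fps fps)"
      by (rule fps_ext) (auto simp: fps_u_def shift_kernel_def
        fps_const.hom_power fps_const.hom_uminus)
    then have "shift_kernel ^ i = fps_u (shift_kernel ^ i :: 'a fps)" by (simp add: fps_u.hom_power)
    then show ?thesis by (simp add: fps_u_def)
  qed
  show ?thesis
    by (rule fps_ext) (simp add: shift_one_nth fps_u_def * fps_const.hom_sum)
qed

lemma shift_one_fps_v: "shift_one (fps_v f) = fps_v f"
  by (rule shift_one_const)

lemma shift_v_fps_v: "shift_v (fps_v f) = fps_v (shift_one f)"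
  by (auto simp: shift_v_def fps_eq_iff shift_one.hom_zero)

lemma shift_v_fps_u: "shift_v (fps_u f) = fps_u f"
  by (rule fps_ext) (simp add: shift_v_def fps_u_def shift_one_const)

lemma diag_fps_u: "diag (fps_u f) = f"
  by (rule fps_ext) (simp add: diag_def fps_u_def fps_const_def if_distrib sum.delta)

lemma diag_fps_v: "diag (fps_v f) = f"
  by (rule fps_ext) (simp add: diag_def, subst sum_atMost_eq_0th, auto)

subsection \<open>The entries of the RTT relation\<close>

lemma fls_central:
  fixes F G :: "'a::ring_1 fls"
  assumes "\<And>n x. fls_nth F n * x = x * fls_nth F n"
  shows "F * G = G * F"
proof (rule fls_eqI)
  fix n
  define a where "a = fls_subdegree F"
  define b where "b = fls_subdegree G"
  have "fls_nth (F * G) n = (\<Sum>i=a..n - b. fls_nth F i * fls_nth G (n - i))"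
    by (rule fls_times_nth_bounds) (simp_all add: a_def b_def)
  also have "\<dots> = (\<Sum>i=b..n - a. fls_nth G i * fls_nth F (n - i))"
    by (rule sum.reindex_bij_witness[of _ "\<lambda>i. n - i" "\<lambda>i. n - i"]) (auto simp: assms)
  also have "\<dots> = fls_nth (G * F) n"
    by (rule fls_times_nth_bounds[symmetric]) (simp_all add: a_def b_def)
  finally show "fls_nth (F * G) n = fls_nth (G * F) n" .
qed

lemma fls_central_X: "fls_X * (F::'a::ring_1 fls) = F * fls_X"
  by (rule fls_central) simp

lemma fls_central_X_inv: "fls_X_inv * (F::'a::ring_1 fls) = F * fls_X_inv"
  by (rule fls_central) simp

lemma fls_central_const_X: "fls_const fls_X * (F::'a::ring_1 fls fls) = F * fls_const fls_X"
  by (rule fls_central) (simp add: fls_central_X)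

lemma numeral_central: "numeral n * (x::'a::ring_1) = x * numeral n"
  by (rule mult_of_nat_commute[of "numeral n", simplified])

lemma power_central: "(\<And>x. w * x = x * w) \<Longrightarrow> w ^ n * x = x * (w::'a::monoid_mult) ^ n"
  by (rule power_commuting_commutes) 

lemma inverse_u_minus_central:
  assumes "\<And>x. w * x = x * (w::'a::ring_1 fls)"
  shows "inverse_u_minus w * F = F * inverse_u_minus w"
  by (rule fls_central) (simp add: inverse_u_minus_def power_central[OF assms])

lemma inverse_u_minus_eq:
  "(1 - fls_const w * fls_X) * inverse_u_minus w = (fls_X :: 'a::ring_1 fls fls)"
proof -
  have "inverse_u_minus w = fls_X + fls_const w * (fls_X * inverse_u_minus w)"
  proof (rule fls_eqI)
    fix n :: int
    show "fls_nth (inverse_u_minus w) n = fls_nth (fls_X + fls_const w * (fls_X * inverse_u_minus w)) n"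
    proof (cases "n < 1")
      case True
      then show ?thesis by (simp add: inverse_u_minus_def fls_X_times_conv_shift)
    next
      case False
      define m where "m = nat (n - 1)"
      have n: "n = int m + 1" using False by (simp add: m_def)
      show ?thesis unfolding n
        by (cases m) (simp_all add: inverse_u_minus_def fls_X_times_conv_shift nat_add_distrib)
    qed
  qed
  then have "inverse_u_minus w - fls_const w * (fls_X * inverse_u_minus w) = fls_X"
    by (simp only: diff_eq_eq)
  then show ?thesis by (simp only: left_diff_distrib mult.assoc mult_1_left)
qed

lemma (in ring_1_hom) hom_of_int: "h (of_int n) = of_int n"
  by (induction n rule: int_induct[of _ 0]) (simp_all add: hom_zero hom_add hom_diff hom_one)

text \<open>These four elements are u^{-1}, v^{-1}, u and v in the ring of the RTT relation.\<close>

definition xu :: "'a::ring_1 fls fls" where "xu = fls_X"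
definition yv :: "'a::ring_1 fls fls" where "yv = fls_const fls_X"
definition uu :: "'a::ring_1 fls fls" where "uu = fls_X_inv"
definition vv :: "'a::ring_1 fls fls" where "vv = fls_const fls_X_inv"

lemma xu_central: "xu * F = F * xu" and yv_central: "yv * F = F * yv"
  and uu_central: "uu * F = F * uu" and vv_central: "vv * F = F * vv"
proof -
  show "vv * F = F * vv" unfolding vv_def
    by (rule fls_central) (simp add: fls_central_X_inv)
qed (simp_all add: xu_def yv_def uu_def fls_central_X fls_central_const_X fls_central_X_inv)

lemma uu_xu: "uu * xu = 1" "xu * uu = 1" and vv_yv: "vv * yv = 1" "yv * vv = 1"
  by (simp_all add: xu_def yv_def uu_def vv_def fls_X_inv_times_conv_shift fls_X_times_conv_shift
      fls_const_mult_const)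

lemma fps2_to_fls2_X: "fps2_to_fls2 X2 = xu"
  unfolding fps_u_X[symmetric] fps2_to_fls2_u xu_def
  by (auto intro!: fls_eqI simp: series_u_def)

lemma series_v_X: "series_v fps_X = yv"
  by (simp add: series_v_def yv_def)

lemma fps2_to_fls2_Y: "fps2_to_fls2 Y2 = yv"
  by (simp add: fps2_to_fls2_v series_v_def yv_def)

lemma inverse_u_minus_shifted:
  "(uu - vv - of_int k) * inverse_u_minus (fls_X_inv + of_int k) = (1 :: 'a::ring_1 fls fls)"
proof -
  have "fls_const (of_int k :: 'a fls) = of_int k"
    by (rule ring_1_hom.hom_of_int[OF ring_1_hom_fls_const])
  then have w: "fls_const (fls_X_inv + of_int k :: 'a fls) = vv + of_int k"
    by (simp add: vv_def flip: fls_plus_const)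
  have "uu * ((vv + of_int k) * xu) = (vv + of_int k :: 'a fls fls)"
    by (metis uu_central uu_xu(1) mult.assoc mult_1_right)
  then have "uu * (1 - (vv + of_int k) * xu) = (uu - vv - of_int k :: 'a fls fls)"
    by (simp add: right_diff_distrib)
  then have "(uu - vv - of_int k) * inverse_u_minus (fls_X_inv + of_int k)
     = uu * ((1 - (vv + of_int k) * xu) * inverse_u_minus (fls_X_inv + of_int k) :: 'a fls fls)"
    by (simp only: flip: mult.assoc)
  then show ?thesis
    using inverse_u_minus_eq[of "fls_X_inv + of_int k :: 'a fls"] unfolding w xu_def[symmetric]
    by (simp add: uu_xu)
qed

abbreviation D0 :: "'a::ring_1 fls fls" where "D0 \<equiv> inverse_u_minus fls_X_inv"
abbreviation D2 :: "'a::ring_1 fls fls" where "D2 \<equiv> inverse_u_minus (fls_X_inv + 2)"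

lemma D0_eq: "(uu - vv) * D0 = 1" and D2_eq: "(uu - vv - 2) * D2 = 1"
  using inverse_u_minus_shifted[of 0] inverse_u_minus_shifted[of 2] by simp_all

lemma D0_central: "D0 * F = F * D0"
  by (rule inverse_u_minus_central) (rule fls_central_X_inv)

lemma D2_central: "D2 * F = F * D2"
  by (rule inverse_u_minus_central) (simp add: distrib_left distrib_right fls_central_X_inv numeral_central)

section \<open>Entries of products with tensor factors, the permutation and Q\<close>

lemma sum_UNIV_single:
  "(\<And>q. q \<noteq> q0 \<Longrightarrow> f q = 0) \<Longrightarrow> (\<Sum>q\<in>UNIV. f q) = (f q0 :: 'a::comm_monoid_add)" for q0 :: "'b::finite"
  by (subst sum.mono_neutral_right[of UNIV "{q0}"]) auto

lemma tensor12_nth: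
  fixes A B :: "'a::ring_1 ^ 'n::finite ^ 'n"
  shows "(tensor1 A ** tensor2 B) $ (i, k) $ (j, l) = A $ i $ j * B $ k $ l"
  unfolding matrix_matrix_mult_def
  by (simp, subst sum_UNIV_single[of "(j, k)"]) (auto simp: tensor1_def tensor2_def)

lemma tensor21_nth:
  fixes A B :: "'a::ring_1 ^ 'n::finite ^ 'n"
  shows "(tensor2 B ** tensor1 A) $ (i, k) $ (j, l) = B $ k $ l * A $ i $ j"
  unfolding matrix_matrix_mult_def
  by (simp, subst sum_UNIV_single[of "(i, l)"]) (auto simp: tensor1_def tensor2_def)

lemma perm_mult_nth:
  "(map_matrix ((*) c) perm_op ** M) $ (i, k) $ q = c * (M :: 'a::ring_1 ^ _ ^ _) $ (k, i) $ q"
  unfolding matrix_matrix_mult_def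
  by (simp, subst sum_UNIV_single[of "(k, i)"]) (auto simp: perm_op_def)

lemma mult_perm_nth:
  assumes "\<And>x. c * x = x * c"
  shows "(M ** map_matrix ((*) c) perm_op) $ p $ (j, l) = c * (M :: 'a::ring_1 ^ _ ^ _) $ p $ (l, j)"
  unfolding matrix_matrix_mult_def
  by (simp, subst sum_UNIV_single[of "(l, j)"]) (auto simp: perm_op_def assms)

lemma sum_UNIV_pair: "(\<Sum>q\<in>UNIV. f q) = (\<Sum>a\<in>UNIV. \<Sum>b\<in>UNIV. f (a, b))"
  for f :: "'b::finite \<times> 'c::finite \<Rightarrow> 'a::comm_monoid_add"
  by (simp add: sum.cartesian_product)

lemma Q_mult_nth:
  "(map_matrix ((*) c) Q_op ** M) $ (i, k) $ q
    = (if k = 7 - i then c * (\<Sum>p\<in>UNIV. (M :: 'a::ring_1 ^ _ ^ _) $ (p, 7 - p) $ q) else 0)"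
  unfolding matrix_matrix_mult_def
  by (auto simp: Q_op_def sum_UNIV_pair sum_distrib_left if_distrib[of "\<lambda>x. x * _"] if_distrib[of "\<lambda>x. _ * x"] cong: if_cong)

lemma mult_Q_nth:
  assumes "\<And>x. c * x = x * c"
  shows "(M ** map_matrix ((*) c) Q_op) $ p $ (j, l)
    = (if l = 7 - j then c * (\<Sum>a\<in>UNIV. (M :: 'a::ring_1 ^ _ ^ _) $ p $ (a, 7 - a)) else 0)"
  unfolding matrix_matrix_mult_def
  by (auto simp: Q_op_def sum_UNIV_pair sum_distrib_left assms if_distrib[of "\<lambda>x. x * _"] if_distrib[of "\<lambda>x. _ * x"] cong: if_cong)

lemma matrix_diff_ldistrib: "A ** (B - C) = A ** B - A ** (C :: 'a::ring_1 ^ 'k ^ 'n)"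
  by (simp add: vec_eq_iff matrix_matrix_mult_def right_diff_distrib sum_subtractf)

lemma matrix_diff_rdistrib: "(A - B) ** C = A ** C - B ** (C :: 'a::ring_1 ^ 'k ^ 'n)"
  by (simp add: vec_eq_iff matrix_matrix_mult_def left_diff_distrib sum_subtractf)

lemma matrix_add_rdistrib': "(A + B) ** C = A ** C + B ** (C :: 'a::ring_1 ^ 'k ^ 'n)"
  by (simp add: vec_eq_iff matrix_matrix_mult_def distrib_right sum.distrib)

lemma rtt_defect_alt:
  "rtt_defect R T = R ** (tensor1 (map_matrix series_u T) ** tensor2 (map_matrix series_v T))
     - (tensor2 (map_matrix series_v T) ** tensor1 (map_matrix series_u T)) ** R"
  by (simp only: rtt_defect_def matrix_mul_assoc)

lemma rtt_R_gl4_iff: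
  "rtt_defect R_gl4 T = 0 \<longleftrightarrow> (\<forall>i j k l.
    series_u (T $ i $ j) * series_v (T $ k $ l) - series_v (T $ k $ l) * series_u (T $ i $ j)
    = D0 * (series_u (T $ k $ j) * series_v (T $ i $ l) - series_v (T $ k $ j) * series_u (T $ i $ l)))"
  (is "_ \<longleftrightarrow> (\<forall>i j k l. ?E i j k l)")
proof -
  have "rtt_defect R_gl4 T = 0 \<longleftrightarrow> (\<forall>i k j l. rtt_defect R_gl4 T $ (i, k) $ (j, l) = 0)"
    by (simp add: vec_eq_iff)
  also have "\<dots> \<longleftrightarrow> (\<forall>i k j l. ?E i j k l)"
    unfolding rtt_defect_alt R_gl4_def matrix_diff_rdistrib matrix_diff_ldistrib
      matrix_mul_lid matrix_mul_rid
    unfolding vector_minus_component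
      perm_mult_nth mult_perm_nth[OF D0_central] tensor12_nth tensor21_nth nth_map_matrix
    by (intro all_cong1) (auto simp: algebra_simps)
  finally show ?thesis by blast
qed

text \<open>The range of Q is the line through the sum of all v_p tensor v_{7-p}. Hence Q
  contributes from the left only for k = 7 - i and from the right only for l = 7 - j.\<close>

lemma rtt_R_so6_iff:
  "rtt_defect R_so6 T = 0 \<longleftrightarrow> (\<forall>i j k l.
    series_u (T $ i $ j) * series_v (T $ k $ l) - series_v (T $ k $ l) * series_u (T $ i $ j)
    = D0 * (series_u (T $ k $ j) * series_v (T $ i $ l) - series_v (T $ k $ j) * series_u (T $ i $ l))
      - (if k = 7 - i then D2 * (\<Sum>p\<in>UNIV. series_u (T $ p $ j) * series_v (T $ (7 - p) $ l)) else 0)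
      + (if l = 7 - j then D2 * (\<Sum>p\<in>UNIV. series_v (T $ k $ (7 - p)) * series_u (T $ i $ p)) else 0))"
  (is "_ \<longleftrightarrow> (\<forall>i j k l. ?E i j k l)")
proof -
  have "rtt_defect R_so6 T = 0 \<longleftrightarrow> (\<forall>i k j l. rtt_defect R_so6 T $ (i, k) $ (j, l) = 0)"
    by (simp add: vec_eq_iff)
  also have "\<dots> \<longleftrightarrow> (\<forall>i k j l. ?E i j k l)"
    unfolding rtt_defect_alt R_so6_def matrix_diff_rdistrib matrix_diff_ldistrib matrix_add_rdistrib' matrix_add_ldistrib
      matrix_mul_lid matrix_mul_rid
    unfolding vector_minus_component vector_add_component
      perm_mult_nth mult_perm_nth[OF D0_central] Q_mult_nth mult_Q_nth[OF D2_central] tensor12_nth tensor21_nth nth_map_matrix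
    by (intro all_cong1) (auto simp: algebra_simps)
  finally show ?thesis by blast
qed

lemma xy_uv: "xu * yv * (uu - vv) = (yv - xu :: 'a::ring_1 fls fls)"
  and xy_uv2: "xu * yv * (uu - vv - 2) = (yv - xu - 2 * xu * yv :: 'a::ring_1 fls fls)"
proof -
  have a: "xu * yv * uu = (yv :: 'a fls fls)"
    by (metis uu_central uu_xu(1) mult.assoc mult_1_left)
  have b: "xu * yv * vv = (xu :: 'a fls fls)"
    by (simp add: mult.assoc vv_yv)
  show "xu * yv * (uu - vv) = (yv - xu :: 'a fls fls)"
    by (simp only: right_diff_distrib a b)
  show "xu * yv * (uu - vv - 2) = (yv - xu - 2 * xu * yv :: 'a fls fls)"
    by (simp only: right_diff_distrib a b) (simp only: numeral_central mult.assoc)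
qed

lemma D0_eq': "(yv - xu) * D0 = xu * yv"
  by (simp add: xy_uv[symmetric] mult.assoc D0_eq)

lemma D2_eq': "(yv - xu - 2 * xu * yv) * D2 = xu * yv"
  by (simp add: xy_uv2[symmetric] mult.assoc[of "xu * yv"] D2_eq)

text \<open>Although u - v is not a power series in x = u^{-1} and y = v^{-1}, the product x y (u -
  v) = y - x is, so multiplying by it removes the denominator.\<close>

lemma rtt_gl4_polynomial:
  assumes "rtt_defect R_gl4 T = 0"
  shows "(Y2 - X2) * (fps_u (T $ i $ j) * fps_v (T $ k $ l) - fps_v (T $ k $ l) * fps_u (T $ i $ j))
    = X2 * Y2 * (fps_u (T $ k $ j) * fps_v (T $ i $ l) - fps_v (T $ k $ j) * fps_u (T $ i $ l))"
proof (rule inj_fps2_to_fls2)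
  have *: "(yv - xu) * (D0 * F) = xu * yv * F" for F :: "'a fls fls"
    by (simp only: D0_eq' flip: mult.assoc)
  show "fps2_to_fls2 ((Y2 - X2) * (fps_u (T $ i $ j) * fps_v (T $ k $ l) - fps_v (T $ k $ l) * fps_u (T $ i $ j)))
    = fps2_to_fls2 (X2 * Y2 * (fps_u (T $ k $ j) * fps_v (T $ i $ l) - fps_v (T $ k $ j) * fps_u (T $ i $ l)))"
    using assms[unfolded rtt_R_gl4_iff, rule_format, of i j k l]
    by (simp only: fps2_to_fls2.hom_mult fps2_to_fls2.hom_diff fps2_to_fls2_u fps2_to_fls2_v
        fps2_to_fls2_X series_v_X *)
qed

lemma rtt_gl4_from_polynomial:
  assumes "\<And>i j k l. (uu - vv) * (series_u (T $ i $ j) * series_v (T $ k $ l) - series_v (T $ k $ l) * series_u (T $ i $ j))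
    = series_u (T $ k $ j) * series_v (T $ i $ l) - series_v (T $ k $ j) * series_u (T $ i $ l)"
  shows "rtt_defect R_gl4 T = 0"
proof -
  have "D0 * ((uu - vv) * F) = F" for F :: "'a fls fls"
    using D0_eq D0_central[of "uu - vv :: 'a fls fls"] by (metis mult.assoc mult_1_left)
  then show ?thesis
    unfolding rtt_R_gl4_iff by (metis assms)
qed

text \<open>The second denominator is cleared by x y (u - v - 2) = y - x - 2 x y. The two factors
  are kept apart: at u = v + 2 the second one vanishes and only the terms with Q survive.\<close>

lemma rtt_so6_polynomial:
  assumes "rtt_defect R_so6 T = 0"
  shows "(Y2 - X2 - 2 * X2 * Y2) * ((Y2 - X2) *
      (fps_u (T $ i $ j) * fps_v (T $ k $ l) - fps_v (T $ k $ l) * fps_u (T $ i $ j)))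
    = (Y2 - X2 - 2 * X2 * Y2) * (X2 * Y2 *
        (fps_u (T $ k $ j) * fps_v (T $ i $ l) - fps_v (T $ k $ j) * fps_u (T $ i $ l)))
    - (Y2 - X2) * (X2 * Y2 * ((if k = 7 - i then \<Sum>p\<in>UNIV. fps_u (T $ p $ j) * fps_v (T $ (7 - p) $ l) else 0)
      - (if l = 7 - j then \<Sum>p\<in>UNIV. fps_v (T $ k $ (7 - p)) * fps_u (T $ i $ p) else 0)))"
  (is "?m2 * (?m1 * ?c) = ?m2 * (?xy * ?p) - ?m1 * (?xy * (?q1 - ?q2))")
proof (rule inj_fps2_to_fls2)
  let ?h = "fps2_to_fls2 :: 'a fps fps \<Rightarrow> _"
  have two: "?h 2 = 2"
    using fps2_to_fls2.hom_of_int[of 2] by simp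
  have 1: "?h ?m1 = yv - xu" and 3: "?h ?xy = xu * yv"
    by (simp_all only: fps2_to_fls2.hom_mult fps2_to_fls2.hom_diff fps2_to_fls2_X fps2_to_fls2_Y)
  have 2: "?h ?m2 = yv - xu - 2 * xu * yv"
    by (simp only: fps2_to_fls2.hom_mult fps2_to_fls2.hom_diff fps2_to_fls2_X fps2_to_fls2_Y two)
  have m: "(yv - xu) * F = F * (yv - xu)" for F :: "'a fls fls"
    by (simp only: left_diff_distrib right_diff_distrib xu_central[of F] yv_central[of F])
  define p where "p = ?h ?p"
  define q where "q = ?h (?q1 - ?q2)"
  define c where "c = ?h ?c"
  have *: "c = D0 * p - D2 * q"
    using assms[unfolded rtt_R_so6_iff, rule_format, of i j k l]
    unfolding c_def p_def q_def
    by (simp add: fps2_to_fls2.hom_mult fps2_to_fls2.hom_diff fps2_to_fls2.hom_sum fps2_to_fls2.hom_zero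
        fps2_to_fls2_u fps2_to_fls2_v right_diff_distrib)
  define A :: "'a fls fls" where "A = yv - xu"
  define B :: "'a fls fls" where "B = yv - xu - 2 * xu * yv"
  have "A * (D2 * q) = D2 * (A * q)"
    by (metis D2_central mult.assoc)
  then have "B * (A * c) = B * ((A * D0) * p) - (B * D2) * (A * q)"
    by (simp only: * right_diff_distrib mult.assoc)
  also have "\<dots> = B * (xu * yv * p) - A * (xu * yv * q)"
    unfolding A_def B_def D0_eq' D2_eq' by (metis m mult.assoc)
  finally have "?h ?m2 * (?h ?m1 * c) = ?h ?m2 * (?h ?xy * p) - ?h ?m1 * (?h ?xy * q)"
    by (simp only: 1 2 3 A_def B_def)
  then show "?h (?m2 * (?m1 * ?c)) = ?h (?m2 * (?xy * ?p) - ?m1 * (?xy * (?q1 - ?q2)))"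
    by (simp only: fps2_to_fls2.hom_mult fps2_to_fls2.hom_diff c_def p_def q_def)
qed

subsection \<open>Fusion in an abstract ring\<close>

text \<open>The elements $a$, $b$, $c$ stand for the transpositions $(12)$, $(23)$, $(34)$ acting on a
  fourfold tensor power and $d$ for $u - v$.\<close>

locale fusion_perms =
  fixes a b c d :: "'m::ring_1"
  assumes aa: "a * a = 1" and bb: "b * b = 1" and cc: "c * c = 1"
    and aba: "a * b * a = b * a * b" and cbc: "c * b * c = b * c * b" and ca: "c * a = a * c"
    and dz: "d * z = z * d"
begin

text \<open>On the product of the two exterior squares, $w$ is the flip and $e - e b e + e w$ is $24$ times
  the antisymmetrizer, so that $\kappa$ is $4 d (d - 2)$ times the orthogonal $R$-matrix.\<close>

definition "e = (1 - a) * (1 - c)"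
definition "w = b * a * c * b"
definition "kappa = d * (d - 2) * e - (d - 2) * (e * w) + d * (e - e * b * e + e * w)"

lemma e_a: "e * a = - e" and e_c: "e * c = - e"
proof -
  have "e = (1 - c) * (1 - a)"
    by (simp only: e_def left_diff_distrib right_diff_distrib mult_1_left mult_1_right ca diff_diff_eq2)
      (simp only: diff_diff_eq diff_add_eq add.commute)
  moreover have "(1 - a) * a = - (1 - a)" by (simp add: left_diff_distrib aa)
  ultimately show "e * a = - e" by (simp only: mult.assoc mult_minus_right)
  have "(1 - c) * c = - (1 - c)" by (simp add: left_diff_distrib cc)
  then show "e * c = - e" by (simp only: e_def mult.assoc mult_minus_right)
qed

text \<open>The right module generated by $e$ over the group algebra of $S_4$ has the basis
  $e$, $eb$, $eba$, $ebc$, $ebac$, $ew$.\<close>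

lemma module_rules:
  "e * b * b = e"
  "e * b * a * a = e * b" "e * b * a * b = - (e * b * a)"
  "e * b * c * a = e * b * a * c" "e * b * c * b = - (e * b * c)" "e * b * c * c = e * b"
  "e * b * a * c * a = e * b * c" "e * b * a * c * c = e * b * a" "e * b * a * c * b = e * w"
  "e * w * a = - (e * w)" "e * w * c = - (e * w)" "e * w * b = e * b * a * c"
proof -
  show "e * b * b = e" by (simp add: mult.assoc bb)
  show "e * b * a * a = e * b" by (simp add: mult.assoc aa)
  show "e * b * c * c = e * b" by (simp add: mult.assoc cc)
  have "e * b * a * b = e * a * b * a" by (simp add: mult.assoc aba[unfolded mult.assoc])
  then show "e * b * a * b = - (e * b * a)" by (simp add: e_a)
  have "e * b * c * b = e * c * b * c" by (simp add: mult.assoc cbc[unfolded mult.assoc])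
  then show "e * b * c * b = - (e * b * c)" by (simp add: e_c)
  show "e * b * c * a = e * b * a * c" by (simp add: mult.assoc ca)
  then show "e * b * a * c * a = e * b * c" by (metis mult.assoc ca aa mult_1_right)
  show "e * b * a * c * c = e * b * a" by (simp add: mult.assoc cc)
  show "e * b * a * c * b = e * w" by (simp add: w_def mult.assoc)
  have "w * a = c * w"
    unfolding w_def by (metis aba cbc ca mult.assoc)
  then show "e * w * a = - (e * w)" by (metis e_c mult.assoc mult_minus_left)
  have "w * c = a * w"
    unfolding w_def by (metis aba cbc ca mult.assoc)
  then show "e * w * c = - (e * w)" by (metis e_a mult.assoc mult_minus_left)
  show "e * w * b = e * b * a * c" by (simp add: w_def mult.assoc bb)
qed

lemma d_right: "x * d * a = x * a * d" "x * d * b = x * b * d" "x * d * c = x * c * d"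
  by (metis dz mult.assoc)+

lemma kappa_alt:
  "kappa = e * (d * (d - 2)) - e * w * (d - 2)
     + (e - (e * b - e * b * a - e * b * c + e * b * a * c) + e * w) * d"
proof -
  have z: "(d - 2) * z = z * (d - 2)" for z
    by (simp only: left_diff_distrib right_diff_distrib dz[of z] numeral_central[of _ z])
  have "d * (d - 2) * e = e * (d * (d - 2))"
    by (metis z dz mult.assoc)
  moreover have "e * b * e = e * b - e * b * a - e * b * c + e * b * a * c"
    by (subst (2) e_def)
      (simp add: algebra_simps)
  ultimately show ?thesis
    by (simp only: kappa_def z[of "e * w"] dz[of "e - _ + e * w"])
qed

text \<open>The four factors are the R-matrices on slots 14, 13, 24, 23 with parameters d + 1, d, d,
  d - 1 and cleared denominators: a c b c a = (14), a b a = (13), c b c = (24). They are multiplied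
  onto \<open>e\<close> one at a time, each result being rewritten in the six-element basis
  above.\<close>

lemma fused_R:
  "e * ((d + 1 - a * c * b * c * a) * (d - a * b * a) * (d - c * b * c) * (d - 1 - b)) = kappa * (d * (d + 1))"
proof -
  note r = module_rules e_a e_c minus_minus mult_minus_left mult_minus_right d_right
    right_diff_distrib distrib_left left_diff_distrib distrib_right mult_1_right
  have "e * (d + 1 - a * c * b * c * a) = e * d + e - e * b * a * c"
    by (simp only: mult.assoc[symmetric] r)
  moreover have "(e * d + e - e * b * a * c) * (d - a * b * a)
      = e * d * d + e * d - e * b * a * c * d + e * b * a * d + e * b * a - e * b * a * c"
    by (simp only: mult.assoc[symmetric] r) simp
  \<comment> \<open>Fusion shows here: the result is divisible by d + 1, which is later moved to the
    right of the fourth factor.\<close>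
  moreover have "(e * d * d + e * d - e * b * a * c * d + e * b * a * d + e * b * a - e * b * a * c) * (d - c * b * c)
     = (e * d * d + e * b * c * d + e * b * a * d + e * w - e * b * a * c * d - e * b * a * c) * (d + 1)"
    by (simp only: mult.assoc[symmetric] r) (simp add: algebra_simps)
  moreover have "(e * d * d + e * b * c * d + e * b * a * d + e * w - e * b * a * c * d - e * b * a * c) * (d - 1 - b)
     = kappa * d"
    unfolding kappa_alt
    by (simp only: mult.assoc[symmetric] r) (simp add: algebra_simps mult_2)
  moreover have "x * (d + 1) * (d - 1 - b) = x * (d - 1 - b) * (d + 1)" for x
    by (simp only: mult.assoc[symmetric] r) (simp add: algebra_simps)
  ultimately show ?thesis
    by (simp only: mult.assoc[symmetric])
qed

end

text \<open>The index is the tensor slot; slots 1, 2 belong to u and slots 3, 4 to v. The letter S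
  stands for the generator matrix at u + 1 or v + 1, T for the one at u or v. Between the two pairs
  only the neighbouring slots 2 and 3 are related by assumption.\<close>

locale fusion = fusion_perms a b c d for a b c d :: "'m::ring_1" +
  fixes S1 S2 T1 T2 S3 S4 T3 T4 :: 'm
  assumes aS: "a * S1 = S2 * a" "a * S2 = S1 * a" and aT: "a * T1 = T2 * a" "a * T2 = T1 * a"
    and cS: "c * S3 = S4 * c" "c * S4 = S3 * c" and cT: "c * T3 = T4 * c" "c * T4 = T3 * c"
    and cS': "c * S1 = S1 * c" "c * S2 = S2 * c" and cT': "c * T1 = T1 * c" "c * T2 = T2 * c"
    and aS': "a * S3 = S3 * a" "a * S4 = S4 * a" and aT': "a * T3 = T3 * a" "a * T4 = T4 * a"
    and bST: "b * S1 = S1 * b" "b * T1 = T1 * b" "b * S4 = S4 * b" "b * T4 = T4 * b"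
    and SS: "(d - b) * (S2 * S3) = S3 * S2 * (d - b)"
    and ST: "(d + 1 - b) * (S2 * T3) = T3 * S2 * (d + 1 - b)"
    and TS: "(d - 1 - b) * (T2 * S3) = S3 * T2 * (d - 1 - b)"
    and TT: "(d - b) * (T2 * T3) = T3 * T2 * (d - b)"
    and S1T2: "(1 - a) * (S1 * T2) = T2 * S1 * (1 - a)"
    and S3T4: "(1 - c) * (S3 * T4) = T4 * S3 * (1 - c)"
begin

text \<open>The relation for slots 2 and 3, conjugated by the transposition of slots 3 and 4. The
  next two lemmas use conjugation in the same way.\<close>

lemma P24_rel: "(d - c * b * c) * (T2 * T4) = T4 * T2 * (d - c * b * c)"
proof -
  have 1: "d - c * b * c = c * (d - b) * c"
    by (simp only: left_diff_distrib right_diff_distrib mult.assoc) (metis cc dz mult.assoc mult_1_right)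
  have "c * (d - b) * c * (T2 * T4) = c * ((d - b) * (T2 * T3)) * c"
    by (metis cT cT' mult.assoc)
  also have "\<dots> = T4 * T2 * (c * (d - b) * c)"
    unfolding TT by (metis cT cT' mult.assoc)
  finally show ?thesis unfolding 1 .
qed

lemma P13_rel: "(d - a * b * a) * (S1 * S3) = S3 * S1 * (d - a * b * a)"
proof -
  have 1: "d - a * b * a = a * (d - b) * a"
    by (simp only: left_diff_distrib right_diff_distrib mult.assoc) (metis aa dz mult.assoc mult_1_right)
  have "a * (d - b) * a * (S1 * S3) = a * ((d - b) * (S2 * S3)) * a"
    by (metis aS aS' mult.assoc)
  also have "\<dots> = S3 * S1 * (a * (d - b) * a)"
    unfolding SS by (metis aS aS' mult.assoc)
  finally show ?thesis unfolding 1 .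
qed

lemma P14_rel: "(d + 1 - a * c * b * c * a) * (S1 * T4) = T4 * S1 * (d + 1 - a * c * b * c * a)"
proof -
  have ac: "a * c * (c * a) = 1" by (metis aa cc mult.assoc mult_1_right)
  have dz': "(d + 1) * z = z * (d + 1)" for z by (simp add: distrib_left distrib_right dz[of z])
  have "a * c * (d + 1) * (c * a) = d + 1"
    by (metis ac dz' mult.assoc mult_1_right)
  then have 1: "d + 1 - a * c * b * c * a = a * c * (d + 1 - b) * (c * a)"
    by (simp add: left_diff_distrib right_diff_distrib mult.assoc)
  have "a * c * (d + 1 - b) * (c * a) * (S1 * T4) = a * c * ((d + 1 - b) * (S2 * T3)) * (c * a)"
    by (metis aS cS' cT aT' mult.assoc)
  also have "\<dots> = T4 * S1 * (a * c * (d + 1 - b) * (c * a))"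
    unfolding ST by (metis aS cS' cT aT' mult.assoc)
  finally show ?thesis unfolding 1 .
qed

text \<open>The four R-matrices carry S1 T2 S3 T4 to S3 T4 S1 T2, each exchanging one pair of
  factors. Then \<open>e\<close> reverses both pairs, by the relations inside slots 12 and 34, and
  \<open>fused_R\<close> evaluates \<open>e\<close> times the four R-matrices.\<close>

lemma fused_rtt_abstract:
  "kappa * (d * (d + 1)) * (S1 * T2 * S3 * T4) = T4 * S3 * T2 * S1 * (kappa * (d * (d + 1)))"
proof -
  define R14 where "R14 = d + 1 - a * c * b * c * a"
  define R13 where "R13 = d - a * b * a"
  define R24 where "R24 = d - c * b * c"
  define R23 where "R23 = d - 1 - b"
  have com: "R23 * S1 = S1 * R23" "R23 * T4 = T4 * R23"
    by (simp_all add: R23_def left_diff_distrib right_diff_distrib dz[of S1] dz[of T4] bST)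
  have "c * b * c * S1 = S1 * (c * b * c)" "c * b * c * S3 = S3 * (c * b * c)"
    "a * b * a * T2 = T2 * (a * b * a)" "a * b * a * T4 = T4 * (a * b * a)"
    by (metis bST cS cS' aT aT' mult.assoc)+
  then have com2: "R24 * S1 = S1 * R24" "R24 * S3 = S3 * R24" "R13 * T2 = T2 * R13" "R13 * T4 = T4 * R13"
    by (simp_all add: R24_def R13_def left_diff_distrib right_diff_distrib dz[of S1] dz[of S3] dz[of T2] dz[of T4])
  have "a * c * b * c * a * T2 = T2 * (a * c * b * c * a)" "a * c * b * c * a * S3 = S3 * (a * c * b * c * a)"
    by (metis bST cS cT' aT aS' mult.assoc)+
  then have com3: "R14 * T2 = T2 * R14" "R14 * S3 = S3 * R14"
    by (simp_all add: R14_def left_diff_distrib right_diff_distrib distrib_left distrib_right dz[of T2] dz[of S3])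
  have "R14 * R13 * R24 * R23 * (S1 * T2 * S3 * T4) = R14 * R13 * R24 * (S1 * (R23 * (T2 * S3)) * T4)"
    by (metis com(1) mult.assoc)
  also have "\<dots> = R14 * R13 * (S1 * S3 * (R24 * (T2 * T4)) * R23)"
    unfolding TS[folded R23_def] by (metis com(2) com2(1,2) mult.assoc)
  also have "\<dots> = R14 * ((R13 * (S1 * S3)) * T4 * T2) * R24 * R23"
    unfolding P24_rel[folded R24_def] by (metis mult.assoc)
  also have "\<dots> = S3 * (R14 * (S1 * T4)) * T2 * R13 * R24 * R23"
    unfolding P13_rel[folded R13_def] by (metis com2(3,4) com3(2) mult.assoc)
  also have "\<dots> = S3 * T4 * (S1 * T2) * (R14 * R13 * R24 * R23)"
    unfolding P14_rel[folded R14_def] by (metis com3(1) mult.assoc)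
  finally have R: "R14 * R13 * R24 * R23 * (S1 * T2 * S3 * T4) = S3 * T4 * (S1 * T2) * (R14 * R13 * R24 * R23)" .
  have e': "e = (1 - c) * (1 - a)"
    by (simp only: e_def left_diff_distrib right_diff_distrib mult_1_left mult_1_right ca diff_diff_eq2)
      (simp only: diff_diff_eq diff_add_eq add.commute)
  have "(1 - a) * (S3 * T4) = S3 * T4 * (1 - a)"
    by (simp add: left_diff_distrib right_diff_distrib) (metis aS' aT' mult.assoc)
  moreover have "(1 - c) * (T2 * S1) = T2 * S1 * (1 - c)"
    by (simp add: left_diff_distrib right_diff_distrib) (metis cS' cT' mult.assoc)
  ultimately have "e * (S3 * T4 * (S1 * T2)) = T4 * S3 * (T2 * S1) * e"
    by (metis S1T2 S3T4 e' e_def mult.assoc)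
  moreover have "e * (R14 * R13 * R24 * R23) = kappa * (d * (d + 1))"
    using fused_R by (simp only: R14_def R13_def R24_def R23_def)
  ultimately show ?thesis
    using R by (metis mult.assoc)
qed

end

subsection \<open>Square matrices as a ring\<close>

text \<open>On the vector types \<open>*\<close> is the componentwise product. This copy has the
  matrix product as its multiplication, so that the ring locales above can be interpreted by
  matrices.\<close>

typedef (overloaded) ('a, 'n) sqm = "UNIV :: ('a::ring_1 ^ 'n::finite ^ 'n) set"
  morphisms mx Sq by simp

setup_lifting type_definition_sqm

instantiation sqm :: (ring_1, finite) ring_1
begin

lift_definition zero_sqm :: "('a, 'b) sqm" is 0 .
lift_definition one_sqm :: "('a, 'b) sqm" is "mat 1" .
lift_definition plus_sqm :: "('a, 'b) sqm \<Rightarrow> ('a, 'b) sqm \<Rightarrow> ('a, 'b) sqm" is "(+)" .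
lift_definition minus_sqm :: "('a, 'b) sqm \<Rightarrow> ('a, 'b) sqm \<Rightarrow> ('a, 'b) sqm" is "(-)" .
lift_definition uminus_sqm :: "('a, 'b) sqm \<Rightarrow> ('a, 'b) sqm" is uminus .
lift_definition times_sqm :: "('a, 'b) sqm \<Rightarrow> ('a, 'b) sqm \<Rightarrow> ('a, 'b) sqm" is "(**)" .

instance
proof
  fix x y z :: "('a, 'b) sqm"
  show "x + y + z = x + (y + z)" "x + y = y + x" "0 + x = x" "- x + x = 0" "x - y = x + - y"
    by (transfer; simp)+
  show "x * y * z = x * (y * z)" by transfer (simp add: matrix_mul_assoc)
  show "1 * x = x" "x * 1 = x" by (transfer; simp)+
  show "(x + y) * z = x * z + y * z" by transfer (rule matrix_add_rdistrib')
  show "x * (y + z) = x * y + x * z" by transfer (rule matrix_add_ldistrib)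
  show "(0 :: ('a, 'b) sqm) \<noteq> 1"
    by transfer (auto simp: vec_eq_iff mat_def)
qed

end

lemmas mx_simps = zero_sqm.rep_eq one_sqm.rep_eq plus_sqm.rep_eq minus_sqm.rep_eq uminus_sqm.rep_eq
  times_sqm.rep_eq Sq_inverse[OF UNIV_I]

lemma Sq_eqI: "mx x = mx y \<Longrightarrow> x = y" by (simp add: mx_inject)

subsection \<open>Permutation matrices and Kronecker products\<close>

definition pm :: "('n::finite \<Rightarrow> 'n) \<Rightarrow> 'a::ring_1 ^ 'n ^ 'n" where
  "pm f = (\<chi> p q. if q = f p then 1 else 0)"

lemma pm_mult_nth: "(pm f ** M) $ p $ q = M $ f p $ q"
  unfolding matrix_matrix_mult_def
  by (simp, subst sum_UNIV_single[of "f p"]) (auto simp: pm_def)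

lemma mult_pm_nth:
  assumes "\<And>x. f (f x) = x"
  shows "(M ** pm f) $ p $ q = M $ p $ f q"
proof -
  have "(q = f x) = (x = f q)" for x using assms by metis
  then show ?thesis
    by (simp add: matrix_matrix_mult_def pm_def if_distrib[of "(*) _"] cong: if_cong)
qed

lemma pm_mult_pm: "pm f ** pm g = pm (g \<circ> f)"
  by (simp add: vec_eq_iff pm_mult_nth) (simp add: pm_def)

lemma pm_id: "pm (\<lambda>x. x) = mat 1"
  by (auto simp: vec_eq_iff pm_def mat_def)

lemma perm_op_eq_pm: "perm_op = pm (\<lambda>(i, j). (j, i))"
  by (auto simp: vec_eq_iff pm_def perm_op_def)

lemma perm_op_mult_nth: "(perm_op ** M) $ (i, k) $ q = (M :: 'a::ring_1 ^ _ ^ _) $ (k, i) $ q"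
  and mult_perm_op_nth: "(N ** perm_op) $ p $ (j, l) = (N :: 'a::ring_1 ^ _ ^ _) $ p $ (l, j)"
  using perm_mult_nth[of 1 M i k q] mult_perm_nth[of 1 N p j l]
  by (simp_all add: map_matrix_def)

definition kron :: "'a::ring_1 ^ 'm ^ 'n \<Rightarrow> 'a ^ 'k ^ 'l \<Rightarrow> 'a ^ ('m::finite \<times> 'k::finite) ^ ('n::finite \<times> 'l::finite)" where
  "kron A B = (\<chi> p q. A $ fst p $ fst q * B $ snd p $ snd q)"

text \<open>Over a noncommutative ring only the two inner matrices \<open>B\<close> and
  \<open>C\<close> have to commute entrywise.\<close>

lemma kron_mult:
  fixes A :: "'a::ring_1 ^ 'm::finite ^ 'n::finite"
  assumes "\<And>i j k l. B $ i $ j * C $ k $ l = C $ k $ l * B $ i $ j"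
  shows "kron A B ** kron C D = kron (A ** C) (B ** D)"
proof -
  have "A $ i $ x * B $ k $ y * (C $ x $ j * D $ y $ l) = A $ i $ x * C $ x $ j * (B $ k $ y * D $ y $ l)" for i x k y j l
    by (metis assms mult.assoc)
  then show ?thesis
    by (simp add: vec_eq_iff kron_def matrix_matrix_mult_def sum_UNIV_pair sum_product)
qed

lemma tensor1_eq_kron: "tensor1 M = kron M (mat 1)"
  by (auto simp: vec_eq_iff tensor1_def kron_def mat_def)

lemma tensor2_eq_kron: "tensor2 M = kron (mat 1) M"
  by (auto simp: vec_eq_iff tensor2_def kron_def mat_def)

lemma mat_1_commute: "(mat 1 :: 'a::ring_1 ^ 'n ^ 'n) $ i $ j * x = x * mat 1 $ i $ j"
  by (simp add: mat_def)

lemma tensor1_mult: "tensor1 (A ** B) = tensor1 A ** tensor1 B"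
  unfolding tensor1_eq_kron by (subst kron_mult) (auto simp: mat_1_commute)

lemma tensor2_mult: "tensor2 (A ** B) = tensor2 A ** tensor2 B"
  unfolding tensor2_eq_kron by (subst kron_mult) (auto simp: mat_1_commute)

lemma tensor1_diff: "tensor1 (A - B) = tensor1 A - tensor1 B"
  and tensor2_diff: "tensor2 (A - B) = tensor2 A - tensor2 B"
  by (auto simp: vec_eq_iff tensor1_def tensor2_def)

lemma tensor1_mat: "tensor1 (mat 1) = mat 1" and tensor2_mat: "tensor2 (mat 1) = mat 1"
  by (auto simp: vec_eq_iff tensor1_def tensor2_def mat_def)

lemma tensor12_commute:
  assumes "\<And>i j k l. A $ i $ j * B $ k $ l = B $ k $ l * A $ i $ j"
  shows "tensor1 A ** tensor2 B = tensor2 B ** tensor1 (A :: 'a::ring_1 ^ 'n::finite ^ 'n)"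
  using assms by (auto simp: vec_eq_iff tensor12_nth tensor21_nth)

text \<open>For central x this is (x - P) A_1 B_2 = B_2 A_1 (x - P) read entry by entry. At x = 1
  the operator x - P is twice the antisymmetrizer.\<close>

definition rtt_pair :: "'a::ring_1 \<Rightarrow> 'a ^ 'n::finite ^ 'n \<Rightarrow> 'a ^ 'n ^ 'n \<Rightarrow> bool" where
  "rtt_pair x A B \<longleftrightarrow> (\<forall>i j k l. x * (A $ i $ j * B $ k $ l - B $ k $ l * A $ i $ j)
     = A $ k $ j * B $ i $ l - B $ k $ j * A $ i $ l)"

lemma mat_mult_nth: "(mat x ** M) $ p $ q = x * (M::'a::ring_1^_^_) $ p $ q"
  unfolding matrix_matrix_mult_def
  by (simp, subst sum_UNIV_single[of p]) (auto simp: mat_def)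

lemma mult_mat_nth: "(M ** mat x) $ p $ q = (M::'a::ring_1^_^_) $ p $ q * x"
  unfolding matrix_matrix_mult_def
  by (simp, subst sum_UNIV_single[of q]) (auto simp: mat_def)

lemma rtt_pairD:
  assumes "rtt_pair x A B" "\<And>z. x * z = z * x"
  shows "x * (A $ i $ j * B $ k $ l) - A $ k $ j * B $ i $ l = B $ k $ l * A $ i $ j * x - B $ k $ j * A $ i $ l"
  using assms(1)[unfolded rtt_pair_def, rule_format, of i j k l] assms(2)[of "B $ k $ l * A $ i $ j"]
  by (simp add: right_diff_distrib algebra_simps)

lemma rtt_pair_tensor:
  assumes "rtt_pair x A B" "\<And>z. x * z = z * x"
  shows "(mat x - perm_op) ** (tensor1 A ** tensor2 B) = (tensor2 B ** tensor1 A) ** (mat x - perm_op)"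
  using rtt_pairD[OF assms]
  by (auto simp: vec_eq_iff matrix_diff_rdistrib matrix_diff_ldistrib perm_op_mult_nth mult_perm_op_nth
      mat_mult_nth mult_mat_nth tensor12_nth tensor21_nth)

subsection \<open>The fourfold tensor power\<close>

type_synonym four = "(4 \<times> 4) \<times> (4 \<times> 4)"

definition f12 :: "four \<Rightarrow> four" where "f12 = (\<lambda>((i, j), (k, l)). ((j, i), (k, l)))"
definition f23 :: "four \<Rightarrow> four" where "f23 = (\<lambda>((i, j), (k, l)). ((i, k), (j, l)))"
definition f34 :: "four \<Rightarrow> four" where "f34 = (\<lambda>((i, j), (k, l)). ((i, j), (l, k)))"

lemma f_invol: "f12 (f12 x) = x" "f23 (f23 x) = x" "f34 (f34 x) = x"
  by (auto simp: f12_def f23_def f34_def split: prod.splits)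

lemma f23_pair: "f23 ((i, j), (k, l)) = ((i, k), (j, l))"
  by (simp add: f23_def)

definition sa :: "('a::ring_1, four) sqm" where "sa = Sq (pm f12)"
definition sb :: "('a::ring_1, four) sqm" where "sb = Sq (pm f23)"
definition sc :: "('a::ring_1, four) sqm" where "sc = Sq (pm f34)"

lemma fusion_perms_sqm:
  assumes "\<And>z. x * z = z * (x::'a::ring_1)"
  shows "fusion_perms sa sb sc (Sq (mat x) :: ('a, four) sqm)"
proof
  show "sa * sa = (1 :: ('a, four) sqm)" "sb * sb = (1 :: ('a, four) sqm)" "sc * sc = (1 :: ('a, four) sqm)"
    by (rule Sq_eqI, simp add: sa_def sb_def sc_def mx_simps pm_mult_pm o_def f_invol pm_id)+
  show "sa * sb * sa = sb * sa * (sb :: ('a, four) sqm)" "sc * sb * sc = sb * sc * (sb :: ('a, four) sqm)"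
    "sc * sa = sa * (sc :: ('a, four) sqm)"
    by (rule Sq_eqI, simp add: sa_def sb_def sc_def mx_simps pm_mult_pm, rule arg_cong[of _ _ pm],
        auto simp: fun_eq_iff f12_def f23_def f34_def)+
  fix z :: "('a, four) sqm"
  show "Sq (mat x) * z = z * Sq (mat x)"
    by (rule Sq_eqI) (simp add: mx_simps vec_eq_iff mat_mult_nth mult_mat_nth assms)
qed

definition sl1 :: "'a::ring_1 ^ 4 ^ 4 \<Rightarrow> ('a, four) sqm" where "sl1 M = Sq (tensor1 (tensor1 M))"
definition sl2 :: "'a::ring_1 ^ 4 ^ 4 \<Rightarrow> ('a, four) sqm" where "sl2 M = Sq (tensor1 (tensor2 M))"
definition sl3 :: "'a::ring_1 ^ 4 ^ 4 \<Rightarrow> ('a, four) sqm" where "sl3 M = Sq (tensor2 (tensor1 M))"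
definition sl4 :: "'a::ring_1 ^ 4 ^ 4 \<Rightarrow> ('a, four) sqm" where "sl4 M = Sq (tensor2 (tensor2 M))"

lemmas slot_defs = sl1_def sl2_def sl3_def sl4_def sa_def sb_def sc_def

lemma slot_commute:
  "sa * sl1 M = sl2 M * sa" "sa * sl2 M = sl1 M * sa" "sa * sl3 M = sl3 M * sa" "sa * sl4 M = sl4 M * sa"
  "sc * sl1 M = sl1 M * sc" "sc * sl2 M = sl2 M * sc" "sc * sl3 M = sl4 M * sc" "sc * sl4 M = sl3 M * sc"
  "sb * sl1 M = sl1 M * sb" "sb * sl4 M = sl4 M * sb"
  by (rule Sq_eqI, simp add: slot_defs mx_simps vec_eq_iff pm_mult_nth mult_pm_nth f_invol,
      auto simp: f12_def f23_def f34_def tensor1_def tensor2_def)+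

lemma slot23_nth:
  "mx (sl2 A * sl3 B) $ ((i, j), (k, l)) $ ((i', j'), (k', l')) = (if i = i' \<and> l = l' then A $ j $ j' * B $ k $ k' else 0)"
  "mx (sl3 B * sl2 A) $ ((i, j), (k, l)) $ ((i', j'), (k', l')) = (if i = i' \<and> l = l' then B $ k $ k' * A $ j $ j' else 0)"
  by (auto simp: slot_defs mx_simps tensor12_nth tensor21_nth) (auto simp: tensor1_def tensor2_def)

text \<open>Slots 2 and 3 lie in different pairs of the nested tensor square, so this relation is
  not the image under \<open>tensor1\<close> or \<open>tensor2\<close> of a relation on one pair, as
  it is for slots 12 and 34; it is checked on entries.\<close>

lemma slot23_rtt:
  assumes "rtt_pair x A B" "\<And>z. x * z = z * x"
  shows "(Sq (mat x) - sb) * (sl2 A * sl3 B) = sl3 B * sl2 A * (Sq (mat x) - sb)"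
proof (rule Sq_eqI)
  note rtt_pairD[OF assms]
  moreover have "mx ((Sq (mat x) - sb) * (sl2 A * sl3 B)) = mat x ** mx (sl2 A * sl3 B) - pm f23 ** mx (sl2 A * sl3 B)"
    "mx (sl3 B * sl2 A * (Sq (mat x) - sb)) = mx (sl3 B * sl2 A) ** mat x - mx (sl3 B * sl2 A) ** pm f23"
    by (simp_all only: times_sqm.rep_eq[of "Sq (mat x) - sb"] times_sqm.rep_eq[of "_ * _"] minus_sqm.rep_eq
        matrix_diff_rdistrib matrix_diff_ldistrib) (simp_all only: sb_def Sq_inverse[OF UNIV_I])
  ultimately show "mx ((Sq (mat x) - sb) * (sl2 A * sl3 B)) = mx (sl3 B * sl2 A * (Sq (mat x) - sb))"
    by (auto simp: vec_eq_iff mat_mult_nth mult_mat_nth pm_mult_nth mult_pm_nth[of f23, OF f_invol(2)] f23_pair slot23_nth)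
qed

lemma sa_eq: "sa = Sq (tensor1 perm_op)" and sc_eq: "sc = Sq (tensor2 perm_op)"
  by (auto simp: sa_def sc_def perm_op_eq_pm Sq_inject vec_eq_iff pm_def tensor1_def tensor2_def f12_def f34_def)

lemma slot12_rtt:
  assumes "rtt_pair 1 A B"
  shows "(1 - sa) * (sl1 A * sl2 B) = sl2 B * sl1 A * (1 - sa)"
    and "(1 - sc) * (sl3 A * sl4 B) = sl4 B * sl3 A * (1 - sc)"
proof -
  have *: "(mat 1 - perm_op) ** (tensor1 A ** tensor2 B) = (tensor2 B ** tensor1 A) ** (mat 1 - perm_op)"
    using rtt_pair_tensor[OF assms] by simp
  show "(1 - sa) * (sl1 A * sl2 B) = sl2 B * sl1 A * (1 - sa)"
    using arg_cong[OF *, of tensor1]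
    by (intro Sq_eqI) (simp only: mx_simps sa_eq slot_defs tensor1_mult tensor1_diff tensor1_mat)
  show "(1 - sc) * (sl3 A * sl4 B) = sl4 B * sl3 A * (1 - sc)"
    using arg_cong[OF *, of tensor2]
    by (intro Sq_eqI) (simp only: mx_simps sc_eq slot_defs tensor2_mult tensor2_diff tensor2_mat)
qed

lemma fusion_sqm:
  fixes S T S' T' :: "'a::ring_1 ^ 4 ^ 4"
  assumes x: "\<And>z. x * z = z * x"
    and "rtt_pair x S S'" "rtt_pair (x + 1) S T'" "rtt_pair (x - 1) T S'" "rtt_pair x T T'"
    and "rtt_pair 1 S T" "rtt_pair 1 S' T'"
  shows "fusion sa sb sc (Sq (mat x)) (sl1 S) (sl2 S) (sl1 T) (sl2 T) (sl3 S') (sl4 S') (sl3 T') (sl4 T')"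
proof -
  interpret fusion_perms sa sb sc "Sq (mat x) :: ('a, four) sqm"
    by (rule fusion_perms_sqm) (rule x)
  have "Sq (mat (x + 1)) = Sq (mat x) + (1 :: ('a, four) sqm)" "Sq (mat (x - 1)) = Sq (mat x) - (1 :: ('a, four) sqm)"
    by (rule Sq_eqI; auto simp: mx_simps vec_eq_iff mat_def)+
  moreover have "(x + 1) * z = z * (x + 1)" "(x - 1) * z = z * (x - 1)" for z
    by (simp_all add: distrib_left distrib_right left_diff_distrib right_diff_distrib x[of z])
  ultimately show ?thesis
    using slot23_rtt[OF assms(2) x] slot23_rtt[OF assms(5) x]
      slot23_rtt[OF assms(3)] slot23_rtt[OF assms(4)] slot12_rtt[OF assms(6)] slot12_rtt[OF assms(7)]
    by unfold_locales (simp_all add: slot_commute)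
qed

subsection \<open>The exterior square\<close>

lemma exhaust_6:
  fixes x :: 6
  shows "x = 1 \<or> x = 2 \<or> x = 3 \<or> x = 4 \<or> x = 5 \<or> x = 6"
proof (induct x)
  case (of_int z)
  then have "z = 0 \<or> z = 1 \<or> z = 2 \<or> z = 3 \<or> z = 4 \<or> z = 5" by fastforce
  then show ?case by auto
qed

lemma forall_6: "(\<forall>i::6. P i) \<longleftrightarrow> P 1 \<and> P 2 \<and> P 3 \<and> P 4 \<and> P 5 \<and> P 6"
  by (metis exhaust_6)

lemma UNIV_6: "UNIV = {1, 2, 3, 4, 5, 6::6}"
  using exhaust_6 by auto

lemma sum_6: "sum f (UNIV::6 set) = f 1 + f 2 + f 3 + f 4 + f 5 + f 6"
  unfolding UNIV_6 by (simp add: ac_simps)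

text \<open>The vector v_k is the wedge of the basis vectors \<open>wfst k\<close> and
  \<open>wsnd k\<close> in this order. The order 4, 2 for k = 5 makes the wedge of v_k and v_{7-k}
  equal to the same volume element for all k, so that Q appears without signs.\<close>

definition wfst :: "6 \<Rightarrow> 4" where
  "wfst k = (if k = 1 then 1 else if k = 2 then 1 else if k = 3 then 2 else if k = 4 then 1 else if k = 5 then 4 else 3)"

definition wsnd :: "6 \<Rightarrow> 4" where
  "wsnd k = (if k = 1 then 2 else if k = 2 then 3 else if k = 3 then 3 else if k = 4 then 4 else if k = 5 then 2 else 4)"

definition om :: "6 \<Rightarrow> 4 \<Rightarrow> 4 \<Rightarrow> 'a::ring_1" where
  "om k i j = (if i = wfst k \<and> j = wsnd k then 1 else 0) - (if i = wsnd k \<and> j = wfst k then 1 else 0)"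

text \<open>\<open>Om\<close> embeds the six-dimensional space as antisymmetric tensors and
  \<open>OmT\<close> is its transpose. \<open>sel\<close> and \<open>selT\<close> are one-sided
  inverses that read off one component of an antisymmetric tensor.\<close>

definition Om :: "'a::ring_1 ^ 6 ^ (4 \<times> 4)" where "Om = (\<chi> p k. om k (fst p) (snd p))"
definition OmT :: "'a::ring_1 ^ (4 \<times> 4) ^ 6" where "OmT = (\<chi> k p. om k (fst p) (snd p))"
definition sel :: "'a::ring_1 ^ (4 \<times> 4) ^ 6" where "sel = (\<chi> k p. if p = (wfst k, wsnd k) then 1 else 0)"
definition selT :: "'a::ring_1 ^ 6 ^ (4 \<times> 4)" where "selT = (\<chi> p k. if p = (wfst k, wsnd k) then 1 else 0)"

lemma om_values:
  "wfst 1 = 1" "wfst 2 = 1" "wfst 3 = 2" "wfst 4 = 1" "wfst 5 = 4" "wfst 6 = 3"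
  "wsnd 1 = 2" "wsnd 2 = 3" "wsnd 3 = 3" "wsnd 4 = 4" "wsnd 5 = 2" "wsnd 6 = 4"
  by (simp_all add: wfst_def wsnd_def)

lemma om_commute: "om k i j * x = x * om k i j"
proof -
  have "((if P then 1 else 0) - (if Q then 1 else 0)) * x = x * ((if P then 1 else 0) - (if Q then 1 else 0))" for P Q
    by (cases P; cases Q) simp_all
  then show ?thesis unfolding om_def .
qed

lemma sel_Om: "sel ** Om = (mat 1 :: 'a::ring_1 ^ 6 ^ 6)"
proof -
  have "(sel ** Om) $ k $ l = (om l (wfst k) (wsnd k) :: 'a)" for k l
    unfolding matrix_matrix_mult_def
    by (simp, subst sum_UNIV_single[of "(wfst k, wsnd k)"]) (auto simp: sel_def Om_def)
  moreover have "\<forall>k l. om l (wfst k) (wsnd k) = (if k = l then 1 else (0::'a))"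
    by (simp add: forall_6 om_values om_def)
  ultimately show ?thesis by (simp add: vec_eq_iff mat_def)
qed

lemma OmT_selT: "OmT ** selT = (mat 1 :: 'a::ring_1 ^ 6 ^ 6)"
proof -
  have "(OmT ** selT) $ l $ k = (om l (wfst k) (wsnd k) :: 'a)" for k l
    unfolding matrix_matrix_mult_def
    by (simp, subst sum_UNIV_single[of "(wfst k, wsnd k)"]) (auto simp: selT_def OmT_def)
  moreover have "\<forall>k l. om l (wfst k) (wsnd k) = (if l = k then 1 else (0::'a))"
    by (simp add: forall_6 om_values om_def)
  ultimately show ?thesis by (simp add: vec_eq_iff mat_def)
qed

lemma Om_OmT: "Om ** OmT = (mat 1 - perm_op :: 'a::ring_1 ^ (4 \<times> 4) ^ (4 \<times> 4))"
proof -
  have "(\<Sum>m\<in>UNIV. om m i j * om m k l) = (if i = k \<and> j = l then 1 else 0) - (if i = l \<and> j = k then 1 else (0::'a))" for i j k l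
    using exhaust_4[of i] exhaust_4[of j] by (elim disjE) (simp_all add: sum_6 om_def om_values)
  then show ?thesis
    by (simp add: vec_eq_iff matrix_matrix_mult_def Om_def OmT_def mat_def perm_op_def)
qed

text \<open>The matrix of 2 x 2 quantum minors when S is the shift of T. Under
  \<open>rtt_pair 1 S T\<close> the columns are antisymmetric, so one component determines them, and
  \<open>selT\<close> replaces half of \<open>Om\<close> without a division.\<close>

definition minors :: "'a::ring_1 ^ 4 ^ 4 \<Rightarrow> 'a ^ 4 ^ 4 \<Rightarrow> 'a ^ 6 ^ 6" where
  "minors S T = OmT ** (tensor1 S ** tensor2 T) ** selT"

lemma sum_OmT:
  "(\<Sum>p\<in>UNIV. OmT $ k $ p * f p) = f (wfst k, wsnd k) - (f (wsnd k, wfst k) :: 'a::ring_1)"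
proof -
  have "OmT $ k $ p = (if p = (wfst k, wsnd k) then 1 else 0) - (if p = (wsnd k, wfst k) then 1 else (0::'a))" for p
    by (cases p) (simp add: OmT_def om_def)
  then show ?thesis
    by (simp add: left_diff_distrib sum_subtractf if_distrib[of "\<lambda>x. x * _"] cong: if_cong)
qed

lemma OmT_mult_nth: "(OmT ** M) $ k $ q = M $ (wfst k, wsnd k) $ q - (M :: 'a::ring_1 ^ 'b ^ _) $ (wsnd k, wfst k) $ q"
  by (simp add: matrix_matrix_mult_def sum_OmT)

lemma mult_selT_nth: "(M ** selT) $ p $ k = (M :: 'a::ring_1 ^ _ ^ 'b) $ p $ (wfst k, wsnd k)"
  by (simp add: matrix_matrix_mult_def selT_def
      if_distrib[of "\<lambda>x. x * _"] if_distrib[of "\<lambda>x. _ * x"] cong: if_cong)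

lemma minors_nth:
  "minors S T $ k $ l = S $ wfst k $ wfst l * T $ wsnd k $ wsnd l - S $ wsnd k $ wfst l * T $ wfst k $ wsnd l"
  by (simp add: minors_def mult_selT_nth OmT_mult_nth tensor12_nth)

text \<open>Since 1 - P = \<open>Om ** OmT\<close>, the relation (1 - P) S_1 T_2 = T_2 S_1 (1 - P)
  factors. Multiplying by \<open>selT\<close> on the right gives the first identity, and cancelling
  \<open>Om\<close> on the left by \<open>sel\<close> the second.\<close>

lemma minors_intertwine:
  assumes "rtt_pair 1 S T"
  shows "Om ** minors S T = (tensor2 T ** tensor1 S) ** Om"
    and "minors S T ** OmT = OmT ** (tensor1 S ** tensor2 T)"
proof -
  have *: "Om ** OmT ** (tensor1 S ** tensor2 T) = (tensor2 T ** tensor1 S) ** (Om ** OmT)"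
    unfolding Om_OmT by (rule rtt_pair_tensor[OF assms]) simp
  have "Om ** minors S T = Om ** OmT ** (tensor1 S ** tensor2 T) ** selT"
    by (simp only: minors_def matrix_mul_assoc)
  also have "\<dots> = (tensor2 T ** tensor1 S) ** Om ** (OmT ** selT)"
    unfolding * by (simp only: matrix_mul_assoc)
  finally show 1: "Om ** minors S T = (tensor2 T ** tensor1 S) ** Om"
    by (simp only: OmT_selT matrix_mul_rid)
  have "Om ** (minors S T ** OmT) = (tensor2 T ** tensor1 S) ** (Om ** OmT)"
    unfolding matrix_mul_assoc 1 ..
  also have "\<dots> = Om ** (OmT ** (tensor1 S ** tensor2 T))"
    unfolding *[symmetric] by (simp only: matrix_mul_assoc)
  finally have "sel ** Om ** (minors S T ** OmT) = sel ** Om ** (OmT ** (tensor1 S ** tensor2 T))"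
    by (simp only: matrix_mul_assoc[symmetric])
  then show "minors S T ** OmT = OmT ** (tensor1 S ** tensor2 T)"
    by (simp only: sel_Om matrix_mul_lid)
qed

section \<open>Two exterior squares inside the fourfold tensor power\<close>

definition WW :: "'a::ring_1 ^ (6 \<times> 6) ^ four" where "WW = kron Om Om"
definition ZZ :: "'a::ring_1 ^ four ^ (6 \<times> 6)" where "ZZ = kron OmT OmT"

lemma ZZ_mult_nth:
  "(ZZ ** M) $ (k, l) $ q = M $ ((wfst k, wsnd k), (wfst l, wsnd l)) $ q - M $ ((wsnd k, wfst k), (wfst l, wsnd l)) $ q
    - (M $ ((wfst k, wsnd k), (wsnd l, wfst l)) $ q - (M :: 'a::ring_1 ^ 'b ^ four) $ ((wsnd k, wfst k), (wsnd l, wfst l)) $ q)"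
proof -
  have "(ZZ ** M) $ (k, l) $ q = (\<Sum>p\<in>UNIV. OmT $ k $ p * (\<Sum>p'\<in>UNIV. OmT $ l $ p' * M $ (p, p') $ q))"
    by (simp add: matrix_matrix_mult_def ZZ_def kron_def sum_UNIV_pair[where 'b = "4 \<times> 4"] sum_distrib_left mult.assoc)
  then show ?thesis by (simp add: sum_OmT)
qed

text \<open>This is where Q enters: compressed to the product of two exterior squares, the
  transposition (23) becomes 1 + P - Q. The identity is verified by evaluating all entries.\<close>

lemma ZZ_f23_WW: "ZZ ** (pm f23 ** WW) = (mat 1 + perm_op - Q_op :: 'a::ring_1 ^ (6 \<times> 6) ^ (6 \<times> 6))"
proof -
  let ?s = "\<lambda>k l m n. om m (wfst k) (wfst l) * om n (wsnd k) (wsnd l) - om m (wsnd k) (wfst l) * om n (wfst k) (wsnd l)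
     - (om m (wfst k) (wsnd l) * om n (wsnd k) (wfst l) - om m (wsnd k) (wsnd l) * om n (wfst k) (wfst l) :: 'a)"
  have "(pm f23 ** WW) $ ((i, j), (k, l)) $ (m, n) = (om m i k * om n j l :: 'a)" for i j k l m n
    by (simp add: pm_mult_nth f23_pair WW_def kron_def Om_def)
  then have "(ZZ ** (pm f23 ** WW)) $ (k, l) $ (m, n) = ?s k l m n" for k l m n
    by (simp add: ZZ_mult_nth)
  moreover have "\<forall>m n. ?s k l m n
     = (if k = m \<and> l = n then 1 else 0) + (if k = n \<and> l = m then 1 else 0) - (if l = 7 - k \<and> n = 7 - m then 1 else 0)" for k l
    using exhaust_6[of k] exhaust_6[of l]
    by (elim disjE) (simp_all add: forall_6 om_def om_values)
  ultimately show ?thesis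
    unfolding vec_eq_iff split_paired_All by (auto simp: mat_def perm_op_def Q_op_def)
qed

lemma WW_ZZ: "WW ** ZZ = tensor1 (mat 1 - perm_op) ** tensor2 (mat 1 - perm_op :: 'a::ring_1 ^ (4 \<times> 4) ^ (4 \<times> 4))"
proof -
  have "WW ** ZZ = kron (Om ** OmT) (Om ** OmT :: 'a ^ (4 \<times> 4) ^ (4 \<times> 4))"
    unfolding WW_def ZZ_def by (rule kron_mult) (simp only: Om_def vec_lambda_beta, rule om_commute)
  then show ?thesis
    unfolding Om_OmT by (simp add: vec_eq_iff tensor12_nth kron_def del: vector_minus_component)
qed

text \<open>The flip of the two pairs of slots, that is, the permutation (13)(24).\<close>

definition f1324 :: "four \<Rightarrow> four" where "f1324 = (\<lambda>(p, q). (q, p))"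

lemma ZZ_f1324: "ZZ ** pm f1324 = perm_op ** (ZZ :: 'a::ring_1 ^ four ^ (6 \<times> 6))"
proof -
  have "f1324 (f1324 x) = x" for x by (auto simp: f1324_def split: prod.splits)
  then have "(ZZ ** pm f1324) $ (k, l) $ (p, q) = (perm_op ** ZZ :: 'a ^ four ^ (6 \<times> 6)) $ (k, l) $ (p, q)" for k l p q
    by (simp add: mult_pm_nth[of f1324] perm_op_mult_nth) (simp add: f1324_def ZZ_def kron_def OmT_def, rule om_commute)
  then show ?thesis by (simp add: vec_eq_iff)
qed

lemma WW_left_inverse: "kron sel sel ** WW = (mat 1 :: 'a::ring_1 ^ (6 \<times> 6) ^ (6 \<times> 6))"
proof -
  have "kron sel sel ** WW = kron (sel ** Om) (sel ** Om :: 'a ^ 6 ^ 6)"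
    unfolding WW_def by (rule kron_mult) (simp add: sel_def)
  then show ?thesis by (auto simp: sel_Om vec_eq_iff kron_def mat_def)
qed

lemma ZZ_right_inverse: "ZZ ** kron selT selT = (mat 1 :: 'a::ring_1 ^ (6 \<times> 6) ^ (6 \<times> 6))"
proof -
  have "ZZ ** kron selT selT = kron (OmT ** selT) (OmT ** selT :: 'a ^ 6 ^ 6)"
    unfolding ZZ_def by (rule kron_mult) (simp add: selT_def)
  then show ?thesis by (auto simp: OmT_selT vec_eq_iff kron_def mat_def)
qed

lemma WW_tensor:
  assumes "Om ** N = M ** (Om :: 'a::ring_1 ^ 6 ^ (4 \<times> 4))"
  shows "WW ** tensor1 N = tensor1 M ** WW" "WW ** tensor2 N = tensor2 M ** WW"
proof -
  have c: "Om $ p $ k * x = x * Om $ p $ k" for p k and x :: 'a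
    by (simp only: Om_def vec_lambda_beta, rule om_commute)
  have c': "x * Om $ p $ k = Om $ p $ k * x" for p k and x :: 'a
    by (rule c[symmetric])
  show "WW ** tensor1 N = tensor1 M ** WW" "WW ** tensor2 N = tensor2 M ** WW"
    unfolding WW_def tensor1_eq_kron tensor2_eq_kron
    by (simp_all only: kron_mult[OF c] kron_mult[OF c'] kron_mult[OF mat_1_commute] assms matrix_mul_lid matrix_mul_rid)
qed

lemma ZZ_tensor:
  assumes "N ** OmT = (OmT :: 'a::ring_1 ^ (4 \<times> 4) ^ 6) ** M"
  shows "tensor1 N ** ZZ = ZZ ** tensor1 M" "tensor2 N ** ZZ = ZZ ** tensor2 M"
proof -
  have c: "OmT $ k $ p * x = x * OmT $ k $ p" for p k and x :: 'a
    by (simp only: OmT_def vec_lambda_beta, rule om_commute)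
  have c': "x * OmT $ k $ p = OmT $ k $ p * x" for p k and x :: 'a
    by (rule c[symmetric])
  show "tensor1 N ** ZZ = ZZ ** tensor1 M" "tensor2 N ** ZZ = ZZ ** tensor2 M"
    unfolding ZZ_def tensor1_eq_kron tensor2_eq_kron
    by (simp_all only: kron_mult[OF c] kron_mult[OF c'] kron_mult[OF mat_1_commute] assms matrix_mul_lid matrix_mul_rid)
qed

lemma mat_commute:
  assumes "\<And>z. x * z = z * (x::'a::ring_1)"
  shows "mat x ** A = A ** mat x"
  by (simp add: vec_eq_iff mat_mult_nth mult_mat_nth assms)

lemma mat_mult_mat: "mat x ** mat y = (mat (x * y) :: 'a::ring_1 ^ 'n ^ 'n)"
  by (simp add: vec_eq_iff mat_mult_nth) (simp add: mat_def)

lemma mat_diff_mat: "mat x - mat y = (mat (x - y) :: 'a::ring_1 ^ 'n ^ 'n)"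
  by (simp add: vec_eq_iff mat_def)

text \<open>The orthogonal R-matrix at d, multiplied by d (d - 2).\<close>

definition R_so6_poly :: "'a::ring_1 \<Rightarrow> 'a ^ (6 \<times> 6) ^ (6 \<times> 6)" where
  "R_so6_poly d = mat (d * (d - 2)) - mat (d - 2) ** perm_op + mat d ** Q_op"

text \<open>Write W and Z for \<open>WW\<close> and \<open>ZZ\<close>. As e = W Z, inserting Q = 1 +
  P - Z b W gives W Q Z = e + e w - e b e, the last bracket in \<open>kappa\<close>; the other terms
  use Z w = P Z.\<close>

lemma mx_kappa:
  assumes d: "\<And>z. d * z = z * (d::'a::ring_1)"
  shows "mx (fusion_perms.kappa sa sb sc (Sq (mat d))) = WW ** (R_so6_poly d ** ZZ)"
proof -
  interpret fusion_perms sa sb sc "Sq (mat d) :: ('a, four) sqm"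
    by (rule fusion_perms_sqm) (rule d)
  have d2: "(d - 2) * z = z * (d - 2)" for z
    by (simp only: left_diff_distrib right_diff_distrib d[of z] numeral_central[of _ z])
  have dd2: "d * (d - 2) * z = z * (d * (d - 2))" for z
    by (metis d d2 mult.assoc)
  have e: "mx e = WW ** ZZ"
    unfolding WW_ZZ e_def by (simp add: mx_simps sa_eq sc_eq tensor1_diff tensor2_diff tensor1_mat tensor2_mat)
  have w: "mx w = pm f1324"
    unfolding w_def by (simp add: mx_simps sa_def sb_def sc_def pm_mult_pm)
      (rule arg_cong[of _ _ pm], auto simp: fun_eq_iff f12_def f23_def f34_def f1324_def)
  have two: "mx (2 :: ('a, four) sqm) = mat 2"
    by (simp add: mx_simps vec_eq_iff mat_def flip: one_add_one)
  have m1: "mx (Sq (mat d) * (Sq (mat d) - 2)) = (mat (d * (d - 2)) :: 'a ^ four ^ four)"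
    and m2: "mx (Sq (mat d) - 2) = (mat (d - 2) :: 'a ^ four ^ four)"
    by (simp_all only: mx_simps two mat_mult_mat mat_diff_mat)
  have mats: "WW ** (mat (d * (d - 2)) ** A) = mat (d * (d - 2)) ** (WW ** A)"
    "WW ** (mat (d - 2) ** A) = mat (d - 2) ** (WW ** A)"
    "WW ** (mat d ** A) = mat d ** (WW ** A)" for A :: "'a ^ 'b::finite ^ (6 \<times> 6)"
    by (metis dd2 mat_commute matrix_mul_assoc, metis d2 mat_commute matrix_mul_assoc, metis d mat_commute matrix_mul_assoc)
  have Q: "(Q_op :: 'a ^ (6 \<times> 6) ^ (6 \<times> 6)) = mat 1 + perm_op - ZZ ** (pm f23 ** WW)"
    by (simp only: ZZ_f23_WW) simp
  have "WW ** (Q_op ** ZZ) = (WW ** ZZ :: 'a ^ four ^ four) + WW ** ZZ ** pm f1324 - WW ** ZZ ** pm f23 ** (WW ** ZZ)"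
    by (simp only: Q matrix_diff_rdistrib matrix_add_rdistrib' matrix_diff_ldistrib matrix_add_ldistrib
        matrix_mul_lid matrix_mul_assoc[symmetric] ZZ_f1324)
  moreover have "mx (e - e * sb * e + e * w) = WW ** ZZ - WW ** ZZ ** pm f23 ** (WW ** ZZ) + WW ** ZZ ** pm f1324"
    by (simp only: mx_simps e w) (simp only: sb_def mx_simps)
  ultimately have 3: "mx (e - e * sb * e + e * w) = WW ** (Q_op ** ZZ)"
    by simp
  have "mx kappa = mat (d * (d - 2)) ** (WW ** ZZ) - mat (d - 2) ** (WW ** ZZ ** pm f1324) + mat d ** (WW ** (Q_op ** ZZ))"
    by (simp only: kappa_def times_sqm.rep_eq[of "Sq (mat d) * (Sq (mat d) - 2)"] times_sqm.rep_eq[of "Sq (mat d) - 2"]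
        times_sqm.rep_eq[of "Sq (mat d)" "e - e * sb * e + e * w"] minus_sqm.rep_eq[of "_ * e"] plus_sqm.rep_eq[of "_ - _" "Sq (mat d) * _"]
        m1 m2 3 times_sqm.rep_eq[of e w] e w Sq_inverse[OF UNIV_I])
  also have "\<dots> = WW ** (R_so6_poly d ** ZZ)"
    by (simp only: R_so6_poly_def matrix_diff_rdistrib matrix_add_rdistrib' matrix_diff_ldistrib matrix_add_ldistrib
        matrix_mul_assoc[symmetric] ZZ_f1324 mats)
  finally show ?thesis .
qed

lemma minors_rtt:
  fixes S T S' T' :: "'a::ring_1 ^ 4 ^ 4"
  assumes d: "\<And>z. d * z = z * d"
    and pairs: "rtt_pair d S S'" "rtt_pair (d + 1) S T'" "rtt_pair (d - 1) T S'" "rtt_pair d T T'"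
      "rtt_pair 1 S T" "rtt_pair 1 S' T'"
    and inv: "y * (d * (d + 1)) = 1"
  shows "R_so6_poly d ** (tensor1 (minors S T) ** tensor2 (minors S' T'))
    = (tensor2 (minors S' T') ** tensor1 (minors S T)) ** R_so6_poly d"
proof -
  let ?N = "minors S T" and ?N' = "minors S' T'" and ?D = "mat (d * (d + 1)) :: 'a ^ four ^ four"
  let ?R = "R_so6_poly d"
  interpret fusion sa sb sc "Sq (mat d)" "sl1 S" "sl2 S" "sl1 T" "sl2 T" "sl3 S'" "sl4 S'" "sl3 T'" "sl4 T'"
    by (rule fusion_sqm[OF d pairs])
  let ?A = "tensor1 (tensor1 S ** tensor2 T)" and ?A' = "tensor2 (tensor1 S' ** tensor2 T')"
  let ?B = "tensor1 (tensor2 T ** tensor1 S)" and ?B' = "tensor2 (tensor2 T' ** tensor1 S')"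
  have "d * (d + 1) * z = z * (d * (d + 1))" for z
  proof -
    have "(d + 1) * z = z * (d + 1)" for z by (simp add: distrib_left distrib_right d[of z])
    then show ?thesis by (metis d mult.assoc)
  qed
  then have Dc: "?D ** A = A ** ?D" for A by (rule mat_commute)
  have two: "mx (Sq (mat d) * (Sq (mat d) + 1)) = ?D"
    by (simp only: mx_simps) (simp add: vec_eq_iff mat_mult_nth, simp add: mat_def)
  have "mx (kappa * (Sq (mat d) * (Sq (mat d) + 1))) = ?D ** (WW ** (?R ** ZZ))"
    by (simp only: times_sqm.rep_eq[of kappa] two mx_kappa[OF d] Dc)
  then have "?D ** (WW ** (?R ** ZZ)) ** (?A ** ?A') = ?B' ** ?B ** (?D ** (WW ** (?R ** ZZ)))"
    using arg_cong[OF fused_rtt_abstract, of mx]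
    by (simp only: times_sqm.rep_eq[of "kappa * _"] times_sqm.rep_eq[of _ "kappa * _"])
      (simp only: mx_simps slot_defs tensor1_mult tensor2_mult matrix_mul_assoc)
  then have "?D ** (WW ** (?R ** ZZ) ** (?A ** ?A')) = ?D ** (?B' ** ?B ** (WW ** (?R ** ZZ)))"
    by (simp only: matrix_mul_assoc Dc[of "?B' ** ?B", symmetric])
  then have "mat y ** ?D ** (WW ** (?R ** ZZ) ** (?A ** ?A')) = mat y ** ?D ** (?B' ** ?B ** (WW ** (?R ** ZZ)))"
    by (simp only: matrix_mul_assoc[symmetric])
  then have eq: "WW ** (?R ** ZZ) ** (?A ** ?A') = ?B' ** ?B ** (WW ** (?R ** ZZ))"
    by (simp only: mat_mult_mat inv matrix_mul_lid)
  note N = minors_intertwine[OF pairs(5)] and N' = minors_intertwine[OF pairs(6)]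
  have "ZZ ** ?A ** ?A' = tensor1 ?N ** tensor2 ?N' ** ZZ"
    unfolding ZZ_tensor(1)[OF N(2), symmetric] matrix_mul_assoc[symmetric] ZZ_tensor(2)[OF N'(2), symmetric] ..
  then have l: "WW ** (?R ** ZZ) ** (?A ** ?A') = WW ** (?R ** (tensor1 ?N ** tensor2 ?N')) ** ZZ"
    by (simp only: matrix_mul_assoc[symmetric])
  have "?B' ** ?B ** WW = WW ** (tensor2 ?N' ** tensor1 ?N)"
    unfolding matrix_mul_assoc[symmetric] WW_tensor(1)[OF N(1), symmetric]
    unfolding matrix_mul_assoc WW_tensor(2)[OF N'(1), symmetric] ..
  then have r: "?B' ** ?B ** (WW ** (?R ** ZZ)) = WW ** ((tensor2 ?N' ** tensor1 ?N) ** ?R) ** ZZ"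
    by (simp only: matrix_mul_assoc)
  have cancel: "U = V" if "WW ** U ** ZZ = WW ** V ** ZZ" for U V :: "'a ^ (6 \<times> 6) ^ (6 \<times> 6)"
  proof -
    have "kron sel sel ** WW ** U ** (ZZ ** kron selT selT) = kron sel sel ** WW ** V ** (ZZ ** kron selT selT)"
      using arg_cong[OF that, of "\<lambda>X. kron sel sel ** (X ** kron selT selT)"]
      by (simp only: matrix_mul_assoc)
    then show ?thesis by (simp only: WW_left_inverse ZZ_right_inverse matrix_mul_lid matrix_mul_rid)
  qed
  from eq show ?thesis unfolding l r by (rule cancel)
qed

subsection \<open>The fused generator matrix\<close>

lemma (in ring_1_hom) rtt_pair_map: "rtt_pair x A B \<Longrightarrow> rtt_pair (h x) (map_matrix h A) (map_matrix h B)"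
  unfolding rtt_pair_def by (simp flip: hom_mult hom_diff)

lemma rtt_pair_from_fps2:
  assumes "(Y2 - X2 + of_int k * (X2 * Y2)) * C = X2 * Y2 * P"
  shows "(uu - vv + of_int k) * fps2_to_fls2 C = fps2_to_fls2 (P :: 'a::ring_1 fps fps)"
proof -
  have h: "(yv - xu + of_int k * (xu * yv)) * fps2_to_fls2 C = xu * yv * fps2_to_fls2 P"
    using arg_cong[OF assms, of fps2_to_fls2]
    by (simp only: fps2_to_fls2.hom_mult fps2_to_fls2.hom_diff fps2_to_fls2.hom_add fps2_to_fls2.hom_of_int
        fps2_to_fls2_X fps2_to_fls2_Y)
  have c: "of_int k * z = z * of_int k" for z :: "'a fls fls"
    by (metis mult_of_int_commute)
  have "xu * yv * (uu - vv + of_int k) = (yv - xu + of_int k * (xu * yv) :: 'a fls fls)"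
    by (simp only: distrib_left xy_uv c)
  with h have "xu * yv * ((uu - vv + of_int k) * fps2_to_fls2 C) = xu * yv * fps2_to_fls2 P"
    by (simp only: mult.assoc[symmetric])
  then have "vv * (uu * (xu * yv * ((uu - vv + of_int k) * fps2_to_fls2 C))) = vv * (uu * (xu * yv * fps2_to_fls2 P))"
    by simp
  moreover have "vv * (uu * (xu * yv * z)) = z" for z :: "'a fls fls"
    by (metis uu_xu(1) vv_yv(1) mult.assoc mult_1_left)
  ultimately show ?thesis by simp
qed

section \<open>Shifting and specialising the spectral parameters\<close>

lemma X2_Y2: "X2 * Y2 = Y2 * X2"
  by (rule X2_central)

lemma shift_v_X_eq: "(1 + Y2) * shift_v Y2 = Y2"
  using arg_cong[OF shift_one_X_eq, of fps_v]
  by (simp add: shift_v_fps_v flip: fps_const_mult fps_const_add fps_const_1_eq_1)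

text \<open>The relation \<open>rtt_pair\<close> at u - v + m with its denominator cleared. In this
  form it lives in power series and can be shifted and restricted to u = v.\<close>

definition fps2_rel :: "int \<Rightarrow> 'a::ring_1 fps ^ 'n::finite ^ 'n \<Rightarrow> 'a fps ^ 'n ^ 'n \<Rightarrow> bool" where
  "fps2_rel m A B \<longleftrightarrow> (\<forall>i j k l. (Y2 - X2 + of_int m * (X2 * Y2)) *
     (fps_u (A $ i $ j) * fps_v (B $ k $ l) - fps_v (B $ k $ l) * fps_u (A $ i $ j))
     = X2 * Y2 * (fps_u (A $ k $ j) * fps_v (B $ i $ l) - fps_v (B $ k $ j) * fps_u (A $ i $ l)))"

lemma fps2_rel_rtt_pair:
  "fps2_rel m A B \<Longrightarrow> rtt_pair (uu - vv + of_int m) (map_matrix series_u A) (map_matrix series_v B)"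
  unfolding fps2_rel_def rtt_pair_def
  using rtt_pair_from_fps2[of m]
  by (fastforce simp: fps2_to_fls2.hom_diff fps2_to_fls2.hom_mult fps2_to_fls2_u fps2_to_fls2_v)

lemma fps2_rel_shift_u:
  assumes "fps2_rel 0 A B"
  shows "fps2_rel 1 (map_matrix shift_one A) B"
  unfolding fps2_rel_def nth_map_matrix
proof (intro allI)
  fix i j k l
  let ?C = "fps_u (shift_one (A $ i $ j)) * fps_v (B $ k $ l) - fps_v (B $ k $ l) * fps_u (shift_one (A $ i $ j))"
  let ?P = "fps_u (shift_one (A $ k $ j)) * fps_v (B $ i $ l) - fps_v (B $ k $ j) * fps_u (shift_one (A $ i $ l))"
  have "(Y2 - shift_one X2) * ?C = shift_one X2 * Y2 * ?P"
    using arg_cong[OF assms[unfolded fps2_rel_def, rule_format, of i j k l], of shift_one]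
    by (simp add: shift_one.hom_mult shift_one.hom_diff shift_one_fps_u shift_one_fps_v)
  \<comment> \<open>The shift of u replaces x by x / (1 + x). Multiplication by 1 + x turns y - x /
    (1 + x) into y - x + x y.\<close>
  then have "(1 + X2) * (Y2 - shift_one X2) * ?C = (1 + X2) * shift_one X2 * Y2 * ?P"
    by (simp only: mult.assoc)
  moreover have "(1 + X2) * (Y2 - shift_one X2) = (Y2 - X2 + X2 * Y2 :: 'a fps fps)"
    by (simp only: right_diff_distrib shift_one_X_eq) (simp add: distrib_right)
  ultimately show "(Y2 - X2 + of_int 1 * (X2 * Y2)) * ?C = X2 * Y2 * ?P"
    by (simp only: shift_one_X_eq of_int_1 mult_1_left)
qed

lemma fps2_rel_shift_v:
  assumes "fps2_rel m A B"
  shows "fps2_rel (m - 1) A (map_matrix shift_one B)"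
  unfolding fps2_rel_def nth_map_matrix
proof (intro allI)
  fix i j k l
  let ?t = "shift_v Y2 :: 'a fps fps"
  let ?C = "fps_u (A $ i $ j) * fps_v (shift_one (B $ k $ l)) - fps_v (shift_one (B $ k $ l)) * fps_u (A $ i $ j)"
  let ?P = "fps_u (A $ k $ j) * fps_v (shift_one (B $ i $ l)) - fps_v (shift_one (B $ k $ j)) * fps_u (A $ i $ l)"
  have "shift_v X2 = (X2 :: 'a fps fps)"
    by (metis fps_u_X shift_v_fps_u)
  then have "(?t - X2 + of_int m * (X2 * ?t)) * ?C = X2 * ?t * ?P"
    using arg_cong[OF assms[unfolded fps2_rel_def, rule_format, of i j k l], of shift_v]
    by (simp only: shift_v.hom_mult shift_v.hom_diff shift_v.hom_add shift_v.hom_of_int) (simp only: shift_v_fps_u shift_v_fps_v)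
  \<comment> \<open>Likewise y becomes y / (1 + y), and multiplication by 1 + y yields y - x (1 + y)
    + m x y, which lowers m by one.\<close>
  then have "(1 + Y2) * (?t - X2 + of_int m * (X2 * ?t)) * ?C = (1 + Y2) * (X2 * ?t) * ?P"
    by (simp only: mult.assoc)
  moreover have xt: "(1 + Y2) * (X2 * ?t) = X2 * Y2"
    by (metis X2_central mult.assoc shift_v_X_eq)
  moreover have "(1 + Y2) * (of_int m * (X2 * ?t)) = of_int m * (X2 * Y2)"
    by (metis mult_of_int_commute mult.assoc xt)
  then have "(1 + Y2) * (?t - X2 + of_int m * (X2 * ?t)) = Y2 - X2 + of_int (m - 1) * (X2 * Y2)"
    by (simp only: right_diff_distrib distrib_left shift_v_X_eq) (simp add: distrib_right left_diff_distrib X2_Y2)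
  ultimately show "(Y2 - X2 + of_int (m - 1) * (X2 * Y2)) * ?C = X2 * Y2 * ?P"
    by (simp only:)
qed

lemma fps_X_cancel: "fps_X * f = fps_X * g \<Longrightarrow> f = (g :: 'a::ring_1 fps)"
  by (metis fps_ext fps_X_mult_nth diff_Suc_1 nat.distinct(1))

text \<open>At u = v both y - x + x y and x y become x^2, which can be cancelled. What remains is
  the relation at the spectral difference 1, where the R-matrix degenerates to 1 - P.\<close>

lemma fps2_rel_diag:
  assumes "fps2_rel 1 A B"
  shows "rtt_pair 1 A B"
  unfolding rtt_pair_def
proof (intro allI)
  fix i j k l
  have d: "diag X2 = fps_X" "diag Y2 = fps_X"
    by (metis fps_u_X diag_fps_u) (rule diag_fps_v)
  have "fps_X * (fps_X * (A $ i $ j * B $ k $ l - B $ k $ l * A $ i $ j))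
     = fps_X * (fps_X * (A $ k $ j * B $ i $ l - B $ k $ j * A $ i $ l))"
    using arg_cong[OF assms[unfolded fps2_rel_def, rule_format, of i j k l], of diag]
    by (simp add: diag.hom_mult diag.hom_diff diag.hom_add diag_fps_u diag_fps_v d mult.assoc)
  then show "1 * (A $ i $ j * B $ k $ l - B $ k $ l * A $ i $ j) = A $ k $ j * B $ i $ l - B $ k $ j * A $ i $ l"
    by (metis fps_X_cancel mult_1_left)
qed

abbreviation fused_minors :: "'a::ring_1 fps ^ 4 ^ 4 \<Rightarrow> 'a fps ^ 6 ^ 6" where
  "fused_minors T \<equiv> minors (map_matrix shift_one T) T"

lemma map_minors: "ring_1_hom h \<Longrightarrow> map_matrix h (minors S T) = minors (map_matrix h S) (map_matrix h T)"
  by (simp add: vec_eq_iff minors_nth ring_1_hom.hom_diff ring_1_hom.hom_mult)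

lemma uv_central: "(uu - vv + of_int k) * z = z * (uu - vv + of_int k)"
  by (simp only: left_diff_distrib right_diff_distrib distrib_left distrib_right uu_central[of z] vv_central[of z]
      mult_of_int_commute[of k z])

lemma R_so6_poly_eq: "R_so6_poly (uu - vv) = mat ((uu - vv) * (uu - vv - 2)) ** (R_so6 :: 'a::ring_1 fls fls ^ (6 \<times> 6) ^ (6 \<times> 6))"
proof -
  have m: "map_matrix ((*) x) A = mat x ** A" for x and A :: "'a fls fls ^ (6 \<times> 6) ^ (6 \<times> 6)"
    by (simp add: vec_eq_iff mat_mult_nth)
  have "(uu - vv) * (uu - vv - 2) = (uu - vv - 2) * (uu - vv :: 'a fls fls)"
    using uv_central[of 0] by simp
  then have "(uu - vv) * (uu - vv - 2) * D0 = (uu - vv - 2 :: 'a fls fls)"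
    by (simp only: mult.assoc D0_eq mult_1_right)
  moreover have "(uu - vv) * (uu - vv - 2) * D2 = (uu - vv :: 'a fls fls)"
    by (simp only: mult.assoc D2_eq mult_1_right)
  ultimately show ?thesis
    unfolding R_so6_poly_def R_so6_def
    by (simp only: m matrix_diff_ldistrib matrix_add_ldistrib matrix_mul_assoc mat_mult_mat matrix_mul_rid)
qed

text \<open>The four slots carry the arguments u + 1, u, v + 1, v. All relations between the pairs
  come from the given one by shifting u, v or both; those inside a pair come from its specialisation
  at difference 1. Finally d (d - 2) is divided out of the polynomial R-matrix.\<close>

lemma rtt_minors:
  fixes T :: "'a::ring_1 fps ^ 4 ^ 4"
  assumes "rtt_defect R_gl4 T = 0"
  shows "rtt_pair 1 (map_matrix shift_one T) T"
    and "rtt_defect R_so6 (fused_minors T) = 0"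
proof -
  let ?S = "map_matrix shift_one T"
  let ?d = "uu - vv :: 'a fls fls"
  let ?Nu = "minors (map_matrix series_u ?S) (map_matrix series_u T)"
  let ?Nv = "minors (map_matrix series_v ?S) (map_matrix series_v T)"
  have TT: "fps2_rel 0 T T"
    using rtt_gl4_polynomial[OF assms] by (simp add: fps2_rel_def)
  have ST: "fps2_rel 1 ?S T" by (rule fps2_rel_shift_u[OF TT])
  show ST1: "rtt_pair 1 ?S T" by (rule fps2_rel_diag[OF ST])
  have d: "?d * z = z * ?d" for z
    using uv_central[of 0] by simp
  \<comment> \<open>The first factor expands (u - v + 1)^{-1}, with w = v - 1, and \<open>D0\<close>
    expands (u - v)^{-1}.\<close>
  have inv: "inverse_u_minus (fls_X_inv + of_int (-1)) * D0 * (?d * (?d + 1)) = 1"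
  proof -
    have "?d * (?d + 1) = (?d + 1) * ?d" by (rule d)
    moreover have "D0 * ?d = 1" by (metis D0_eq d)
    moreover have "inverse_u_minus (fls_X_inv + of_int (-1)) * (?d + 1) = 1"
    proof -
      have "?d - of_int (-1) = ?d + 1" by simp
      then have "(?d + 1) * inverse_u_minus (fls_X_inv + of_int (-1)) = 1"
        using inverse_u_minus_shifted[of "-1", where 'a = 'a] by (simp only:)
      then show ?thesis
        using uv_central[of 1 "inverse_u_minus (fls_X_inv + of_int (-1)) :: 'a fls fls"] by (metis of_int_1)
    qed
    ultimately show ?thesis by (metis d mult.assoc mult_1_right)
  qed
  have "R_so6_poly ?d ** (tensor1 ?Nu ** tensor2 ?Nv) = (tensor2 ?Nv ** tensor1 ?Nu) ** R_so6_poly ?d"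
  proof (rule minors_rtt[OF d _ _ _ _ _ _ inv])
    show "rtt_pair ?d (map_matrix series_u T) (map_matrix series_v T)"
      using fps2_rel_rtt_pair[OF TT] by simp
    show "rtt_pair (?d + 1) (map_matrix series_u ?S) (map_matrix series_v T)"
      using fps2_rel_rtt_pair[OF ST] by simp
    show "rtt_pair (?d - 1) (map_matrix series_u T) (map_matrix series_v ?S)"
      using fps2_rel_rtt_pair[OF fps2_rel_shift_v[OF TT]] by simp
    show "rtt_pair ?d (map_matrix series_u ?S) (map_matrix series_v ?S)"
      using fps2_rel_rtt_pair[OF fps2_rel_shift_v[OF ST]] by simp
    show "rtt_pair 1 (map_matrix series_u ?S) (map_matrix series_u T)"
      using series_u.rtt_pair_map[OF ST1] by (simp add: series_u.hom_one)
    show "rtt_pair 1 (map_matrix series_v ?S) (map_matrix series_v T)"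
      using series_v.rtt_pair_map[OF ST1] by (simp add: series_v.hom_one)
  qed
  then have eq: "R_so6_poly ?d ** (tensor1 (map_matrix series_u (minors ?S T)) ** tensor2 (map_matrix series_v (minors ?S T)))
    = (tensor2 (map_matrix series_v (minors ?S T)) ** tensor1 (map_matrix series_u (minors ?S T))) ** R_so6_poly ?d" (is "_ ** ?A = ?B ** _")
    by (simp only: map_minors[OF ring_1_hom_series_u] map_minors[OF ring_1_hom_series_v])
  let ?m = "?d * (?d - 2)"
  have "(?d - 2) * z = z * (?d - 2)" for z
    using uv_central[of "-2" z] by simp
  then have "?m * z = z * ?m" for z by (metis d mult.assoc)
  then have mc: "mat ?m ** C = C ** mat ?m" for C :: "'a fls fls ^ (6 \<times> 6) ^ (6 \<times> 6)" by (rule mat_commute)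
  have "D2 * D0 * ?m = 1"
    by (metis D0_eq D2_eq D0_central D2_central mult.assoc mult_1_right)
  then have inv2: "mat (D2 * D0) ** (mat ?m ** C) = C" for C :: "'a fls fls ^ (6 \<times> 6) ^ (6 \<times> 6)"
    by (simp only: matrix_mul_assoc mat_mult_mat matrix_mul_lid)
  have "mat ?m ** (R_so6 ** ?A) = mat ?m ** (?B ** R_so6)"
    using eq unfolding R_so6_poly_eq by (simp only: matrix_mul_assoc mc[of ?B, symmetric])
  then have "R_so6 ** ?A = ?B ** R_so6"
    using arg_cong[of _ _ "\<lambda>C. mat (D2 * D0) ** C"] inv2 by metis
  then show "rtt_defect R_so6 (minors ?S T) = 0"
    by (simp add: rtt_defect_alt)
qed

lemma shift_one_nth_0: "fps_nth (shift_one f) 0 = fps_nth f 0"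
  by (simp add: shift_one_nth)

lemma minors_nth_0:
  assumes "\<And>i j. fps_nth (T $ i $ j) 0 = (if i = j then 1 else 0)"
  shows "fps_nth (fused_minors T $ k $ l) 0 = (if k = l then 1 else 0)"
  using exhaust_6[of k] exhaust_6[of l]
  by (elim disjE) (simp_all add: minors_nth shift_one_nth_0 assms om_values)

section \<open>The fused matrix as an operator on the exterior square\<close>

lemma ring_1_hom_constant_series: "ring_1_hom constant_series"
  unfolding constant_series_def[abs_def]
  by (rule ring_1_hom_comp[OF ring_1_hom_fps_const ring_1_hom_of_complex])

lemma constant_series_central: "constant_series c * f = f * constant_series c"
  by (simp add: constant_series_def fps_eq_iff of_complex_commute)

lemma fused_left_eq: "fused_left = mat (constant_series (1 / 2)) ** ((mat 1 - perm_op) ** (tensor1 (map_matrix shift_one T_gl4) ** tensor2 T_gl4))"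
  and fused_right_eq: "fused_right = (tensor2 T_gl4 ** tensor1 (map_matrix shift_one T_gl4)) ** (mat 1 - perm_op) ** mat (constant_series (1 / 2))"
proof -
  interpret c: ring_1_hom constant_series by (rule ring_1_hom_constant_series)
  have a: "map_matrix constant_series antisymmetrizer = mat (constant_series (1 / 2)) ** (mat 1 - perm_op)"
    unfolding antisymmetrizer_def c.map_matrix_scale c.map_matrix_diff c.map_matrix_one c.map_matrix_perm_op
    by (simp add: vec_eq_iff mat_mult_nth)
  show "fused_left = mat (constant_series (1 / 2)) ** ((mat 1 - perm_op) ** (tensor1 (map_matrix shift_one T_gl4) ** tensor2 T_gl4))"
    unfolding fused_left_def a by (simp only: matrix_mul_assoc)
  show "fused_right = (tensor2 T_gl4 ** tensor1 (map_matrix shift_one T_gl4)) ** (mat 1 - perm_op) ** mat (constant_series (1 / 2))"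
    unfolding fused_right_def a
    by (simp only: matrix_mul_assoc mat_commute[OF constant_series_central])
qed

lemma fused_left_eq_right: "fused_left = fused_right"
proof -
  have "(mat 1 - perm_op) ** (tensor1 (map_matrix shift_one T_gl4) ** tensor2 T_gl4)
     = (tensor2 T_gl4 ** tensor1 (map_matrix shift_one T_gl4)) ** (mat 1 - perm_op)"
    by (rule rtt_pair_tensor[OF rtt_minors(1)[OF gl4.rtt]]) simp
  then show ?thesis
    unfolding fused_left_eq fused_right_eq by (simp only: mat_commute[OF constant_series_central])
qed

text \<open>In the form \<open>fused_right\<close> the antisymmetrizer acts first and fixes the
  columns of \<open>Om\<close>; the intertwining property of the minors does the rest. The
  normalisation \<open>c\<close> is central and factors out.\<close>

lemma fused_left_acts:
  "acts_on_exterior_square_by c fused_left (fused_minors T_gl4)"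
proof -
  let ?h = "constant_series (1 / 2) :: Y_gl4 fps"
  let ?N = "fused_minors T_gl4"
  interpret c: ring_1_hom "constant_series :: complex \<Rightarrow> Y_gl4 fps" by (rule ring_1_hom_constant_series)
  have swap: "om k j i = - (om k i j :: Y_gl4 fps)" for k i j
    by (simp only: om_def minus_diff_eq conj_commute)
  have hh: "?h + ?h = 1"
    unfolding c.hom_add[symmetric] by (simp add: c.hom_one)
  have half: "?h * (x + x) = x" for x :: "Y_gl4 fps"
    by (simp only: distrib_left distrib_right[symmetric] hh mult_1_left)
  have h2: "?h * (om k i j - om k j i) = om k i j" for k i j
    using half[of "om k i j"] swap[of k j i] by (simp only: diff_minus_eq_add)
  have "mat ?h ** ((mat 1 - perm_op) ** Om) = (Om :: Y_gl4 fps ^ 6 ^ (4 \<times> 4))"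
    by (simp add: vec_eq_iff mat_mult_nth matrix_diff_rdistrib perm_op_mult_nth Om_def h2)
  then have "(mat 1 - perm_op) ** mat ?h ** Om = (Om :: Y_gl4 fps ^ 6 ^ (4 \<times> 4))"
    unfolding mat_commute[OF constant_series_central, of _ "mat 1 - perm_op", symmetric]
    by (simp only: matrix_mul_assoc)
  then have "fused_left ** Om = Om ** ?N"
    unfolding fused_left_eq_right fused_right_eq minors_intertwine(1)[OF rtt_minors(1)[OF gl4.rtt]]
    by (simp only: matrix_mul_assoc[symmetric])
  then have *: "(\<Sum>q\<in>UNIV. fused_left $ p $ q * om l (fst q) (snd q)) = (\<Sum>k\<in>UNIV. om k (fst p) (snd p) * ?N $ k $ l)" for p l
    by (cases p) (simp add: vec_eq_iff matrix_matrix_mult_def Om_def)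
  have w: "wedge_basis_series c k $ p = (constant_series c :: Y_gl4 fps) * om k (fst p) (snd p)" for k p
  proof -
    have "wedge_basis c k $ p = c * om k (fst p) (snd p)"
      using exhaust_6[of k] by (cases p) (elim disjE; simp add: wedge_basis_def wedge_def om_def om_values axis_def)
    moreover have "constant_series (om k i j) = (om k i j :: Y_gl4 fps)" for i j
    proof -
      have "constant_series ((if P then 1 else 0) - (if Q then 1 else 0)) = ((if P then 1 else 0) - (if Q then 1 else 0) :: Y_gl4 fps)" for P Q
        by (cases P; cases Q) (simp_all only: if_True if_False c.hom_diff c.hom_one c.hom_zero)
      then show ?thesis unfolding om_def .
    qed
    ultimately show ?thesis by (simp only: wedge_basis_series_def c.hom_mult vec_lambda_beta)
  qed
  show ?thesis
    unfolding acts_on_exterior_square_by_def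
  proof (intro allI, simp only: vec_eq_iff, intro allI)
    fix l p
    have "(fused_left *v wedge_basis_series c l) $ p = (\<Sum>q\<in>UNIV. constant_series c * (fused_left $ p $ q * om l (fst q) (snd q)))"
      unfolding matrix_vector_mult_def vec_lambda_beta w
      by (intro sum.cong refl) (metis constant_series_central mult.assoc)
    also have "\<dots> = (\<Sum>k\<in>UNIV. constant_series c * (om k (fst p) (snd p) * ?N $ k $ l))"
      by (simp only: sum_distrib_left[symmetric] *)
    also have "\<dots> = (\<Sum>k\<in>UNIV. ?N $ k $ l * (constant_series c * om k (fst p) (snd p)))"
      by (intro sum.cong refl)
        (simp only: om_commute[of _ _ _ "?N $ _ $ l"] mult.assoc[symmetric] constant_series_central[of c "?N $ _ $ l"])
    also have "\<dots> = (\<Sum>k\<in>UNIV. ?N $ k $ l *s wedge_basis_series c k) $ p"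
      by (simp add: w)
    finally show "(fused_left *v wedge_basis_series c l) $ p = (\<Sum>k\<in>UNIV. ?N $ k $ l *s wedge_basis_series c k) $ p" .
  qed
qed

lemma fusion_hom:
  obtains \<phi> where "alg_hom \<phi>" "map_matrix (fps_map \<phi>) T_so6 = fused_minors T_gl4"
  using so6.lift[OF ring_1_hom.map_matrix_R_so6 minors_nth_0[OF gl4.T_nth_0] rtt_minors(2)[OF gl4.rtt]] by blast

subsection \<open>Filtrations by weighted products\<close>

text \<open>The label set is a parameter, so that the full filtration (\<open>UNIV\<close>) and the
  products of generators with smaller superscripts (\<open>below r\<close>) are instances of one
  notion.\<close>

inductive_set filt :: "('i \<Rightarrow> 'a::complex_algebra_1) \<Rightarrow> ('i \<Rightarrow> nat) \<Rightarrow> 'i set \<Rightarrow> nat \<Rightarrow> 'a set"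
  for g wt I d where
  zero: "0 \<in> filt g wt I d"
| prod: "set ms \<subseteq> I \<Longrightarrow> sum_list (map wt ms) \<le> d \<Longrightarrow> c *\<^sub>C prod_list (map g ms) \<in> filt g wt I d"
| add: "x \<in> filt g wt I d \<Longrightarrow> y \<in> filt g wt I d \<Longrightarrow> x + y \<in> filt g wt I d"

lemma filt_mono:
  assumes "x \<in> filt g wt I d" "d \<le> d'" "I \<subseteq> I'"
  shows "x \<in> filt g wt I' d'"
  using assms(1)
proof induction
  case (prod ms c)
  then show ?case using assms by (intro filt.prod) auto
qed (auto intro: filt.intros)

lemma filt_scale: "x \<in> filt g wt I d \<Longrightarrow> c *\<^sub>C x \<in> filt g wt I d"
  by (induction rule: filt.induct) (auto simp: scaleC_add_right scaleC_scaleC intro: filt.intros)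

lemma filt_uminus: "x \<in> filt g wt I d \<Longrightarrow> - x \<in> filt g wt I d"
  using filt_scale[of x g wt I d "-1"] by (simp add: scaleC_minus_one)

lemma filt_diff: "x \<in> filt g wt I d \<Longrightarrow> y \<in> filt g wt I d \<Longrightarrow> x - y \<in> filt g wt I d"
  using filt.add[OF _ filt_uminus] by (metis diff_conv_add_uminus)

lemma filt_sum: "(\<And>i. i \<in> A \<Longrightarrow> f i \<in> filt g wt I d) \<Longrightarrow> sum f A \<in> filt g wt I d"
  by (induction A rule: infinite_finite_induct) (auto intro: filt.intros)

lemma filt_gen: "i \<in> I \<Longrightarrow> wt i \<le> d \<Longrightarrow> g i \<in> filt g wt I d"
  using filt.prod[of "[i]" I wt d 1 g] by (simp add: scaleC_one)

lemma filt_of_complex: "of_complex c \<in> filt g wt I d"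
  using filt.prod[of "[]" I wt d c g] by (simp add: of_complex_def)

lemma filt_of_int: "of_int n \<in> filt g wt I d"
  using filt_of_complex[of "of_int n" g wt I d] by (simp add: of_complex_of_int)

lemma filt_one: "1 \<in> filt g wt I d"
  using filt_of_int[of 1] by simp

lemma filt_mult:
  assumes "x \<in> filt g wt I d" "y \<in> filt g wt I e"
  shows "x * y \<in> filt g wt I (d + e)"
  using assms(1)
proof induction
  case (prod ms c)
  show ?case using assms(2)
  proof induction
    case (prod ns c')
    then show ?case
      using \<open>set ms \<subseteq> I\<close> \<open>sum_list (map wt ms) \<le> d\<close> filt.prod[of "ms @ ns" I wt "d + e" "c * c'" g]
      by (simp add: scaleC_mult_left scaleC_mult_right scaleC_scaleC mult.commute[of c' c])
  qed (auto simp: distrib_left intro: filt.intros)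
qed (auto simp: distrib_right intro: filt.intros)

lemma filt_mult_le:
  "x \<in> filt g wt I d \<Longrightarrow> y \<in> filt g wt I e \<Longrightarrow> d + e \<le> r \<Longrightarrow> x * y \<in> filt g wt I r"
  by (rule filt_mono[OF filt_mult]) auto

lemma filt_prod_list:
  assumes "\<And>i. i \<in> set ms \<Longrightarrow> g i \<in> filt g' wt' I' (wt i)"
  shows "prod_list (map g ms) \<in> filt g' wt' I' (sum_list (map wt ms))"
  using assms by (induction ms) (auto intro: filt_one filt_mult)

lemma filt_subst:
  assumes "\<And>i. i \<in> I \<Longrightarrow> g i \<in> filt g' wt' I' (wt i)" "x \<in> filt g wt I d"
  shows "x \<in> filt g' wt' I' d"
  using assms(2)
proof induction
  case (prod ms c)
  then show ?case
    by (intro filt_scale filt_mono[OF filt_prod_list[of ms g g' wt' I' wt]]) (auto intro: assms(1))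
qed (auto intro: filt.intros)

text \<open>Products are lifted factor by factor, so the weight bound survives.\<close>

lemma filt_hom_lift:
  assumes "alg_hom h" "\<And>i. i \<in> I \<Longrightarrow> \<exists>x\<in>filt g' wt' I' (wt i). h x = g i" "y \<in> filt g wt I d"
  shows "\<exists>x\<in>filt g' wt' I' d. h x = y"
proof -
  interpret alg_hom h by fact
  obtain f where f: "f i \<in> filt g' wt' I' (wt i)" "h (f i) = g i" if "i \<in> I" for i
    using assms(2) by metis
  show ?thesis using assms(3)
  proof induction
    case zero
    then show ?case using filt.zero hom_zero by blast
  next
    case (prod ms c)
    have "c *\<^sub>C prod_list (map f ms) \<in> filt g' wt' I' d"
      using prod f by (intro filt_scale filt_mono[OF filt_prod_list[of ms f g' wt' I' wt]]) auto
    moreover have "map (h \<circ> f) ms = map g ms"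
      using prod f by (intro map_cong) auto
    then have "h (c *\<^sub>C prod_list (map f ms)) = c *\<^sub>C prod_list (map g ms)"
      by (simp only: hom_scaleC hom_prod_list map_map)
    ultimately show ?case by blast
  next
    case (add x y)
    then show ?case by (metis filt.add hom_add)
  qed
qed

subsection \<open>Leading terms of the coefficients\<close>

definition gen :: "'a fps ^ 'n::finite ^ 'n \<Rightarrow> 'n \<times> 'n \<times> nat \<Rightarrow> 'a" where
  "gen T = (\<lambda>(i, j, s). fps_nth (T $ i $ j) (Suc s))"

definition wt :: "'n \<times> 'n \<times> nat \<Rightarrow> nat" where
  "wt = (\<lambda>(i, j, s). Suc s)"

definition below :: "nat \<Rightarrow> ('n \<times> 'n \<times> nat) set" where
  "below r = {(i, j, s). Suc s < r}"

text \<open>The error terms at superscript r: the total weight may still reach r, but every single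
  factor has a smaller superscript.\<close>

abbreviation low :: "'a::complex_algebra_1 fps ^ 'n::finite ^ 'n \<Rightarrow> nat \<Rightarrow> 'a set" where
  "low T r \<equiv> filt (gen T) wt (below r) r"

definition leading :: "'a::complex_algebra_1 fps ^ 'n::finite ^ 'n \<Rightarrow> nat \<Rightarrow> 'a fps \<Rightarrow> complex \<Rightarrow> 'a \<Rightarrow> bool" where
  "leading T r A \<alpha> a \<longleftrightarrow> fps_nth A 0 = of_complex \<alpha> \<and> (\<forall>m<r. fps_nth A m \<in> filt (gen T) wt (below r) m) \<and>
     fps_nth A r - a \<in> low T r"

lemma leading_gen:
  assumes "\<And>i j. fps_nth (T $ i $ j) 0 = (if i = j then 1 else 0)"
  shows "leading T r (T $ i $ j) (if i = j then 1 else 0) (fps_nth (T $ i $ j) r)"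
proof -
  have "fps_nth (T $ i $ j) m \<in> filt (gen T) wt (below r) m" if "m < r" for m
  proof (cases m)
    case 0
    then show ?thesis by (simp add: assms filt_one filt.zero)
  next
    case (Suc n)
    then show ?thesis
      using filt_gen[of "(i, j, n)" "below r" wt m "gen T"] that by (simp add: gen_def wt_def below_def)
  qed
  then show ?thesis by (simp add: leading_def assms of_complex_def scaleC_one filt.zero)
qed

text \<open>The coefficient of u^{-r} in (u + 1)^{-r} is 1, and every other contribution involves
  only earlier coefficients of the series.\<close>

lemma leading_shift_one:
  assumes "leading T r A \<alpha> a"
  shows "leading T r (shift_one A) \<alpha> a"
proof -
  let ?F = "filt (gen T) wt (below r)"
  have k: "fps_nth (shift_kernel ^ i :: 'a fps) n \<in> ?F 0" for i n
  proof -
    define K :: "int fps" where "K = shift_kernel"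
    interpret h: ring_1_hom "of_int :: int \<Rightarrow> 'a" by unfold_locales auto
    interpret h': ring_1_hom "fps_map (of_int :: int \<Rightarrow> 'a)" by (rule h.ring_1_hom_fps_map)
    have "shift_kernel = fps_map (of_int :: int \<Rightarrow> 'a) K"
      by (rule fps_ext) (simp add: K_def shift_kernel_def)
    then have "shift_kernel ^ i = fps_map (of_int :: int \<Rightarrow> 'a) (K ^ i)"
      by (simp add: h'.hom_power)
    then show ?thesis by (simp add: filt_of_int)
  qed
  have m: "fps_nth (shift_one A) m \<in> ?F m" if "m < r" for m
    unfolding shift_one_nth
  proof (rule filt_sum)
    fix i assume "i \<in> {0..m}"
    then have "i < r" "i \<le> m" using that by auto
    with assms show "fps_nth A i * fps_nth (shift_kernel ^ i) m \<in> ?F m"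
      by (intro filt_mult_le[of _ "gen T" wt "below r" i _ 0]) (auto simp: leading_def k)
  qed
  have "fps_nth (shift_one A) r - fps_nth A r = (\<Sum>i<r. fps_nth A i * fps_nth (shift_kernel ^ i) r)"
    by (simp add: shift_one_nth atLeast0AtMost lessThan_Suc_atMost[symmetric] shift_kernel_power_nth_self)
  also have "\<dots> \<in> ?F r"
  proof (rule filt_sum)
    fix i assume "i \<in> {..<r}"
    with assms show "fps_nth A i * fps_nth (shift_kernel ^ i) r \<in> ?F r"
      by (intro filt_mult_le[of _ "gen T" wt "below r" i _ 0]) (auto simp: leading_def k)
  qed
  finally have "(fps_nth (shift_one A) r - fps_nth A r) + (fps_nth A r - a) \<in> ?F r"
    using assms by (intro filt.add) (auto simp: leading_def)
  with m assms show ?thesis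
    by (auto simp: leading_def shift_one_nth_0)
qed

text \<open>In the Cauchy product only the two extreme summands involve coefficients of index r, and
  there the other factor is a scalar.\<close>

lemma leading_mult:
  assumes "leading T r A \<alpha> a" "leading T r B \<beta> b" "r > 0"
  shows "fps_nth (A * B) r - (\<beta> *\<^sub>C a + \<alpha> *\<^sub>C b) \<in> low T r"
proof -
  have "{0..r} = insert 0 (insert r {0<..<r})" using assms(3) by auto
  then have "fps_nth (A * B) r = fps_nth A 0 * fps_nth B r + (fps_nth A r * fps_nth B 0 +
      (\<Sum>i\<in>{0<..<r}. fps_nth A i * fps_nth B (r - i)))"
    using assms(3) by (simp add: fps_mult_nth)
  then have "fps_nth (A * B) r - (\<beta> *\<^sub>C a + \<alpha> *\<^sub>C b) = \<alpha> *\<^sub>C (fps_nth B r - b) + \<beta> *\<^sub>C (fps_nth A r - a)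
      + (\<Sum>i\<in>{0<..<r}. fps_nth A i * fps_nth B (r - i))"
    using assms(1,2) scaleC_add_right[of \<alpha> "fps_nth B r - b" b] scaleC_add_right[of \<beta> "fps_nth A r - a" a]
    by (simp add: leading_def of_complex_mult mult_of_complex)
  also have "\<dots> \<in> low T r"
  proof (intro filt.add filt_scale filt_sum)
    fix i assume "i \<in> {0<..<r}"
    with assms(1,2) show "fps_nth A i * fps_nth B (r - i) \<in> low T r"
      by (intro filt_mult_le[of _ "gen T" wt "below r" i _ "r - i"]) (auto simp: leading_def)
  qed (use assms in \<open>auto simp: leading_def\<close>)
  finally show ?thesis .
qed

subsection \<open>Generators as images of generators\<close>

lemma scaleC_diff_right: "c *\<^sub>C (x - y) = c *\<^sub>C x - c *\<^sub>C (y :: 'a::complex_algebra_1)"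
  using scaleC_add_right[of c "x - y" y] by (simp add: algebra_simps)

lemma half_eq: "y = x + x \<Longrightarrow> (1 / 2) *\<^sub>C y = (x :: 'a::complex_algebra_1)"
  using scaleC_add_left[of "1/2" "1/2" x] by (simp add: scaleC_add_right scaleC_one)

text \<open>The matrix by which a 4 x 4 matrix acts on the exterior square as a derivation; it is
  the linear part of the quantum minors.\<close>

definition lin :: "(4 \<Rightarrow> 4 \<Rightarrow> 'a::ring_1) \<Rightarrow> 6 \<Rightarrow> 6 \<Rightarrow> 'a" where
  "lin f k l = (if wsnd k = wsnd l then f (wfst k) (wfst l) else 0) + (if wfst k = wfst l then f (wsnd k) (wsnd l) else 0)
    - ((if wfst k = wsnd l then f (wsnd k) (wfst l) else 0) + (if wsnd k = wfst l then f (wfst k) (wsnd l) else 0))"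

lemma minors_leading:
  fixes T :: "'a::complex_algebra_1 fps ^ 4 ^ 4"
  assumes T0: "\<And>i j. fps_nth (T $ i $ j) 0 = (if i = j then 1 else 0)" and "r > 0"
  shows "fps_nth (fused_minors T $ k $ l) r - lin (\<lambda>i j. fps_nth (T $ i $ j) r) k l \<in> low T r"
proof -
  note L = leading_mult[OF leading_shift_one[OF leading_gen[OF T0]] leading_gen[OF T0] assms(2)]
  have if_scaleC: "(if b then 1 else 0) *\<^sub>C x = (if b then x else 0)" for b and x :: 'a
    by (simp add: scaleC_one)
  show ?thesis
    using filt_diff[OF L[of "wfst k" "wfst l" "wsnd k" "wsnd l"] L[of "wsnd k" "wfst l" "wfst k" "wsnd l"]]
    unfolding if_scaleC by (simp add: minors_nth lin_def algebra_simps)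
qed

text \<open>A left inverse of \<open>lin\<close>. The off-diagonal entries are read off, up to sign,
  where a single summand of \<open>lin\<close> survives; the diagonal ones solve for f_11, ..., f_44
  from f_11 + f_22, f_11 + f_33, f_22 + f_33 and f_11 + f_44.\<close>

definition unlin :: "(6 \<Rightarrow> 6 \<Rightarrow> 'a::complex_algebra_1) \<Rightarrow> 4 \<Rightarrow> 4 \<Rightarrow> 'a" where
  "unlin f i j = (if (i, j) = (1, 1) then (1 / 2) *\<^sub>C (f 1 1 + f 2 2 - f 3 3)
    else if (i, j) = (2, 2) then (1 / 2) *\<^sub>C (f 1 1 + f 3 3 - f 2 2)
    else if (i, j) = (3, 3) then (1 / 2) *\<^sub>C (f 2 2 + f 3 3 - f 1 1)
    else if (i, j) = (4, 4) then f 4 4 - (1 / 2) *\<^sub>C (f 1 1 + f 2 2 - f 3 3)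
    else if (i, j) = (1, 2) then f 2 3
    else if (i, j) = (1, 3) then - f 1 3
    else if (i, j) = (1, 4) then f 1 5
    else if (i, j) = (2, 1) then f 3 2
    else if (i, j) = (2, 3) then f 1 2
    else if (i, j) = (2, 4) then f 1 4
    else if (i, j) = (3, 1) then - f 3 1
    else if (i, j) = (3, 2) then f 2 1
    else if (i, j) = (3, 4) then f 2 4
    else if (i, j) = (4, 1) then f 5 1
    else if (i, j) = (4, 2) then f 4 1
    else f 4 2)"

lemma unlin_lin: "unlin (lin f) i j = f i j"
proof -
  have d: "(1 / 2) *\<^sub>C (a + b + (a + c) - (b + c)) = a" for a b c :: 'a
    by (rule half_eq) simp
  have d2: "(1 / 2) *\<^sub>C (a + b + (b + c) - (a + c)) = b" for a b c :: 'a
    by (rule half_eq) simp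
  have d3: "(1 / 2) *\<^sub>C (a + c + (b + c) - (a + b)) = c" for a b c :: 'a
    by (rule half_eq) simp
  have *: "lin f 1 1 = f 1 1 + f 2 2" "lin f 2 2 = f 1 1 + f 3 3" "lin f 3 3 = f 2 2 + f 3 3" "lin f 4 4 = f 1 1 + f 4 4"
    by (simp_all add: lin_def om_values)
  have diag: "unlin (lin f) 1 1 = f 1 1" "unlin (lin f) 2 2 = f 2 2" "unlin (lin f) 3 3 = f 3 3" "unlin (lin f) 4 4 = f 4 4"
    by (simp_all only: unlin_def * prod.inject simp_thms if_True if_False d)
      (simp_all add: d d2 d3 half_eq[OF refl])
  show ?thesis
    using exhaust_4[of i] exhaust_4[of j]
    by (elim disjE) (simp_all only: diag, simp_all add: unlin_def lin_def om_values)
qed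

lemma unlin_diff: "unlin f i j - unlin g i j = unlin (\<lambda>k l. f k l - g k l) i j"
  unfolding unlin_def by (simp add: scaleC_diff_right scaleC_add_right)

lemma unlin_filt: "(\<And>k l. f k l \<in> filt g w I d) \<Longrightarrow> unlin f i j \<in> filt g w I d"
  using exhaust_4[of i] exhaust_4[of j]
  by (elim disjE) (simp_all add: unlin_def filt_scale filt.add filt_diff filt_uminus)

lemma (in alg_hom) hom_unlin: "h (unlin f i j) = unlin (\<lambda>k l. h (f k l)) i j"
  unfolding unlin_def by (simp add: hom_scaleC hom_add hom_diff hom_uminus)

text \<open>By induction on the superscript: \<open>unlin\<close> inverts the leading part, and the
  remaining error is built from generators with smaller superscripts, which already have preimages
  of the right weight. Keeping the correction in \<open>low\<close> later allows the passage between
  these preimages and the generators.\<close>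

lemma gen_lift_exists:
  fixes \<phi> :: "X_so6 \<Rightarrow> Y_gl4"
  assumes "alg_hom \<phi>" and N: "map_matrix (fps_map \<phi>) T_so6 = fused_minors T_gl4"
  shows "\<exists>z\<in>low T_so6 (Suc n). \<phi> (unlin (\<lambda>k l. fps_nth (T_so6 $ k $ l) (Suc n)) i j + z) = fps_nth (T_gl4 $ i $ j) (Suc n)"
proof (induction n arbitrary: i j rule: less_induct)
  case (less n)
  interpret alg_hom \<phi> by fact
  let ?r = "Suc n"
  let ?x = "\<lambda>n k l. fps_nth (T_so6 $ k $ l) (Suc n)" and ?t = "\<lambda>i j. fps_nth (T_gl4 $ i $ j) ?r"
  have phi: "\<phi> (?x n k l) = fps_nth (fused_minors T_gl4 $ k $ l) ?r" for k l
    using arg_cong[OF N, of "\<lambda>M. fps_nth (M $ k $ l) ?r"] by simp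
  have lift: "\<exists>x\<in>filt (gen T_so6) wt (below ?r) (wt m). \<phi> x = gen T_gl4 m" if m: "m \<in> below ?r" for m
  proof -
    obtain i j p where m_eq: "m = (i, j, p)" by (cases m)
    with m have p: "p < n" by (simp add: below_def)
    from less[OF this] obtain z where z: "z \<in> low T_so6 (Suc p)" "\<phi> (unlin (?x p) i j + z) = fps_nth (T_gl4 $ i $ j) (Suc p)"
      by blast
    have "?x p k l \<in> filt (gen T_so6) wt (below ?r) (Suc p)" for k l
      using filt_gen[of "(k, l, p)" "below ?r" wt "Suc p" "gen T_so6"] p by (simp add: gen_def wt_def below_def)
    then have "unlin (?x p) i j + z \<in> filt (gen T_so6) wt (below ?r) (Suc p)"
      using p by (intro filt.add unlin_filt filt_mono[OF z(1)]) (auto simp: below_def)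
    with z(2) show ?thesis by (auto simp: m_eq wt_def gen_def)
  qed
  have "?t i j - \<phi> (unlin (?x n) i j) = - unlin (\<lambda>k l. \<phi> (?x n k l) - lin ?t k l) i j"
    by (simp add: hom_unlin unlin_lin flip: unlin_diff)
  also have "\<dots> \<in> low T_gl4 ?r"
    unfolding phi by (intro filt_uminus unlin_filt minors_leading gl4.T_nth_0) simp
  finally have mem: "?t i j - \<phi> (unlin (?x n) i j) \<in> low T_gl4 ?r" .
  have "\<exists>z\<in>low T_so6 ?r. \<phi> z = ?t i j - \<phi> (unlin (?x n) i j)"
    by (rule filt_hom_lift[OF assms(1) _ mem]) (rule lift)
  then obtain z where z: "z \<in> low T_so6 ?r" "\<phi> z = ?t i j - \<phi> (unlin (?x n) i j)" ..
  then have "\<phi> (unlin (?x n) i j + z) = ?t i j" by (simp only: hom_add) simp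
  with z(1) show ?case ..
qed

lemma fusion_hom_surj:
  fixes \<phi> :: "X_so6 \<Rightarrow> Y_gl4"
  assumes "alg_hom \<phi>" and N: "map_matrix (fps_map \<phi>) T_so6 = fused_minors T_gl4"
  shows "surj \<phi>"
proof -
  interpret alg_hom \<phi> by fact
  have "\<exists>x. y = \<phi> x" for y
  proof (induction y rule: gl4.generators_induct)
    case zero show ?case by (metis hom_zero)
  next
    case (add x y) then show ?case by (metis hom_add)
  next
    case (prod c ws)
    have "\<exists>x. prod_list (map (\<lambda>(i, j, s). fps_nth (T_gl4 $ i $ j) (Suc s)) ws) = \<phi> x"
    proof (induction ws)
      case Nil show ?case using hom_one by (metis list.map(1) prod_list.Nil)
    next
      case (Cons a ws)
      obtain i j s where "a = (i, j, s)" by (cases a)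
      with Cons gen_lift_exists[OF assms, of s i j] show ?case by simp (metis hom_mult)
    qed
    then show ?case by (metis hom_scaleC)
  qed
  then show ?thesis by (auto simp: surj_def)
qed

subsection \<open>Orthogonality in the extended orthogonal Yangian\<close>

lemma double_cancel: "x + x = 0 \<Longrightarrow> x = (0 :: 'a::complex_algebra_1)"
  using half_eq[of "x + x" x] by simp

lemma shift_two_X: "(1 + 2 * fps_X) * shift_one (shift_one fps_X) = (fps_X :: 'a::ring_1 fps)"
proof -
  have 1: "(1 + shift_one fps_X) * shift_one (shift_one fps_X) = (shift_one fps_X :: 'a fps)"
    using arg_cong[OF shift_one_X_eq, of shift_one] by (simp only: shift_one.hom_mult shift_one.hom_add shift_one.hom_one)
  have "(1 + fps_X) * (1 + shift_one fps_X) = (1 + fps_X + fps_X :: 'a fps)"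
    by (simp only: distrib_left mult_1_right shift_one_X_eq)
  then have "(1 + 2 * fps_X) * shift_one (shift_one fps_X) = (1 + fps_X) * ((1 + shift_one fps_X) * shift_one (shift_one fps_X) :: 'a fps)"
    by (simp only: mult.assoc[symmetric] mult_2 add.assoc)
  then show ?thesis by (simp only: 1 shift_one_X_eq)
qed

text \<open>The cleared RTT relation at u = v + 2, where the factor for u - v - 2 vanishes and only
  the Q terms are left. There y - x becomes twice a product of non-zero-divisors, so cancelling it
  uses division by 2. For k = 7 - i the identity says that the transpose of T(v + 2) for the form,
  times T(v), is a scalar.\<close>

lemma so6_orthogonality:
  fixes T :: "'a::complex_algebra_1 fps ^ 6 ^ 6"
  assumes "rtt_defect R_so6 T = 0"
  defines "U \<equiv> map_matrix (\<lambda>f. shift_one (shift_one f)) T"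
  shows "(if k = 7 - i then \<Sum>p\<in>UNIV. U $ p $ j * T $ (7 - p) $ l else 0)
    = (if l = 7 - j then \<Sum>p\<in>UNIV. T $ k $ (7 - p) * U $ i $ p else 0)" (is "?q1 = ?q2")
proof -
  interpret H: ring_1_hom "\<lambda>F :: 'a fps fps. diag (shift_one (shift_one F))"
    by (rule ring_1_hom_comp[OF ring_1_hom_diag ring_1_hom_comp[OF ring_1_hom_shift_one ring_1_hom_shift_one]])
  let ?s = "shift_one (shift_one fps_X) :: 'a fps"
  have u: "diag (shift_one (shift_one (fps_u f))) = shift_one (shift_one f)" for f :: "'a fps"
    by (simp add: shift_one_fps_u diag_fps_u)
  have v: "diag (shift_one (shift_one (fps_v f))) = f" for f :: "'a fps"
    by (simp add: shift_one_fps_v diag_fps_v)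
  have x: "diag (shift_one (shift_one (X2 :: 'a fps fps))) = ?s"
    by (metis fps_u_X u)
  have two: "diag (shift_one (shift_one (2 :: 'a fps fps))) = 2"
    using H.hom_of_int[of 2] by simp
  have "?s * fps_X = fps_X * ?s" by (rule fps_mult_fps_X_commute[symmetric])
  then have ys: "fps_X - ?s = 2 * ?s * fps_X" and z: "fps_X - ?s - 2 * ?s * fps_X = 0"
    using shift_two_X[where ?'a = 'a] by (simp_all add: distrib_right mult.assoc eq_diff_eq diff_eq_eq add.commute)
  have "(fps_X - ?s) * (?s * fps_X * (?q1 - ?q2)) = 0"
    using arg_cong[OF rtt_so6_polynomial[OF assms(1), of i j k l], of "\<lambda>F. diag (shift_one (shift_one F))"]
    unfolding H.hom_mult H.hom_diff x v two z U_def
    by (simp add: H.hom_sum H.hom_mult H.hom_zero u v if_distrib[of "\<lambda>F. diag (shift_one (shift_one F))"] cong: if_cong)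
  moreover define Q where "Q = ?q1 - ?q2"
  ultimately have "?s * (fps_X * (?s * (fps_X * Q))) + ?s * (fps_X * (?s * (fps_X * Q))) = 0"
    unfolding ys by (simp only: mult.assoc mult_2 distrib_right)
  then have "?s * (fps_X * (?s * (fps_X * (Q + Q)))) = 0"
    by (simp only: distrib_left)
  \<comment> \<open>The shifted variable is x / (1 + 2 x); multiplying by 1 + 2 x twice restores
    powers of x, which can be cancelled.\<close>
  moreover have "fps_X * (fps_X * (fps_X * (fps_X * F))) = (1 + 2 * fps_X) * ((1 + 2 * fps_X) * (?s * (fps_X * (?s * (fps_X * F)))))" for F
  proof -
    have c: "fps_X * G = G * fps_X" for G :: "'a fps" by (rule fps_mult_fps_X_commute)
    have zc: "(1 + 2 * fps_X) * G = G * (1 + 2 * fps_X)" for G :: "'a fps"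
      by (simp only: distrib_left distrib_right c[of G] mult_2 mult_1_left mult_1_right)
    have c2: "(1 + 2 * fps_X) * (G * H) = G * ((1 + 2 * fps_X) * H)" for G H :: "'a fps"
      by (simp only: mult.assoc[symmetric] zc[of G])
    have s: "(1 + 2 * fps_X) * (?s * G) = fps_X * G" for G
      by (simp only: mult.assoc[symmetric] shift_two_X)
    show ?thesis by (simp only: s c2[of fps_X])
  qed
  ultimately have "fps_X * (fps_X * (fps_X * (fps_X * (Q + Q)))) = fps_X * (fps_X * (fps_X * (fps_X * 0)))"
    by (simp only: mult_zero_right)
  then have "Q + Q = 0"
    by (metis fps_X_cancel)
  then have "fps_nth Q n + fps_nth Q n = 0" for n
    by (metis fps_add_nth fps_zero_nth)
  then have "Q = 0" using double_cancel by (metis fps_ext fps_zero_nth)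
  then show ?thesis by (simp only: Q_def right_minus_eq)
qed

lemma six_diff_eq: "(7 - p = l) = (p = 7 - (l::6))"
  by (metis diff_diff_eq2 add_diff_cancel_left' add.commute)

text \<open>The degree r part of orthogonality is linear in the generators of superscript r up to
  lower terms. Modulo these, the r-th coefficient of T is skew for the form up to a scalar: it lies
  in the Lie algebra of orthogonal similitudes, of dimension 15 + 1.\<close>

lemma so6_orthogonality_leading:
  fixes T :: "'a::complex_algebra_1 fps ^ 6 ^ 6"
  assumes T: "rtt_defect R_so6 T = 0" "\<And>i j. fps_nth (T $ i $ j) 0 = (if i = j then 1 else 0)" and r: "r > 0"
  shows "l \<noteq> 7 - j \<Longrightarrow> fps_nth (T $ (7 - l) $ j) r + fps_nth (T $ (7 - j) $ l) r \<in> low T r"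
    and "(fps_nth (T $ j $ j) r + fps_nth (T $ (7 - j) $ (7 - j)) r) - (fps_nth (T $ k $ k) r + fps_nth (T $ (7 - k) $ (7 - k)) r) \<in> low T r"
proof -
  define U where "U = map_matrix (\<lambda>f. shift_one (shift_one f)) T"
  note O = so6_orthogonality[OF T(1), folded U_def]
  define S where "S j l = (\<Sum>p\<in>UNIV. U $ p $ j * T $ (7 - p) $ l)" for j l
  let ?t = "\<lambda>i j. fps_nth (T $ i $ j) r"
  have S: "fps_nth (S j l) r - (?t (7 - l) j + ?t (7 - j) l) \<in> low T r" for j l
  proof -
    have if_scaleC: "(if b then 1 else 0) *\<^sub>C x = (if b then x else 0)" for b and x :: 'a
      by (simp add: scaleC_one)
    have "(\<Sum>p\<in>UNIV. fps_nth (U $ p $ j * T $ (7 - p) $ l) r - ((if 7 - p = l then ?t p j else 0) + (if p = j then ?t (7 - p) l else 0))) \<in> low T r"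
    proof (rule filt_sum)
      fix p
      show "fps_nth (U $ p $ j * T $ (7 - p) $ l) r - ((if 7 - p = l then ?t p j else 0) + (if p = j then ?t (7 - p) l else 0)) \<in> low T r"
        using leading_mult[OF leading_shift_one[OF leading_shift_one[OF leading_gen[OF T(2)]]] leading_gen[OF T(2)] r, of p j "7 - p" l]
        unfolding if_scaleC U_def nth_map_matrix .
    qed
    then show ?thesis
      unfolding six_diff_eq by (simp add: S_def fps_sum_nth sum_subtractf sum.distrib)
  qed
  {
    assume "l \<noteq> 7 - j"
    then have "S j l = 0" using O[of "7 - i" i j l for i] by (simp add: S_def)
    with filt_uminus[OF S[of j l]] show "?t (7 - l) j + ?t (7 - j) l \<in> low T r" by (simp add: add.commute)
  }
  \<comment> \<open>The right-hand side, with rows fixed to 1 and 6, does not depend on j up to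
    reindexing, so all these sums are one and the same series.\<close>
  have "S j (7 - j) = (\<Sum>p\<in>UNIV. T $ 6 $ (7 - p) * U $ 1 $ p)" for j
    using O[of 6 1 j "7 - j"] by (simp add: S_def)
  then have "S j (7 - j) = S k (7 - k)" by simp
  with filt_diff[OF S[of k "7 - k"] S[of j "7 - j"]]
  show "(?t j j + ?t (7 - j) (7 - j)) - (?t k k + ?t (7 - k) (7 - k)) \<in> low T r"
    by (simp add: algebra_simps)
qed

subsection \<open>Commutators in the extended orthogonal Yangian\<close>

context
  fixes T :: "'a::complex_algebra_1 fps ^ 6 ^ 6"
begin

text \<open>Integer degrees are needed because Laurent series have negative exponents; negative
  degrees contain only 0.\<close>

definition ifilt :: "int \<Rightarrow> 'a set" where
  "ifilt z = (if z < 0 then {0} else filt (gen T) wt UNIV (nat z))"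

lemma ifilt_zero: "0 \<in> ifilt z"
  by (simp add: ifilt_def filt.zero)

lemma ifilt_add: "x \<in> ifilt z \<Longrightarrow> y \<in> ifilt z \<Longrightarrow> x + y \<in> ifilt z"
  by (auto simp: ifilt_def filt.add)

lemma ifilt_uminus: "x \<in> ifilt z \<Longrightarrow> - x \<in> ifilt z"
  by (auto simp: ifilt_def filt_uminus)

lemma ifilt_sum: "(\<And>i. i \<in> A \<Longrightarrow> f i \<in> ifilt z) \<Longrightarrow> sum f A \<in> ifilt z"
  by (induction A rule: infinite_finite_induct) (auto intro: ifilt_zero ifilt_add)

lemma ifilt_mult: "x \<in> ifilt z \<Longrightarrow> y \<in> ifilt z' \<Longrightarrow> x * y \<in> ifilt (z + z')"
proof (cases "z < 0 \<or> z' < 0")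
  case True
  assume "x \<in> ifilt z" "y \<in> ifilt z'"
  with True have "x * y = 0" by (auto simp: ifilt_def)
  then show ?thesis by (simp add: ifilt_zero)
next
  case False
  assume "x \<in> ifilt z" "y \<in> ifilt z'"
  with False show ?thesis
    by (auto simp: ifilt_def nat_add_distrib intro: filt_mult)
qed

text \<open>Give u and v the degree 1. Then bound e means total degree at most -e, for
  \<open>bounded2\<close> in both variables together. The generator series have e = 0, and the
  expansions of (u - v)^{-1} and (u - v - 2)^{-1} have e = 1.\<close>

definition bounded1 :: "int \<Rightarrow> 'a fls \<Rightarrow> bool" where
  "bounded1 e F \<longleftrightarrow> (\<forall>n. fls_nth F n \<in> ifilt (n - e))"

definition bounded2 :: "int \<Rightarrow> 'a fls fls \<Rightarrow> bool" where
  "bounded2 e F \<longleftrightarrow> (\<forall>m. bounded1 (e - m) (fls_nth F m))"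

lemma bounded1_simps:
  "bounded1 e 0" "bounded1 e F \<Longrightarrow> bounded1 e G \<Longrightarrow> bounded1 e (F + G)" "bounded1 e F \<Longrightarrow> bounded1 e (- F)"
  by (auto simp: bounded1_def ifilt_zero ifilt_add ifilt_uminus)

lemma bounded1_sum: "(\<And>i. i \<in> A \<Longrightarrow> bounded1 e (f i)) \<Longrightarrow> bounded1 e (sum f A)"
  by (induction A rule: infinite_finite_induct) (auto intro: bounded1_simps)

lemma bounded1_mult:
  assumes "bounded1 e F" "bounded1 e' G"
  shows "bounded1 (e + e') (F * G)"
  unfolding bounded1_def fls_times_nth(2)
proof (intro allI ifilt_sum)
  fix n i
  have e: "n - (e + e') = (i - e) + (n - i - e')" by simp
  show "fls_nth F i * fls_nth G (n - i) \<in> ifilt (n - (e + e'))"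
    unfolding e using assms by (intro ifilt_mult) (simp_all add: bounded1_def)
qed

lemma bounded2_mult:
  assumes "bounded2 e F" "bounded2 e' G"
  shows "bounded2 (e + e') (F * G)"
  unfolding bounded2_def fls_times_nth(2)
proof (intro allI bounded1_sum)
  fix n i
  have e: "e + e' - n = (e - i) + (e' - (n - i))" by simp
  show "bounded1 (e + e' - n) (fls_nth F i * fls_nth G (n - i))"
    unfolding e using assms by (intro bounded1_mult) (simp_all add: bounded2_def)
qed

lemma bounded2_simps:
  "bounded2 e 0" "bounded2 e F \<Longrightarrow> bounded2 e G \<Longrightarrow> bounded2 e (F + G)" "bounded2 e F \<Longrightarrow> bounded2 e (- F)"
  by (auto simp: bounded2_def intro: bounded1_simps)

lemma bounded2_diff: "bounded2 e F \<Longrightarrow> bounded2 e G \<Longrightarrow> bounded2 e (F - G)"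
  using bounded2_simps(2)[of e F "- G"] bounded2_simps(3)[of e G] by simp

lemma bounded2_sum: "(\<And>i. i \<in> A \<Longrightarrow> bounded2 e (f i)) \<Longrightarrow> bounded2 e (sum f A)"
  by (induction A rule: infinite_finite_induct) (auto intro: bounded2_simps)

lemma bounded1_power: "bounded1 (- 1) w \<Longrightarrow> bounded1 (- int k) (w ^ k)"
proof (induction k)
  case 0
  then show ?case by (auto simp: bounded1_def ifilt_def filt_one filt.zero)
next
  case (Suc k)
  then show ?case using bounded1_mult[of "-1" w "- int k" "w ^ k"] by simp
qed

lemma bounded2_inverse_u_minus:
  assumes "bounded1 (- 1) w"
  shows "bounded2 1 (inverse_u_minus w)"
  unfolding bounded2_def
proof
  fix m :: int
  show "bounded1 (1 - m) (fls_nth (inverse_u_minus w) m)"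
  proof (cases "m < 1")
    case True
    then show ?thesis by (simp add: inverse_u_minus_def bounded1_simps)
  next
    case False
    then have "fls_nth (inverse_u_minus w) m = w ^ (nat m - 1)" "1 - m = - int (nat m - 1)"
      by (auto simp: inverse_u_minus_def)
    then show ?thesis using bounded1_power[OF assms, of "nat m - 1"] by (simp only:)
  qed
qed

lemma bounded2_D0: "bounded2 1 D0" and bounded2_D2: "bounded2 1 D2"
proof -
  have X: "bounded1 (- 1) fls_X_inv"
    by (auto simp: bounded1_def ifilt_def filt_one filt.zero)
  have "fls_nth (2 :: 'a fls) n = (if n = 0 then of_int 2 else 0)" for n
    by (metis fls_one_nth fls_plus_nth one_add_one add_0 of_int_numeral)
  then have "bounded1 (- 1) 2"
    by (auto simp: bounded1_def ifilt_def filt_of_int[of 2, simplified] filt.zero)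
  with X show "bounded2 1 D0" "bounded2 1 D2"
    by (auto intro: bounded2_inverse_u_minus bounded1_simps)
qed

context
  assumes T0: "\<And>i j. fps_nth (T $ i $ j) 0 = (if i = j then 1 else 0)" and rtt: "rtt_defect R_so6 T = 0"
begin

lemma nth_ifilt: "fps_nth (T $ i $ j) n \<in> ifilt (int n)"
proof (cases n)
  case 0
  then show ?thesis by (simp add: T0 ifilt_def filt_one filt.zero)
next
  case (Suc m)
  then show ?thesis using filt_gen[of "(i, j, m)" UNIV wt n "gen T"] by (simp add: ifilt_def gen_def wt_def nat_add_distrib)
qed

lemma bounded2_u: "bounded2 0 (series_u (T $ i $ j))" and bounded2_v: "bounded2 0 (series_v (T $ i $ j))"
proof -
  have "fps_nth (T $ i $ j) (nat m) \<in> ifilt m" if "\<not> m < 0" for m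
    using nth_ifilt[of i j "nat m"] that by simp
  then show "bounded2 0 (series_u (T $ i $ j))" "bounded2 0 (series_v (T $ i $ j))"
    by (auto simp: bounded2_def bounded1_def series_u_def series_v_def ifilt_zero)
qed

text \<open>In the RTT relation every term on the right of the commutator carries \<open>D0\<close>
  or \<open>D2\<close>, hence has total degree at most -1. Comparing coefficients, commutators drop
  by one in weight.\<close>

lemma so6_commutator:
  "gen T a * gen T b - gen T b * gen T a \<in> filt (gen T) wt UNIV (wt a + wt b - 1)"
proof -
  obtain i j s k l s' where ab: "a = (i, j, s)" "b = (k, l, s')" by (cases a, cases b)
  let ?C = "series_u (T $ i $ j) * series_v (T $ k $ l) - series_v (T $ k $ l) * series_u (T $ i $ j)"
  have b1: "bounded2 1 (D0 * F)" "bounded2 1 (D2 * F)" if "bounded2 0 F" for F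
    using bounded2_mult[OF bounded2_D0 that] bounded2_mult[OF bounded2_D2 that] by simp_all
  have b0: "bounded2 0 (series_u (T $ i $ j) * series_v (T $ k $ l))" "bounded2 0 (series_v (T $ i $ j) * series_u (T $ k $ l))" for i j k l
    using bounded2_mult[OF bounded2_u bounded2_v] bounded2_mult[OF bounded2_v bounded2_u] by simp_all
  have "bounded2 1 ?C"
    unfolding rtt[unfolded rtt_R_so6_iff, rule_format, of i j k l]
    by (intro bounded2_simps(2) bounded2_diff b1 b0) (auto intro: bounded2_simps bounded2_sum b0 b1)
  moreover have e: "int (Suc s) + int (Suc s') - 1 = int (Suc s') - (1 - int (Suc s))" by simp
  ultimately have "fls_nth (fls_nth ?C (int (Suc s))) (int (Suc s')) \<in> ifilt (int (Suc s) + int (Suc s') - 1)"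
    unfolding e bounded2_def bounded1_def by blast
  moreover have "fls_nth (fls_nth ?C (int (Suc s))) (int (Suc s')) = gen T a * gen T b - gen T b * gen T a"
    unfolding ab gen_def series_v_def series_u_def
    by (simp add: nat_add_distrib)
  ultimately show ?thesis
    by (simp add: ifilt_def wt_def ab nat_add_distrib)
qed

end

end

subsection \<open>Spanning by monomials\<close>

text \<open>The Leibniz rule, applied to one argument after the other, extends the estimate from
  generators to all elements.\<close>

lemma filt_commutator:
  assumes comm: "\<And>a b. g a * g b - g b * g a \<in> filt g w UNIV (w a + w b - 1)"
    and pos: "\<And>a. w a > 0"
    and x: "x \<in> filt g w UNIV d" and y: "y \<in> filt g w UNIV e"
  shows "x * y - y * x \<in> filt g w UNIV (d + e - 1)"
proof -
  let ?p = "\<lambda>ms. prod_list (map g ms)" and ?w = "\<lambda>ms. sum_list (map w ms)"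
  have p: "?p ms \<in> filt g w UNIV (?w ms)" for ms
    by (rule filt_prod_list) (simp add: filt_gen)
  have wz: "ms = []" if "?w ms = 0" for ms
    using that pos by (cases ms) (auto simp: less_not_refl2)
  have 1: "g a * ?p ns - ?p ns * g a \<in> filt g w UNIV (w a + ?w ns - 1)" for a ns
  proof (induction ns)
    case Nil
    show ?case by (simp add: filt.zero)
  next
    case (Cons b ns)
    have "(g a * g b - g b * g a) * ?p ns + g b * (g a * ?p ns - ?p ns * g a) \<in> filt g w UNIV (w a + ?w (b # ns) - 1)"
      using pos[of a]
      by (intro filt.add filt_mult_le[OF comm p] filt_mult_le[OF filt_gen Cons]) auto
    then show ?case by (simp add: algebra_simps)
  qed
  have 2: "?p ms * ?p ns - ?p ns * ?p ms \<in> filt g w UNIV (?w ms + ?w ns - 1)" for ms ns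
  proof (induction ms)
    case Nil
    show ?case by (simp add: filt.zero)
  next
    case (Cons a ms)
    \<comment> \<open>For empty \<open>ms\<close> the commutator is 0; otherwise its weight is
      positive and the subtraction of 1 in the induction hypothesis is not truncated.\<close>
    have "g a * (?p ms * ?p ns - ?p ns * ?p ms) \<in> filt g w UNIV (w a + ?w ms + ?w ns - 1)"
    proof (cases "ms = []")
      case False
      then have "?w ms > 0" using wz by blast
      then show ?thesis by (intro filt_mult_le[OF filt_gen Cons]) auto
    qed (simp add: filt.zero)
    moreover have "(g a * ?p ns - ?p ns * g a) * ?p ms \<in> filt g w UNIV (w a + ?w ms + ?w ns - 1)"
      using pos[of a] by (intro filt_mult_le[OF 1 p]) auto
    ultimately show ?case
      using filt.add by (fastforce simp: algebra_simps)
  qed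
  show ?thesis using x
  proof induction
    case (prod ms c)
    show ?case using y
    proof induction
      case (prod ns c')
      have "(c * c') *\<^sub>C (?p ms * ?p ns - ?p ns * ?p ms) \<in> filt g w UNIV (d + e - 1)"
        using prod \<open>?w ms \<le> d\<close> by (intro filt_scale filt_mono[OF 2]) auto
      then show ?case
        by (simp add: scaleC_mult_left scaleC_mult_right scaleC_scaleC scaleC_diff_right mult.commute[of c' c])
    next
      case (add y z)
      from filt.add[OF add(3,4)] show ?case by (simp add: algebra_simps)
    qed (simp add: filt.zero)
  next
    case (add x z)
    from filt.add[OF add(3,4)] show ?case by (simp add: algebra_simps)
  qed (simp add: filt.zero)
qed

lemma filt_permute:
  assumes comm: "\<And>a b. g a * g b - g b * g a \<in> filt g w UNIV (w a + w b - 1)"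
    and pos: "\<And>a. w a > 0"
    and "mset ms = mset ns"
  shows "prod_list (map g ms) - prod_list (map g ns) \<in> filt g w UNIV (sum_list (map w ms) - 1)"
  using assms(3)
proof (induction ms arbitrary: ns)
  case Nil
  then show ?case by (simp add: filt.zero)
next
  case (Cons a ms)
  let ?p = "\<lambda>ms. prod_list (map g ms)" and ?w = "\<lambda>ms. sum_list (map w ms)"
  have p: "?p ms \<in> filt g w UNIV (?w ms)" for ms
    by (rule filt_prod_list) (simp add: filt_gen)
  from Cons.prems have "a \<in> set ns" by (metis list.set_intros(1) set_mset_mset)
  then obtain ys zs where ns: "ns = ys @ a # zs" by (meson split_list)
  with Cons.prems have ms: "mset ms = mset (ys @ zs)" by simp
  then have "mset (map w ms) = mset (map w (ys @ zs))" by (simp only: mset_map)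
  then have w: "?w ms = ?w ys + ?w zs" by (metis sum_mset_sum_list map_append sum_list_append)
  have "g a * (?p ms - ?p (ys @ zs)) \<in> filt g w UNIV (w a + ?w ms - 1)"
  proof (cases "ms = []")
    case True
    with ms show ?thesis by (simp add: filt.zero)
  next
    case False
    then have "?w ms > 0" using pos by (cases ms) (auto simp: add_pos_nonneg)
    then show ?thesis by (intro filt_mult_le[OF filt_gen Cons.IH[OF ms]]) auto
  qed
  moreover have "(g a * ?p ys - ?p ys * g a) * ?p zs \<in> filt g w UNIV (w a + ?w ms - 1)"
  proof -
    have "g a * ?p ys - ?p ys * g a \<in> filt g w UNIV (w a + ?w ys - 1)"
      by (rule filt_commutator[OF comm pos filt_gen p]) auto
    then show ?thesis using pos[of a] w by (intro filt_mult_le[OF _ p]) auto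
  qed
  ultimately have "g a * (?p ms - ?p (ys @ zs)) + (g a * ?p ys - ?p ys * g a) * ?p zs \<in> filt g w UNIV (w a + ?w ms - 1)"
    by (rule filt.add)
  then show ?case by (simp add: ns algebra_simps)
qed

text \<open>The ordering may be chosen arbitrarily for each multiset, as reordering costs only terms
  of smaller weight.\<close>

definition canon :: "'i multiset \<Rightarrow> 'i list" where
  "canon M = (SOME ms. mset ms = M)"

lemma mset_canon: "mset (canon M) = M"
  unfolding canon_def by (rule someI_ex) (rule ex_mset)

definition mono_eval :: "('i \<Rightarrow> 'a::complex_algebra_1) \<Rightarrow> ('i multiset \<Rightarrow>\<^sub>0 complex) \<Rightarrow> 'a" where
  "mono_eval g p = (\<Sum>M\<in>Poly_Mapping.keys p. Poly_Mapping.lookup p M *\<^sub>C prod_list (map g (canon M)))"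

lemma mono_eval_superset:
  assumes "finite A" "Poly_Mapping.keys p \<subseteq> A"
  shows "mono_eval g p = (\<Sum>M\<in>A. Poly_Mapping.lookup p M *\<^sub>C prod_list (map g (canon M)))"
  unfolding mono_eval_def
  by (rule sum.mono_neutral_left) (use assms in \<open>auto simp: in_keys_iff\<close>)

lemma mono_eval_add: "mono_eval g (p + q) = mono_eval g p + mono_eval g q"
proof -
  let ?A = "Poly_Mapping.keys p \<union> Poly_Mapping.keys q"
  have "Poly_Mapping.keys (p + q) \<subseteq> ?A" by (rule Poly_Mapping.keys_add)
  then show ?thesis
    by (simp add: mono_eval_superset[of ?A] lookup_add scaleC_add_left sum.distrib)
qed

lemma mono_eval_single: "mono_eval g (Poly_Mapping.single M c) = c *\<^sub>C prod_list (map g (canon M))"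
  by (simp add: mono_eval_superset[of "{M}"])

lemma (in alg_hom) hom_mono_eval: "h (mono_eval g p) = mono_eval (h \<circ> g) p"
  by (simp add: mono_eval_def hom_sum hom_scaleC hom_prod_list)

text \<open>By strong induction on the degree: putting a nonempty product into its chosen order
  changes it by an element of strictly smaller weight.\<close>

lemma filt_mono_eval:
  assumes comm: "\<And>a b. g a * g b - g b * g a \<in> filt g w UNIV (w a + w b - 1)"
    and pos: "\<And>a. w a > 0"
    and "x \<in> filt g w UNIV d"
  shows "\<exists>p. x = mono_eval g p"
  using assms(3)
proof (induction d arbitrary: x rule: less_induct)
  case (less d)
  show ?case using less.prems
  proof induction
    case zero
    show ?case by (rule exI[of _ 0]) (simp add: mono_eval_def)
  next
    case (add x y)
    then show ?case by (metis mono_eval_add)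
  next
    case (prod ms c)
    let ?p = "\<lambda>ms. prod_list (map g ms)"
    have "\<exists>p. c *\<^sub>C (?p ms - ?p (canon (mset ms))) = mono_eval g p"
    proof (cases "ms = []")
      case True
      then have "canon (mset ms) = []" using mset_canon[of "mset ms"] by simp
      then show ?thesis using True by (intro exI[of _ 0]) (simp add: mono_eval_def)
    next
      case False
      then have "sum_list (map w ms) > 0" using pos by (cases ms) (auto simp: add_pos_nonneg)
      then have "sum_list (map w ms) - 1 < d" using prod by simp
      moreover have "c *\<^sub>C (?p ms - ?p (canon (mset ms))) \<in> filt g w UNIV (sum_list (map w ms) - 1)"
        by (intro filt_scale filt_permute[OF comm pos]) (simp add: mset_canon)
      ultimately show ?thesis by (rule less.IH)
    qed
    then obtain p where "c *\<^sub>C (?p ms - ?p (canon (mset ms))) = mono_eval g p" ..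
    then have "c *\<^sub>C ?p ms = mono_eval g (p + Poly_Mapping.single (mset ms) c)"
      by (simp add: mono_eval_add mono_eval_single scaleC_diff_right diff_eq_eq)
    then show ?case ..
  qed
qed

text \<open>The 16 combinations \<open>unlin\<close> determine the upper left part of the matrix.
  Orthogonality pairs each entry with its reflection in the antidiagonal, and the scalar relation
  supplies the last two diagonal entries.\<close>

lemma unlin_recover:
  fixes f :: "6 \<Rightarrow> 6 \<Rightarrow> 'a::complex_algebra_1"
  assumes u: "\<And>i j. unlin f i j \<in> filt g w I d"
    and o1: "\<And>l j. l \<noteq> 7 - j \<Longrightarrow> f (7 - l) j + f (7 - j) l \<in> filt g w I d"
    and o2: "\<And>j k. (f j j + f (7 - j) (7 - j)) - (f k k + f (7 - k) (7 - k)) \<in> filt g w I d"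
  shows "f k l \<in> filt g w I d"
proof -
  let ?F = "filt g w I d"
  have *: "f 2 3 \<in> ?F" "f 1 3 \<in> ?F" "f 1 5 \<in> ?F" "f 3 2 \<in> ?F" "f 1 2 \<in> ?F" "f 1 4 \<in> ?F" "f 3 1 \<in> ?F"
    "f 2 1 \<in> ?F" "f 2 4 \<in> ?F" "f 5 1 \<in> ?F" "f 4 1 \<in> ?F" "f 4 2 \<in> ?F"
    using u[of 1 2] filt_uminus[OF u[of 1 3]] u[of 1 4] u[of 2 1] u[of 2 3] u[of 2 4] filt_uminus[OF u[of 3 1]]
      u[of 3 2] u[of 3 4] u[of 4 1] u[of 4 2] u[of 4 3]
    by (simp_all add: unlin_def)
  have h: "(1 / 2) *\<^sub>C (a + b - c) + (1 / 2) *\<^sub>C (a + c - b) = a" for a b c :: 'a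
    unfolding scaleC_add_right[symmetric] by (rule half_eq) simp
  have D: "f 1 1 \<in> ?F" "f 2 2 \<in> ?F" "f 3 3 \<in> ?F"
  proof -
    have "unlin f 1 1 + unlin f 2 2 = f 1 1" by (simp add: unlin_def h)
    then show "f 1 1 \<in> ?F" by (metis filt.add u)
    have "unlin f 1 1 + unlin f 3 3 = f 2 2"
      using h[of "f 2 2" "f 1 1" "f 3 3"] by (simp add: unlin_def add.commute)
    then show "f 2 2 \<in> ?F" by (metis filt.add u)
    have "unlin f 2 2 + unlin f 3 3 = f 3 3"
      using h[of "f 3 3" "f 1 1" "f 2 2"] by (simp add: unlin_def add.commute)
    then show "f 3 3 \<in> ?F" by (metis filt.add u)
  qed
  have "unlin f 1 1 + unlin f 4 4 = f 4 4" by (simp add: unlin_def)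
  then have D4: "f 4 4 \<in> ?F" by (metis filt.add u)
  have conj: "f (7 - j) (7 - a) \<in> ?F" if "f a j \<in> ?F" "a \<noteq> j" for a j
    using filt_diff[OF o1[of "7 - a" j] that(1)] that(2) by (simp add: algebra_simps)
  \<comment> \<open>An antidiagonal entry is its own partner, so orthogonality bounds its
    double.\<close>
  have anti: "f a (7 - a) \<in> ?F" if "a \<noteq> 7 - a" for a
    using filt_scale[OF o1[of "7 - a" "7 - a"], of "1 / 2"] that half_eq[OF refl, of "f a (7 - a)"]
    by (simp add: algebra_simps)
  have o: "f 5 5 \<in> ?F" "f 6 6 \<in> ?F"
    using filt_diff[OF filt.add[OF o2[of 2 3] filt.add[OF D(3) D4]] D(2)]
      filt_diff[OF filt.add[OF o2[of 1 3] filt.add[OF D(3) D4]] D(1)] by simp_all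
  show ?thesis
    using exhaust_6[of k] exhaust_6[of l]
    by (elim disjE) (use * D D4 o *[THEN conj] anti[of 1] anti[of 2] anti[of 3] anti[of 4] anti[of 5] anti[of 6] in simp_all)
qed

lemma X_so6_filt: "\<exists>d. x \<in> filt (gen T_so6) wt UNIV d"
proof (induction x rule: so6.generators_induct)
  case (add x y)
  then obtain d e where "x \<in> filt (gen T_so6) wt UNIV d" "y \<in> filt (gen T_so6) wt UNIV e" by blast
  then have "x + y \<in> filt (gen T_so6) wt UNIV (max d e)"
    by (intro filt.add) (auto intro: filt_mono)
  then show ?case ..
next
  case (prod c ws)
  have "c *\<^sub>C prod_list (map (gen T_so6) ws) \<in> filt (gen T_so6) wt UNIV (sum_list (map wt ws))"
    by (rule filt.prod) auto
  then show ?case unfolding gen_def ..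
qed (auto intro: filt.zero)

lemma wt_simp: "wt (i, j, n) = Suc n"
  by (simp add: wt_def)

text \<open>The chosen preimages \<open>s\<close> and the generators bound each other with the same
  weights: one direction by construction, the other by induction through
  \<open>unlin_recover\<close>. Thus the commutator estimate passes from the generators to
  \<open>s\<close>, and normal ordering applies to \<open>s\<close>.\<close>

lemma X_so6_spanned:
  fixes \<phi> :: "X_so6 \<Rightarrow> Y_gl4"
  assumes "alg_hom \<phi>" and N: "map_matrix (fps_map \<phi>) T_so6 = fused_minors T_gl4"
  shows "\<exists>s p. x = mono_eval s p \<and> \<phi> \<circ> s = gen T_gl4"
proof -
  interpret alg_hom \<phi> by fact
  let ?f = "\<lambda>n k l. fps_nth (T_so6 $ k $ l) (Suc n)"
  obtain z where z: "z n i j \<in> low T_so6 (Suc n)" "\<phi> (unlin (?f n) i j + z n i j) = fps_nth (T_gl4 $ i $ j) (Suc n)" for n i j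
    using gen_lift_exists[OF assms] by metis
  define s where "s = (\<lambda>(i, j, n). unlin (?f n) i j + z n i j)"
  have phi_s: "\<phi> \<circ> s = gen T_gl4"
    by (auto simp: s_def gen_def z)
  have f_gen: "?f n k l \<in> filt (gen T_so6) wt UNIV (Suc n)" for n k l
    using filt_gen[of "(k, l, n)" UNIV wt "Suc n" "gen T_so6"] by (simp add: gen_def wt_simp)
  have s_in: "s m \<in> filt (gen T_so6) wt UNIV (wt m)" for m
    by (cases m) (auto simp: s_def wt_simp intro!: filt.add unlin_filt f_gen filt_mono[OF z(1)])
  have f_in: "?f n k l \<in> filt s wt UNIV (Suc n)" for n k l
  proof (induction n arbitrary: k l rule: less_induct)
    case (less n)
    have low: "y \<in> filt s wt UNIV (Suc n)" if "y \<in> low T_so6 (Suc n)" for y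
      by (rule filt_subst[OF _ that]) (auto simp: below_def gen_def wt_simp less)
    have "unlin (?f n) i j \<in> filt s wt UNIV (Suc n)" for i j
    proof -
      have "s (i, j, n) - z n i j \<in> filt s wt UNIV (Suc n)"
        by (intro filt_diff filt_gen low z) (auto simp: wt_simp)
      then show ?thesis by (simp add: s_def)
    qed
    then show ?case
      by (rule unlin_recover) (auto intro!: low so6_orthogonality_leading so6.rtt so6.T_nth_0)
  qed
  then have gen_in: "gen T_so6 m \<in> filt s wt UNIV (wt m)" for m
    by (cases m) (simp add: gen_def wt_simp)
  have pos: "wt m > 0" for m :: "'b \<times> 'b \<times> nat" by (cases m) (simp add: wt_simp)
  have comm: "s a * s b - s b * s a \<in> filt s wt UNIV (wt a + wt b - 1)" for a b
  proof (rule filt_subst[OF gen_in])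
    show "s a * s b - s b * s a \<in> filt (gen T_so6) wt UNIV (wt a + wt b - 1)"
      by (rule filt_commutator[OF so6_commutator[OF so6.T_nth_0 so6.rtt] pos s_in s_in])
  qed
  obtain d where "x \<in> filt (gen T_so6) wt UNIV d" using X_so6_filt by blast
  then have "x \<in> filt s wt UNIV d" by (rule filt_subst[OF gen_in])
  then obtain p where "x = mono_eval s p" using filt_mono_eval[OF comm pos] by blast
  with phi_s show ?thesis by blast
qed

subsection \<open>Linear operators on functions\<close>

text \<open>Functions of arbitrary support are allowed, so that pulling back along any partial map
  of states is defined.\<close>

typedef 's linop = "{F :: ('s \<Rightarrow> complex) \<Rightarrow> 's \<Rightarrow> complex.
    (\<forall>f g. F (\<lambda>s. f s + g s) = (\<lambda>s. F f s + F g s)) \<and> (\<forall>c f. F (\<lambda>s. c * f s) = (\<lambda>s. c * F f s))}"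
  morphisms app Abs_linop
  by (rule exI[of _ "\<lambda>f. f"]) simp

setup_lifting type_definition_linop

instantiation linop :: (type) complex_algebra_1
begin

lift_definition zero_linop :: "'a linop" is "\<lambda>f s. 0" by simp
lift_definition one_linop :: "'a linop" is "\<lambda>f. f" by simp
lift_definition plus_linop :: "'a linop \<Rightarrow> 'a linop \<Rightarrow> 'a linop" is "\<lambda>F G f s. F f s + G f s"
  by (auto simp: algebra_simps)
lift_definition minus_linop :: "'a linop \<Rightarrow> 'a linop \<Rightarrow> 'a linop" is "\<lambda>F G f s. F f s - G f s"
  by (auto simp: algebra_simps)
lift_definition uminus_linop :: "'a linop \<Rightarrow> 'a linop" is "\<lambda>F f s. - F f s"
  by (auto simp: algebra_simps)
lift_definition times_linop :: "'a linop \<Rightarrow> 'a linop \<Rightarrow> 'a linop" is "\<lambda>F G f. F (G f)"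
  by auto
lift_definition scaleC_linop :: "complex \<Rightarrow> 'a linop \<Rightarrow> 'a linop" is "\<lambda>c F f s. c * F f s"
  by (auto simp: algebra_simps)

instance
proof
  fix a b :: complex and x y z :: "'a linop"
  show "x + y + z = x + (y + z)" "x + y = y + x" "0 + x = x" "- x + x = 0" "x - y = x + - y"
    "x * y * z = x * (y * z)" "1 * x = x" "x * 1 = x" "(x + y) * z = x * z + y * z"
    "a *\<^sub>C (x + y) = a *\<^sub>C x + a *\<^sub>C y" "(a + b) *\<^sub>C x = a *\<^sub>C x + b *\<^sub>C x"
    "a *\<^sub>C b *\<^sub>C x = (a * b) *\<^sub>C x" "1 *\<^sub>C x = x" "(a *\<^sub>C x) * y = a *\<^sub>C (x * y)"
    by (transfer; simp add: fun_eq_iff algebra_simps)+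
  show "x * (y + z) = x * y + x * z" "x * (a *\<^sub>C y) = a *\<^sub>C (x * y)"
    by (transfer; simp)+
  show "(0 :: 'a linop) \<noteq> 1"
  proof
    assume "(0 :: 'a linop) = 1"
    then have "app (0 :: 'a linop) (\<lambda>_. 1) undefined = app 1 (\<lambda>_. 1) undefined" by simp
    then show False by (simp add: zero_linop.rep_eq one_linop.rep_eq)
  qed
qed

end

lemmas app_simps = zero_linop.rep_eq one_linop.rep_eq plus_linop.rep_eq minus_linop.rep_eq
  uminus_linop.rep_eq times_linop.rep_eq scaleC_linop.rep_eq

lemma app_sum: "app (sum F A) f s = (\<Sum>i\<in>A. app (F i) f s)"
  by (induction A rule: infinite_finite_induct) (simp_all add: app_simps)

lemma linop_eqI: "(\<And>f s. app F f s = app G f s) \<Longrightarrow> F = G"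
  by (metis app_inject ext)

text \<open>Pulling back reverses composition, so a product of operators moves the state by its
  factors from left to right. This matches the right multiplication by matrix units below.\<close>

lift_definition pull :: "('s \<Rightarrow> 's option) \<Rightarrow> 's linop" is "\<lambda>a f s. case a s of None \<Rightarrow> 0 | Some t \<Rightarrow> f t"
  by (auto simp: fun_eq_iff split: option.splits)

lemma pull_mult: "pull a * pull b = pull (\<lambda>s. Option.bind (a s) b)"
  by (rule linop_eqI) (simp add: app_simps pull.rep_eq split: option.splits Option.bind_splits)

subsection \<open>A representation separating the monomials\<close>

text \<open>A site carries the unitisation of the matrix algebra, on which matrix units act by right
  multiplication (the state \<^const>\<open>None\<close> is the unit), and a counter for the power of the
  evaluation parameter.\<close>

type_synonym state = "nat \<Rightarrow> (4 \<times> 4) option \<times> nat"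

definition sact :: "nat \<Rightarrow> 4 \<Rightarrow> 4 \<Rightarrow> nat \<Rightarrow> state \<Rightarrow> state option" where
  "sact k i j n \<sigma> = (case fst (\<sigma> k) of None \<Rightarrow> Some (\<sigma>(k := (Some (i, j), snd (\<sigma> k) + n)))
     | Some (a, b) \<Rightarrow> if b = i then Some (\<sigma>(k := (Some (a, j), snd (\<sigma> k) + n))) else None)"

definition site :: "nat \<Rightarrow> 4 \<Rightarrow> 4 \<Rightarrow> nat \<Rightarrow> state linop" where
  "site k i j n = pull (sact k i j n)"

lemma site_mult: "site k i j n * site k i' j' n' = (if j = i' then site k i j' (n + n') else 0)"
proof (rule linop_eqI)
  fix f \<sigma>
  show "app (site k i j n * site k i' j' n') f \<sigma> = app (if j = i' then site k i j' (n + n') else 0) f \<sigma>"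
    by (auto simp: site_def pull_mult pull.rep_eq sact_def zero_linop.rep_eq add.assoc split: option.splits)
qed

lemma site_commute: "k \<noteq> k' \<Longrightarrow> site k i j n * site k' i' j' n' = site k' i' j' n' * site k i j n"
  unfolding site_def pull_mult
  by (rule arg_cong[of _ _ pull]) (auto simp: fun_eq_iff sact_def fun_upd_twist split: option.splits Option.bind_splits)

text \<open>The coefficients of delta_ij + E_ij / (u - z), the evaluation module at z, where z^n
  raises the counter by n.\<close>

definition site_coeff :: "nat \<Rightarrow> 4 \<Rightarrow> 4 \<Rightarrow> nat \<Rightarrow> state linop" where
  "site_coeff k i j r = (case r of 0 \<Rightarrow> if i = j then 1 else 0 | Suc n \<Rightarrow> site k i j n)"

definition L_site :: "nat \<Rightarrow> state linop fps ^ 4 ^ 4" where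
  "L_site k = (\<chi> i j. Abs_fps (site_coeff k i j))"

lemma fps_uv_nth: "fps_nth (fps_nth (fps_u f * fps_v g) m) n = fps_nth f m * fps_nth g n"
  and fps_vu_nth: "fps_nth (fps_nth (fps_v g * fps_u f) m) n = fps_nth g n * fps_nth f m"
  by (simp_all add: fps_u_def)

text \<open>The second assumption is the RTT relation compared at u^{-r} v^{-s}. The coefficients it
  does not reach, where u or v has exponent 0, commute because the constant term of T is the
  identity.\<close>

lemma rtt_gl4_from_coeffs:
  fixes T :: "'a::ring_1 fps ^ 4 ^ 4"
  assumes T0: "\<And>i j. fps_nth (T $ i $ j) 0 = (if i = j then 1 else 0)"
    and "\<And>i j k l r s. (fps_nth (T $ i $ j) (Suc r) * fps_nth (T $ k $ l) s - fps_nth (T $ k $ l) s * fps_nth (T $ i $ j) (Suc r))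
      - (fps_nth (T $ i $ j) r * fps_nth (T $ k $ l) (Suc s) - fps_nth (T $ k $ l) (Suc s) * fps_nth (T $ i $ j) r)
      = fps_nth (T $ k $ j) r * fps_nth (T $ i $ l) s - fps_nth (T $ k $ j) s * fps_nth (T $ i $ l) r"
  shows "rtt_defect R_gl4 T = 0"
proof -
  have "fps2_rel 0 T T"
    unfolding fps2_rel_def
  proof (intro allI)
    fix i j k l
    define C where "C = fps_u (T $ i $ j) * fps_v (T $ k $ l) - fps_v (T $ k $ l) * fps_u (T $ i $ j)"
    define P where "P = fps_u (T $ k $ j) * fps_v (T $ i $ l) - fps_v (T $ k $ j) * fps_u (T $ i $ l)"
    have C0: "fps_nth (fps_nth C m) 0 = 0" "fps_nth (fps_nth C 0) n = 0" for m n
      by (simp_all only: C_def fps_sub_nth fps_uv_nth fps_vu_nth T0) simp_all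
    have CP: "fps_nth (fps_nth C (Suc m)) n - fps_nth (fps_nth C m) (Suc n) = fps_nth (fps_nth P m) n" for m n
      by (simp only: C_def P_def fps_sub_nth fps_uv_nth fps_vu_nth assms(2))
    have "fps_nth (fps_nth ((Y2 - X2) * C) m) n = fps_nth (fps_nth (X2 * Y2 * P) m) n" for m n
    proof -
      have "fps_nth (fps_nth (Y2 * C) m) n = (if n = 0 then 0 else fps_nth (fps_nth C m) (n - 1))"
        "fps_nth (fps_nth (X2 * C) m) n = (if m = 0 then 0 else fps_nth (fps_nth C (m - 1)) n)"
        "fps_nth (fps_nth (X2 * Y2 * P) m) n = (if m = 0 \<or> n = 0 then 0 else fps_nth (fps_nth P (m - 1)) (n - 1))"
        by (simp_all add: mult.assoc)
      then show ?thesis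
        by (cases m; cases n) (simp_all add: left_diff_distrib C0 flip: CP)
    qed
    then have "(Y2 - X2) * C = X2 * Y2 * P" by (intro fps_ext)
    then show "(Y2 - X2 + of_int 0 * (X2 * Y2)) * (fps_u (T $ i $ j) * fps_v (T $ k $ l) - fps_v (T $ k $ l) * fps_u (T $ i $ j))
      = X2 * Y2 * (fps_u (T $ k $ j) * fps_v (T $ i $ l) - fps_v (T $ k $ j) * fps_u (T $ i $ l))"
      by (simp add: C_def P_def)
  qed
  from fps2_rel_rtt_pair[OF this] show ?thesis
    by (intro rtt_gl4_from_polynomial) (simp add: rtt_pair_def)
qed

text \<open>A product at one site depends only on the sum of the exponents. Hence for positive r and
  s both sides of the coefficient relation vanish, and the cases with a zero index reduce to the
  multiplication of matrix units.\<close>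

lemma rtt_L_site: "rtt_defect R_gl4 (L_site k) = 0"
proof (rule rtt_gl4_from_coeffs)
  have n: "fps_nth (L_site k $ i $ j) r = site_coeff k i j r" for i j r
    by (simp add: L_site_def)
  show "fps_nth (L_site k $ i $ j) 0 = (if i = j then 1 else 0)" for i j
    by (simp add: n site_coeff_def)
  fix i j k' l r s
  show "(fps_nth (L_site k $ i $ j) (Suc r) * fps_nth (L_site k $ k' $ l) s - fps_nth (L_site k $ k' $ l) s * fps_nth (L_site k $ i $ j) (Suc r))
      - (fps_nth (L_site k $ i $ j) r * fps_nth (L_site k $ k' $ l) (Suc s) - fps_nth (L_site k $ k' $ l) (Suc s) * fps_nth (L_site k $ i $ j) r)
      = fps_nth (L_site k $ k' $ j) r * fps_nth (L_site k $ i $ l) s - fps_nth (L_site k $ k' $ j) s * fps_nth (L_site k $ i $ l) r"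
    unfolding n
  proof (cases r; cases s)
    fix r' s' assume rs: "r = Suc r'" "s = Suc s'"
    have "site k i j (Suc r') * site k k' l s' = site k i j r' * site k k' l (Suc s')"
      "site k k' l s' * site k i j (Suc r') = site k k' l (Suc s') * site k i j r'"
      "site k k' j r' * site k i l s' = site k k' j s' * site k i l r'"
      by (simp_all add: site_mult add.commute)
    then show "(site_coeff k i j (Suc r) * site_coeff k k' l s - site_coeff k k' l s * site_coeff k i j (Suc r))
      - (site_coeff k i j r * site_coeff k k' l (Suc s) - site_coeff k k' l (Suc s) * site_coeff k i j r)
      = site_coeff k k' j r * site_coeff k i l s - site_coeff k k' j s * site_coeff k i l r"
      by (simp add: rs site_coeff_def)
  qed (simp_all add: site_coeff_def site_mult)
qed

lemma series_uv_commute: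
  assumes "\<And>m n. fps_nth f m * fps_nth g n = fps_nth g n * fps_nth f m"
  shows "series_u f * series_v g = series_v g * series_u f"
proof -
  have "fps_u f * fps_v g = fps_v g * fps_u f"
    by (intro fps_ext) (simp only: fps_uv_nth fps_vu_nth assms)
  from arg_cong[OF this, of fps2_to_fls2] show ?thesis
    by (simp only: fps2_to_fls2.hom_mult fps2_to_fls2_u fps2_to_fls2_v)
qed

text \<open>The coproduct: two solutions with mutually commuting entries can be multiplied, since
  A_2(v) passes B_1(u) and the R-matrix is then carried through each solution in turn.\<close>

lemma rtt_defect_mult:
  fixes R :: "'a::ring_1 fls fls ^ ('n::finite \<times> 'n) ^ ('n \<times> 'n)"
  assumes "rtt_defect R A = 0" "rtt_defect R B = 0"
    and "\<And>i j k l m n. fps_nth (A $ i $ j) m * fps_nth (B $ k $ l) n = fps_nth (B $ k $ l) n * fps_nth (A $ i $ j) m"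
  shows "rtt_defect R (A ** B) = 0"
proof -
  let ?u = "\<lambda>A. tensor1 (map_matrix series_u A)" and ?v = "\<lambda>A. tensor2 (map_matrix series_v A)"
  have A: "R ** ?u A ** ?v A = ?v A ** ?u A ** R" and B: "R ** ?u B ** ?v B = ?v B ** ?u B ** R"
    using assms(1,2) by (simp_all add: rtt_defect_def)
  have c1: "?u B ** ?v A = ?v A ** ?u B"
    by (rule tensor12_commute) (simp add: series_uv_commute assms(3))
  have c2: "?u A ** ?v B = ?v B ** ?u A"
    by (rule tensor12_commute) (simp add: series_uv_commute assms(3))
  have m: "?u (A ** B) = ?u A ** ?u B" "?v (A ** B) = ?v A ** ?v B"
    by (simp_all only: series_u.map_matrix_mult series_v.map_matrix_mult tensor1_mult tensor2_mult)
  have "R ** (?u A ** ?u B) ** (?v A ** ?v B) = R ** ?u A ** (?u B ** ?v A) ** ?v B"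
    by (simp only: matrix_mul_assoc)
  also have "\<dots> = R ** ?u A ** ?v A ** (?u B ** ?v B)"
    unfolding c1 by (simp only: matrix_mul_assoc)
  also have "\<dots> = ?v A ** ?u A ** (R ** ?u B ** ?v B)"
    unfolding A by (simp only: matrix_mul_assoc)
  also have "\<dots> = ?v A ** (?u A ** ?v B) ** ?u B ** R"
    unfolding B by (simp only: matrix_mul_assoc)
  also have "\<dots> = (?v A ** ?v B) ** (?u A ** ?u B) ** R"
    unfolding c2 by (simp only: matrix_mul_assoc)
  finally show ?thesis unfolding rtt_defect_def m by simp
qed

lemma matrix_mult_fps_nth: "fps_nth ((A ** B) $ i $ j) n = (\<Sum>a\<in>UNIV. \<Sum>p=0..n. fps_nth (A $ i $ a) p * fps_nth (B $ a $ j) (n - p))"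
  by (simp add: matrix_matrix_mult_def fps_sum_nth fps_mult_nth)

primrec monodromy :: "nat \<Rightarrow> state linop fps ^ 4 ^ 4" where
  "monodromy 0 = mat 1"
| "monodromy (Suc K) = monodromy K ** L_site K"

lemma monodromy_commute:
  "K \<le> k \<Longrightarrow> fps_nth (monodromy K $ i $ j) m * site_coeff k i' j' n = site_coeff k i' j' n * fps_nth (monodromy K $ i $ j) m"
proof (induction K arbitrary: i j m)
  case 0
  then show ?case by (simp add: mat_def)
next
  case (Suc K)
  have c: "site_coeff K a b r * site_coeff k i' j' n = site_coeff k i' j' n * site_coeff K a b r" for a b r
    using site_commute[of K k] Suc.prems by (auto simp: site_coeff_def split: nat.splits)
  have l: "fps_nth (L_site K $ a $ b) r = site_coeff K a b r" for a b r by (simp add: L_site_def)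
  have IH: "fps_nth (monodromy K $ i $ a) p * site_coeff k i' j' n = site_coeff k i' j' n * fps_nth (monodromy K $ i $ a) p" for a p
    using Suc by simp
  have "fps_nth (monodromy K $ i $ a) p * fps_nth (L_site K $ a $ j) q * site_coeff k i' j' n
      = site_coeff k i' j' n * (fps_nth (monodromy K $ i $ a) p * fps_nth (L_site K $ a $ j) q)" for a p q
    unfolding l mult.assoc c by (simp only: mult.assoc[symmetric] IH)
  then show ?case
    by (simp add: matrix_mult_fps_nth sum_distrib_left sum_distrib_right)
qed

lemma rtt_monodromy: "rtt_defect R_gl4 (monodromy K) = 0"
proof (induction K)
  case 0
  show ?case using rtt_relations_one[of R_gl4] unfolding rtt_relations_subset_zero_iff by simp
next
  case (Suc K)
  show ?case
    unfolding monodromy.simps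
    by (rule rtt_defect_mult[OF Suc rtt_L_site]) (simp add: L_site_def monodromy_commute)
qed

lemma monodromy_nth_0: "fps_nth (monodromy K $ i $ j) 0 = (if i = j then 1 else 0)"
proof (induction K arbitrary: i j)
  case (Suc K)
  then show ?case
    by (simp add: matrix_mult_fps_nth L_site_def site_coeff_def if_distrib[of "\<lambda>x. x * _"] cong: if_cong)
qed (simp add: mat_def)

subsection \<open>Leading terms in the evaluation parameters\<close>

abbreviation vacuum :: state where "vacuum \<equiv> \<lambda>_. (None, 0)"

context
  fixes K :: nat
begin

definition height :: "state \<Rightarrow> nat" where
  "height \<sigma> = (\<Sum>k<K. snd (\<sigma> k))"

definition vanish :: "nat \<Rightarrow> (state \<Rightarrow> complex) set" where
  "vanish D = {f. \<forall>\<sigma>. height \<sigma> < D \<longrightarrow> f \<sigma> = 0}"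

text \<open>The dual form of a degree filtration: an operator of degree m in the evaluation
  parameters raises heights of states by m, so it reduces the order to which a function vanishes by
  m. In \<open>lowers_less\<close> the degree is smaller than m.\<close>

definition lowers :: "nat \<Rightarrow> state linop set" where
  "lowers m = {F. \<forall>D. \<forall>f\<in>vanish (D + m). app F f \<in> vanish D}"

definition lowers_less :: "nat \<Rightarrow> state linop set" where
  "lowers_less m = {F. \<forall>D. \<forall>f\<in>vanish (D + m). app F f \<in> vanish (Suc D)}"

lemma vanish_antimono: "f \<in> vanish D \<Longrightarrow> D' \<le> D \<Longrightarrow> f \<in> vanish D'"
  by (auto simp: vanish_def)

lemma lowers_closed: "0 \<in> lowers m" "F \<in> lowers m \<Longrightarrow> G \<in> lowers m \<Longrightarrow> F + G \<in> lowers m"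
  by (auto simp: lowers_def vanish_def app_simps)

lemma lowers_less_closed: "0 \<in> lowers_less m" "F \<in> lowers_less m \<Longrightarrow> G \<in> lowers_less m \<Longrightarrow> F + G \<in> lowers_less m"
  by (auto simp: lowers_less_def vanish_def app_simps)

lemma lowers_sum: "(\<And>i. i \<in> A \<Longrightarrow> F i \<in> lowers m) \<Longrightarrow> sum F A \<in> lowers m"
  by (induction A rule: infinite_finite_induct) (auto intro: lowers_closed)

lemma lowers_less_sum: "(\<And>i. i \<in> A \<Longrightarrow> F i \<in> lowers_less m) \<Longrightarrow> sum F A \<in> lowers_less m"
  by (induction A rule: infinite_finite_induct) (auto intro: lowers_less_closed)

lemma lowers_one: "1 \<in> lowers 0"
  by (simp add: lowers_def app_simps)

lemma lowers_mult: "F \<in> lowers m \<Longrightarrow> G \<in> lowers m' \<Longrightarrow> F * G \<in> lowers (m + m')"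
  by (simp add: lowers_def app_simps add.assoc[symmetric])

lemma lowers_less_mult1: "F \<in> lowers_less m \<Longrightarrow> G \<in> lowers m' \<Longrightarrow> F * G \<in> lowers_less (m + m')"
  by (simp add: lowers_def lowers_less_def app_simps add.assoc[symmetric])

lemma lowers_less_mult2: "F \<in> lowers m \<Longrightarrow> G \<in> lowers_less m' \<Longrightarrow> F * G \<in> lowers_less (m + m')"
  unfolding lowers_def lowers_less_def
proof clarify
  fix D f
  assume F: "\<forall>D. \<forall>f\<in>vanish (D + m). app F f \<in> vanish D"
    and G: "\<forall>D. \<forall>f\<in>vanish (D + m'). app G f \<in> vanish (Suc D)" and "f \<in> vanish (D + (m + m'))"
  then have "f \<in> vanish ((D + m) + m')" by (simp only: add.assoc)
  with G have "app G f \<in> vanish (Suc D + m)" by (simp only: add_Suc)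
  with F show "app (F * G) f \<in> vanish (Suc D)" unfolding times_linop.rep_eq by blast
qed

lemma lowers_imp_less: "F \<in> lowers m \<Longrightarrow> m < m' \<Longrightarrow> F \<in> lowers_less m'"
  unfolding lowers_def lowers_less_def
proof clarify
  fix D f
  assume *: "\<forall>D. \<forall>f\<in>vanish (D + m). app F f \<in> vanish D" "m < m'" "f \<in> vanish (D + m')"
  then have "f \<in> vanish (Suc D + m)" by (auto intro: vanish_antimono)
  with * show "app F f \<in> vanish (Suc D)" by blast
qed

lemma less_imp_lowers: "F \<in> lowers_less m \<Longrightarrow> F \<in> lowers m"
  unfolding lowers_def lowers_less_def
proof clarify
  fix D f
  assume "\<forall>D. \<forall>f\<in>vanish (D + m). app F f \<in> vanish (Suc D)" "f \<in> vanish (D + m)"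
  then have "app F f \<in> vanish (Suc D)" by blast
  then show "app F f \<in> vanish D" by (rule vanish_antimono) simp
qed

lemma lowers_site: "k < K \<Longrightarrow> site k i j n \<in> lowers n"
proof -
  assume k: "k < K"
  have h: "height (\<sigma>(k := (x, snd (\<sigma> k) + n))) = height \<sigma> + n" for \<sigma> x
    using k by (simp add: height_def sum.remove[of "{..<K}" k])
  show ?thesis
    by (auto simp: lowers_def vanish_def site_def pull.rep_eq sact_def h split: option.splits)
qed

text \<open>A site contributing u^{-p} has parameter degree p - 1. Hence a term of total exponent n
  + 1 that involves two or more sites has parameter degree below n, and only the single-site terms
  remain.\<close>

lemma monodromy_leading:
  "J \<le> K \<Longrightarrow> fps_nth (monodromy J $ i $ j) (Suc n) - (\<Sum>k<J. site k i j n) \<in> lowers_less n"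
proof (induction J arbitrary: i j n)
  case 0
  show ?case by (simp add: mat_def lowers_less_closed)
next
  case (Suc J)
  have IH: "fps_nth (monodromy J $ i $ j) (Suc n) - (\<Sum>k<J. site k i j n) \<in> lowers_less n" for i j n
    using Suc by simp
  have M: "fps_nth (monodromy J $ i $ j) (Suc n) \<in> lowers n" for i j n
  proof -
    have "(\<Sum>k<J. site k i j n) \<in> lowers n"
      using Suc.prems by (intro lowers_sum lowers_site) auto
    from lowers_closed(2)[OF less_imp_lowers[OF IH[of i j n]] this] show ?thesis by simp
  qed
  let ?t = "\<lambda>a p. fps_nth (monodromy J $ i $ a) p * site_coeff J a j (Suc n - p)"
  have "fps_nth (monodromy (Suc J) $ i $ j) (Suc n) = (\<Sum>a\<in>UNIV. \<Sum>p=0..Suc n. ?t a p)"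
    by (simp only: monodromy.simps matrix_mult_fps_nth) (simp add: L_site_def)
  also have "\<dots> = (\<Sum>a\<in>UNIV. ?t a 0 + (\<Sum>p=1..n. ?t a p) + ?t a (Suc n))"
  proof (intro sum.cong refl)
    fix a
    have "{0..Suc n} = insert 0 (insert (Suc n) {1..n})" by auto
    then show "(\<Sum>p=0..Suc n. ?t a p) = ?t a 0 + (\<Sum>p=1..n. ?t a p) + ?t a (Suc n)"
      by (simp add: add_ac)
  qed
  also have "\<dots> = site J i j n + (\<Sum>a\<in>UNIV. \<Sum>p=1..n. ?t a p) + fps_nth (monodromy J $ i $ j) (Suc n)"
    by (simp add: sum.distrib monodromy_nth_0 site_coeff_def if_distrib[of "\<lambda>x. x * _"] if_distrib[of "\<lambda>x. _ * x"] cong: if_cong)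
  finally have eq: "fps_nth (monodromy (Suc J) $ i $ j) (Suc n) - (\<Sum>k<Suc J. site k i j n)
      = (\<Sum>a\<in>UNIV. \<Sum>p=1..n. ?t a p) + (fps_nth (monodromy J $ i $ j) (Suc n) - (\<Sum>k<J. site k i j n))"
    by simp
  have "?t a p \<in> lowers_less n" if pn: "p \<in> {1..n}" for a p
  proof -
    obtain q where p: "p = Suc q" using pn by (cases p) auto
    obtain m where m: "Suc n - p = Suc m" using pn p by (metis Suc_diff_le atLeastAtMost_iff)
    have "fps_nth (monodromy J $ i $ a) (Suc q) * site J a j m \<in> lowers (q + m)"
      using Suc.prems by (intro lowers_mult M lowers_site) auto
    then show ?thesis
      using m p pn by (intro lowers_imp_less) (auto simp: site_coeff_def)
  qed
  then show ?case
    unfolding eq by (intro lowers_less_closed lowers_less_sum IH)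
qed

definition site_sum :: "4 \<times> 4 \<times> nat \<Rightarrow> state linop" where
  "site_sum = (\<lambda>(i, j, n). \<Sum>k<K. site k i j n)"

lemma site_sum_simp: "site_sum (i, j, n) = (\<Sum>k<K. site k i j n)"
  by (simp add: site_sum_def)

text \<open>The degree in the evaluation parameters, which counts every factor by its superscript
  minus one, unlike \<open>wt\<close>.\<close>

definition pdeg :: "(4 \<times> 4 \<times> nat) list \<Rightarrow> nat" where
  "pdeg ms = (\<Sum>(i, j, n)\<leftarrow>ms. n)"

lemma gen_monodromy: "gen (monodromy K) m - site_sum m \<in> lowers_less (snd (snd m))"
  and gen_monodromy_lowers: "gen (monodromy K) m \<in> lowers (snd (snd m))"
  and site_sum_lowers: "site_sum m \<in> lowers (snd (snd m))"
proof -
  obtain i j n where m: "m = (i, j, n)" by (cases m)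
  show 1: "gen (monodromy K) m - site_sum m \<in> lowers_less (snd (snd m))"
    using monodromy_leading[of K i j n] by (simp add: m gen_def site_sum_def)
  show 2: "site_sum m \<in> lowers (snd (snd m))"
    by (auto simp: m site_sum_def intro: lowers_sum lowers_site)
  from lowers_closed(2)[OF less_imp_lowers[OF 1] 2] show "gen (monodromy K) m \<in> lowers (snd (snd m))"
    by simp
qed

lemma prod_monodromy:
  "prod_list (map (gen (monodromy K)) ms) \<in> lowers (pdeg ms)"
  "prod_list (map (gen (monodromy K)) ms) - prod_list (map site_sum ms) \<in> lowers_less (pdeg ms)"
proof (induction ms)
  case Nil
  case 1 show ?case by (simp add: pdeg_def lowers_one)
  case 2 show ?case by (simp add: lowers_less_closed)
next
  case (Cons m ms)
  have d: "pdeg (m # ms) = snd (snd m) + pdeg ms" by (simp add: pdeg_def case_prod_unfold)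
  case 1
  show ?case using lowers_mult[OF gen_monodromy_lowers Cons(1)] by (simp add: d)
  case 2
  show ?case
    using lowers_less_closed(2)[OF lowers_less_mult1[OF gen_monodromy Cons(1)] lowers_less_mult2[OF site_sum_lowers Cons(2)]]
    by (simp add: d algebra_simps)
qed

text \<open>The vacuum has height 0, so a product of degree below D cannot reach the support of f,
  and at degree D only its leading part does.\<close>

lemma app_vacuum:
  assumes "f \<in> vanish D"
  shows "pdeg ms < D \<Longrightarrow> app (prod_list (map (gen (monodromy K)) ms)) f vacuum = 0"
    and "pdeg ms = D \<Longrightarrow> app (prod_list (map (gen (monodromy K)) ms)) f vacuum
      = app (prod_list (map site_sum ms)) f vacuum"
proof -
  have h: "height vacuum = 0" by (simp add: height_def)
  {
    assume "pdeg ms < D"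
    with assms have "f \<in> vanish ((D - pdeg ms) + pdeg ms)" by simp
    then have "app (prod_list (map (gen (monodromy K)) ms)) f \<in> vanish (D - pdeg ms)"
      using prod_monodromy(1)[of ms] unfolding lowers_def by blast
    then show "app (prod_list (map (gen (monodromy K)) ms)) f vacuum = 0"
      using \<open>pdeg ms < D\<close> h by (simp add: vanish_def)
  }
  {
    assume "pdeg ms = D"
    with assms have "f \<in> vanish (0 + pdeg ms)" by simp
    then have "app (prod_list (map (gen (monodromy K)) ms) - prod_list (map site_sum ms)) f \<in> vanish (Suc 0)"
      using prod_monodromy(2)[of ms] unfolding lowers_less_def by blast
    then show "app (prod_list (map (gen (monodromy K)) ms)) f vacuum
      = app (prod_list (map site_sum ms)) f vacuum"
      using h by (simp add: vanish_def app_simps)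
  }
qed

subsection \<open>Counting the assignments of factors to sites\<close>

context
  fixes lab :: "nat \<Rightarrow> 4 \<times> 4 \<times> nat"
begin

definition target :: state where
  "target k = (if k < K then (Some (fst (lab k), fst (snd (lab k))), snd (snd (lab k))) else (None, 0))"

definition free_sites :: "state \<Rightarrow> nat set" where
  "free_sites \<sigma> = {k. k < K \<and> \<sigma> k = (None, 0)}"

text \<open>An empty site carries no power of its parameter, so emptiness can be tested on either
  the pair or the first component.\<close>

definition admissible :: "state \<Rightarrow> bool" where
  "admissible \<sigma> \<longleftrightarrow> (\<forall>k. fst (\<sigma> k) = None \<longrightarrow> \<sigma> k = (None, 0)) \<and> (\<forall>k\<ge>K. \<sigma> k = (None, 0))"

definition matches :: "state \<Rightarrow> bool" where
  "matches \<sigma> \<longleftrightarrow> (\<forall>k<K. \<sigma> k \<noteq> (None, 0) \<longrightarrow> \<sigma> k = target k)"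

text \<open>N counts the ways of distributing the factors over the sites so as to arrive at the
  target. There are at most as many factors as free sites and the target occupies every site, so
  each factor must fill a free site of its own with the right label. As N is a natural number,
  contributions cannot cancel.\<close>

lemma count_assignments:
  assumes "admissible \<sigma>" "length ms \<le> card (free_sites \<sigma>)"
  shows "\<exists>N. app (prod_list (map site_sum ms)) (\<lambda>\<sigma>. if \<sigma> = target then 1 else 0) \<sigma> = of_nat N \<and>
    (N > 0 \<longleftrightarrow> matches \<sigma> \<and> mset ms = image_mset lab (mset_set (free_sites \<sigma>)))"
  using assms
proof (induction ms arbitrary: \<sigma>)
  case Nil
  have fin: "finite (free_sites \<sigma>)" by (simp add: free_sites_def)
  have "\<sigma> = target \<longleftrightarrow> matches \<sigma> \<and> free_sites \<sigma> = {}"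
  proof
    assume "\<sigma> = target"
    then show "matches \<sigma> \<and> free_sites \<sigma> = {}"
      by (auto simp: matches_def free_sites_def target_def)
  next
    assume "matches \<sigma> \<and> free_sites \<sigma> = {}"
    then have "\<sigma> k = target k" for k
      using Nil.prems(1) by (cases "k < K") (auto simp: matches_def free_sites_def admissible_def target_def)
    then show "\<sigma> = target" by blast
  qed
  moreover have "{#} = image_mset lab (mset_set (free_sites \<sigma>)) \<longleftrightarrow> free_sites \<sigma> = {}"
    using fin by (auto simp: mset_set_empty_iff)
  ultimately show ?case
    by (intro exI[of _ "if \<sigma> = target then 1 else 0"]) (auto simp: app_simps)
next
  case (Cons m ms)
  obtain i j n where m: "m = (i, j, n)" by (cases m)
  let ?f = "\<lambda>\<sigma>. if \<sigma> = target then 1 else 0"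
  let ?F = "free_sites \<sigma>"
  have fin: "finite ?F" by (simp add: free_sites_def)
  let ?v = "\<lambda>k. app (site k i j n) (app (prod_list (map site_sum ms)) ?f) \<sigma>"
  let ?P = "\<lambda>k. k \<in> ?F \<and> matches \<sigma> \<and> lab k = m \<and> mset ms = image_mset lab (mset_set (?F - {k}))"
  have "\<exists>N. ?v k = of_nat N \<and> (N > 0 \<longleftrightarrow> ?P k)" if k: "k < K" for k
  proof (cases "fst (\<sigma> k)")
    case None
    then have s: "\<sigma> k = (None, 0)" using Cons.prems(1) by (simp add: admissible_def)
    let ?s = "\<sigma>(k := (Some (i, j), n))"
    have kF: "k \<in> ?F" using k s by (simp add: free_sites_def)
    have F: "free_sites ?s = ?F - {k}" by (auto simp: free_sites_def)
    have "admissible ?s" using Cons.prems(1) k by (auto simp: admissible_def)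
    moreover have "length ms \<le> card (free_sites ?s)" using Cons.prems(2) kF fin by (simp add: F)
    ultimately obtain N where N: "app (prod_list (map site_sum ms)) ?f ?s = of_nat N"
      "N > 0 \<longleftrightarrow> matches ?s \<and> mset ms = image_mset lab (mset_set (?F - {k}))"
      using Cons.IH[of ?s] unfolding F by metis
    have "matches ?s \<longleftrightarrow> matches \<sigma> \<and> lab k = m"
      using k s by (cases "lab k") (auto simp: matches_def target_def m)
    moreover have "?v k = of_nat N" using N(1) None s by (simp add: site_def pull.rep_eq sact_def)
    ultimately show ?thesis using N(2) kF by blast
  next
    case (Some ab)
    obtain a b where ab: "ab = (a, b)" by (cases ab)
    have kF: "k \<notin> ?F" using Some by (auto simp: free_sites_def)
    have "?v k = 0"
    proof (cases "b = i")
      case True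
      let ?s = "\<sigma>(k := (Some (a, j), snd (\<sigma> k) + n))"
      have F: "free_sites ?s = ?F" using Some by (auto simp: free_sites_def)
      have "admissible ?s" using Cons.prems(1) k by (auto simp: admissible_def)
      moreover have "length ms \<le> card (free_sites ?s)" using Cons.prems(2) by (simp add: F)
      ultimately obtain N where N: "app (prod_list (map site_sum ms)) ?f ?s = of_nat N"
        "N > 0 \<longleftrightarrow> matches ?s \<and> mset ms = image_mset lab (mset_set ?F)"
        using Cons.IH[of ?s] unfolding F by metis
      \<comment> \<open>A factor was spent on an occupied site, and too few are left to fill the
        free ones.\<close>
      have "size (mset ms) \<noteq> size (image_mset lab (mset_set ?F))"
        using Cons.prems(2) by simp
      then have "N = 0" using N(2) by (metis gr0I)
      then show ?thesis using N(1) Some True by (simp add: site_def pull.rep_eq sact_def ab)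
    qed (simp add: site_def pull.rep_eq sact_def Some ab)
    then show ?thesis using kF by (intro exI[of _ 0]) simp
  qed
  then obtain N where N: "?v k = of_nat (N k)" "N k > 0 \<longleftrightarrow> ?P k" if "k < K" for k
    by metis
  have v: "app (prod_list (map site_sum (m # ms))) ?f \<sigma> = of_nat (\<Sum>k<K. N k)"
    by (simp add: app_simps site_sum_simp m app_sum N(1))
  have "sum N {..<K} = 0 \<longleftrightarrow> (\<forall>k<K. N k = 0)"
    by (subst sum_eq_0_iff) auto
  then have "(\<Sum>k<K. N k) > 0 \<longleftrightarrow> (\<exists>k<K. N k > 0)"
    unfolding neq0_conv[symmetric] by (simp only: not_all not_imp)
  also have "\<dots> \<longleftrightarrow> (\<exists>k. ?P k)"
    using N(2) by (auto simp: free_sites_def)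
  also have "\<dots> \<longleftrightarrow> matches \<sigma> \<and> mset (m # ms) = image_mset lab (mset_set ?F)"
  proof -
    have i: "image_mset lab (mset_set ?F) = add_mset (lab k) (image_mset lab (mset_set (?F - {k})))" if "k \<in> ?F" for k
      using that fin by (metis image_mset_add_mset mset_set.remove)
    show ?thesis
    proof
      assume "\<exists>k. ?P k"
      then obtain k where "?P k" ..
      with i[of k] show "matches \<sigma> \<and> mset (m # ms) = image_mset lab (mset_set ?F)" by simp
    next
      assume *: "matches \<sigma> \<and> mset (m # ms) = image_mset lab (mset_set ?F)"
      then have "m \<in># image_mset lab (mset_set ?F)" by (metis list.set_intros(1) set_mset_mset)
      then obtain k where k: "k \<in> ?F" "lab k = m" using fin by auto
      with * i[OF k(1)] have "?P k" by simp
      then show "\<exists>k. ?P k" ..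
    qed
  qed
  finally have "(\<Sum>k<K. N k) > 0 \<longleftrightarrow> matches \<sigma> \<and> mset (m # ms) = image_mset lab (mset_set ?F)" .
  then show ?case using v by (intro exI[of _ "\<Sum>k<K. N k"] conjI)
qed

end

end

subsection \<open>Linear independence of the monomials\<close>

text \<open>Among the monomials of largest parameter degree one of largest length is chosen, and one
  site is used per factor. The function concentrated at its target state detects only this monomial:
  smaller degree does not reach the height, shorter products leave a site empty, and otherwise the
  labels differ.\<close>

lemma mono_eval_gen_T_gl4_eq_0:
  assumes "mono_eval (gen T_gl4) p = 0"
  shows "p = 0"
proof (rule ccontr)
  assume "p \<noteq> 0"
  let ?keys = "Poly_Mapping.keys p"
  let ?d = "\<lambda>M. pdeg (canon M)"
  have ne: "?keys \<noteq> {}" using \<open>p \<noteq> 0\<close> by simp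
  define D where "D = Max (?d ` ?keys)"
  have D: "?d M \<le> D" if "M \<in> ?keys" for M
    using that by (simp add: D_def)
  have "D \<in> ?d ` ?keys" unfolding D_def using ne by (intro Max_in) auto
  then have ne': "{M \<in> ?keys. ?d M = D} \<noteq> {}" by auto
  define K where "K = Max (size ` {M \<in> ?keys. ?d M = D})"
  have K: "size M \<le> K" if "M \<in> ?keys" "?d M = D" for M
    using that by (auto simp: K_def)
  have "K \<in> size ` {M \<in> ?keys. ?d M = D}" unfolding K_def using ne' by (intro Max_in) auto
  then obtain M0 where M0: "M0 \<in> ?keys" "?d M0 = D" "size M0 = K" by auto
  have len: "length (canon M0) = K" using M0(3) mset_canon[of M0] by (metis size_mset)
  define lab where "lab k = canon M0 ! k" for k
  obtain h where h: "alg_hom h" "map_matrix (fps_map h) T_gl4 = monodromy K"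
    using gl4.lift[OF ring_1_hom.map_matrix_R_gl4 monodromy_nth_0 rtt_monodromy] by blast
  interpret alg_hom h by (rule h)
  let ?f = "\<lambda>\<sigma>. if \<sigma> = target K lab then 1 else 0 :: complex"
  have "h \<circ> gen T_gl4 = gen (monodromy K)"
    unfolding h(2)[symmetric] by (auto simp: fun_eq_iff gen_def)
  then have zero: "mono_eval (gen (monodromy K)) p = 0"
    using arg_cong[OF assms, of h] by (simp add: hom_mono_eval hom_zero)
  have height: "height K (target K lab) = D"
  proof -
    have "D = (\<Sum>k<K. snd (snd (lab k)))"
      using M0(2) len unfolding pdeg_def by (simp add: sum_list_sum_nth atLeast0LessThan lab_def case_prod_unfold)
    then show ?thesis by (simp add: height_def target_def)
  qed
  then have fD: "?f \<in> vanish K D" by (auto simp: vanish_def)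
  have adm: "admissible K vacuum" by (simp add: admissible_def)
  have free: "free_sites K vacuum = {..<K}" by (auto simp: free_sites_def)
  have match: "matches K lab vacuum" by (simp add: matches_def)
  have M0_lab: "image_mset lab (mset_set {..<K}) = M0"
  proof -
    have "mset (map lab [0..<K]) = M0"
      using len mset_canon[of M0] unfolding lab_def by (metis map_nth)
    then show ?thesis by (simp add: atLeast0LessThan)
  qed
  have val: "\<exists>N. app (prod_list (map (gen (monodromy K)) (canon M))) ?f vacuum = of_nat N \<and> (N > 0 \<longleftrightarrow> M = M0)"
    if M: "M \<in> ?keys" for M
  proof (cases "?d M = D")
    case True
    have "length (canon M) \<le> card (free_sites K vacuum)"
      using K[OF M True] mset_canon[of M] by (simp add: free) (metis size_mset)
    from count_assignments[OF adm this, of lab]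
    show ?thesis
      unfolding app_vacuum(2)[OF fD True] free M0_lab mset_canon using match by blast
  next
    case False
    then have "?d M < D" using D[OF M] by simp
    then show ?thesis using app_vacuum(1)[OF fD, of "canon M"] False M0(2) by (intro exI[of _ 0]) auto
  qed
  then obtain N where N: "app (prod_list (map (gen (monodromy K)) (canon M))) ?f vacuum = of_nat (N M)" "N M > 0 \<longleftrightarrow> M = M0"
    if "M \<in> ?keys" for M
    by metis
  have "0 = app (mono_eval (gen (monodromy K)) p) ?f vacuum"
    by (simp add: zero app_simps)
  also have "\<dots> = (\<Sum>M\<in>?keys. Poly_Mapping.lookup p M * of_nat (N M))"
    by (simp add: mono_eval_def app_sum app_simps N(1))
  also have "\<dots> = (\<Sum>M\<in>{M0}. Poly_Mapping.lookup p M * of_nat (N M))"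
    using M0(1) N(2) by (intro sum.mono_neutral_right) auto
  finally have "Poly_Mapping.lookup p M0 * of_nat (N M0) = 0" by simp
  then show False using M0(1) N(2)[OF M0(1)] by (simp add: in_keys_iff)
qed

subsection \<open>Scaling automorphisms\<close>

lemma (in ring_1_hom) shift_one_fps_map: "shift_one (fps_map h f) = fps_map h (shift_one f)"
proof -
  interpret H: ring_1_hom "fps_map h" by (rule ring_1_hom_fps_map)
  have "fps_map h shift_kernel = (shift_kernel :: 'b fps)"
    by (rule fps_ext) (simp add: shift_kernel_def hom_zero hom_power hom_uminus hom_one)
  then have "fps_map h (shift_kernel ^ i) = (shift_kernel ^ i :: 'b fps)" for i
    by (simp add: H.hom_power)
  then have "h (fps_nth (shift_kernel ^ i) n) = (fps_nth (shift_kernel ^ i) n :: 'b)" for i n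
    by (metis fps_map_nth)
  then show ?thesis
    by (intro fps_ext) (simp add: shift_one_nth hom_sum hom_mult)
qed

text \<open>The coefficient recursion for f(u) f(u + 1) = g(u). The n-th coefficient of f enters
  once through each factor, both times with coefficient 1; this is the origin of the division by
  2.\<close>

fun shift_root :: "complex fps \<Rightarrow> nat \<Rightarrow> complex" where
  "shift_root g n = (if n = 0 then 1 else
     (fps_nth g n - (\<Sum>m<n. \<Sum>i<n. shift_root g m * shift_root g i * fps_nth (shift_kernel ^ i) (n - m))) / 2)"

declare shift_root.simps [simp del]

lemma shift_root_exists:
  fixes g :: "complex fps"
  assumes "fps_nth g 0 = 1"
  obtains f where "fps_nth f 0 = 1" "shift_one f * f = g"
proof -
  define f where "f = Abs_fps (shift_root g)"
  let ?k = "\<lambda>i. fps_nth (shift_kernel ^ i :: complex fps)"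
  have f0: "fps_nth f 0 = 1" by (simp add: f_def shift_root.simps)
  have "fps_nth (f * shift_one f) n = fps_nth g n" for n
  proof (cases "n = 0")
    case True
    then show ?thesis by (simp add: f0 assms shift_one_nth_0)
  next
    case False
    let ?S = "\<Sum>m<n. \<Sum>i<n. fps_nth f m * fps_nth f i * ?k i (n - m)"
    have "fps_nth (f * shift_one f) n = (\<Sum>m\<le>n. \<Sum>i\<le>n. fps_nth f m * fps_nth f i * ?k i (n - m))"
      unfolding fps_mult_nth atLeast0AtMost
      by (intro sum.cong refl) (simp add: shift_one_nth_superset[of _ n] sum_distrib_left mult.assoc)
    also have "\<dots> = (\<Sum>m<n. \<Sum>i\<le>n. fps_nth f m * fps_nth f i * ?k i (n - m)) + (\<Sum>i\<le>n. fps_nth f n * fps_nth f i * ?k i 0)"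
      by (simp add: lessThan_Suc_atMost[symmetric])
    also have "(\<Sum>i\<le>n. fps_nth f n * fps_nth f i * ?k i 0) = fps_nth f n"
      by (subst sum_atMost_eq_0th) (auto simp: f0 shift_kernel_def)
    also have "(\<Sum>m<n. \<Sum>i\<le>n. fps_nth f m * fps_nth f i * ?k i (n - m)) = ?S + (\<Sum>m<n. fps_nth f m * fps_nth f n * ?k n (n - m))"
      by (simp add: lessThan_Suc_atMost[symmetric] sum.distrib)
    also have "(\<Sum>m<n. fps_nth f m * fps_nth f n * ?k n (n - m)) = (\<Sum>m\<in>{0}. fps_nth f m * fps_nth f n * ?k n (n - m))"
      using False by (intro sum.mono_neutral_right) (auto simp: shift_kernel_power_nth_eq_0)
    also have "\<dots> = fps_nth f n"
      by (simp add: f0 shift_kernel_power_nth_self)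
    also have "?S + fps_nth f n + fps_nth f n = fps_nth g n"
      using False by (simp add: f_def shift_root.simps[of g n])
    finally show ?thesis .
  qed
  then have "shift_one f * f = g" by (metis fps_ext mult.commute)
  with f0 show ?thesis by (rule that)
qed

section \<open>Multiplication of the generator matrix by a scalar series\<close>

abbreviation cseries :: "complex fps \<Rightarrow> 'a::complex_algebra_1 fps" where
  "cseries \<equiv> fps_map of_complex"

lemma cseries_central: "cseries f * F = F * cseries f"
proof (rule fps_ext)
  fix n
  show "fps_nth (cseries f * F) n = fps_nth (F * cseries f) n"
    unfolding fps_mult_nth
    by (rule sum.reindex_bij_witness[of _ "\<lambda>i. n - i" "\<lambda>i. n - i"]) (auto simp: of_complex_commute)
qed

lemma ring_1_hom_cseries: "ring_1_hom cseries"
  by (rule of_complex.ring_1_hom_fps_map)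

lemma fps_map_cseries: "alg_hom h \<Longrightarrow> fps_map h (cseries f * F) = cseries f * fps_map h F"
proof -
  assume "alg_hom h"
  then interpret alg_hom h .
  interpret H: ring_1_hom "fps_map h" by (rule ring_1_hom_fps_map)
  have "fps_map h (cseries f) = cseries f" by (rule fps_ext) (simp add: hom_of_complex)
  then show ?thesis by (simp add: H.hom_mult)
qed

lemma fps_map_comp: "fps_map (g \<circ> h) F = fps_map g (fps_map h F)"
  by (rule fps_ext) simp

lemma alg_hom_id: "alg_hom (\<lambda>x. x)"
  by unfold_locales auto

text \<open>The scalar matrix f(u) solves the RTT relation and its entries are central, so its
  product with the generator matrix is again a solution.\<close>

lemma gl4_scaling_hom:
  assumes "fps_nth f 0 = 1"
  obtains h where "alg_hom h" "\<And>i j. fps_map h (T_gl4 $ i $ j) = cseries f * T_gl4 $ i $ j"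
proof -
  let ?F = "cseries f :: Y_gl4 fps"
  have Fc: "fps_nth ?F m * x = x * fps_nth ?F m" for m x
    by (simp add: of_complex_commute)
  have u: "map_matrix series_u (mat ?F) = mat (series_u ?F)" and v: "map_matrix series_v (mat ?F) = mat (series_v ?F)"
    by (auto simp: vec_eq_iff mat_def series_u.hom_zero series_v.hom_zero)
  have t: "tensor1 (mat z) = mat z" "tensor2 (mat z) = mat z" for z :: "Y_gl4 fls fls"
    by (auto simp: vec_eq_iff tensor1_def tensor2_def mat_def)
  have "series_u ?F * z = z * series_u ?F" for z
    by (intro fls_central) (auto simp: series_u_def of_complex_commute intro!: fls_central)
  moreover have "series_v ?F * z = z * series_v ?F" for z
    by (intro fls_central) (auto simp: series_v_def of_complex_commute intro!: fls_central)
  ultimately have c: "mat (series_u ?F) ** A = A ** mat (series_u ?F)" "mat (series_v ?F) ** A = A ** mat (series_v ?F)"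
    for A :: "Y_gl4 fls fls ^ (4 \<times> 4) ^ (4 \<times> 4)"
    by (auto intro: mat_commute)
  have "R_gl4 ** mat (series_u ?F) ** mat (series_v ?F) = mat (series_v ?F) ** (mat (series_u ?F) ** R_gl4)"
    unfolding c(1)[of R_gl4] c(2)[of "R_gl4 ** mat (series_u ?F)"] ..
  then have "rtt_defect R_gl4 (mat ?F) = 0"
    unfolding rtt_defect_def u v t by (simp only: matrix_mul_assoc diff_self)
  then have "rtt_defect R_gl4 (mat ?F ** T_gl4) = 0"
    by (rule rtt_defect_mult[OF _ gl4.rtt]) (simp add: mat_def of_complex_commute)
  moreover have "fps_nth ((mat ?F ** T_gl4) $ i $ j) 0 = (if i = j then 1 else 0)" for i j
    by (simp add: mat_mult_nth gl4.T_nth_0 assms of_complex.hom_one)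
  ultimately obtain h where h: "alg_hom h" "map_matrix (fps_map h) T_gl4 = mat ?F ** T_gl4"
    using gl4.lift[OF ring_1_hom.map_matrix_R_gl4] by blast
  have "fps_map h (T_gl4 $ i $ j) = ?F * T_gl4 $ i $ j" for i j
    using arg_cong[OF h(2), of "\<lambda>M. M $ i $ j"] by (simp add: mat_mult_nth)
  with h(1) show ?thesis by (rule that)
qed

lemma gl4_scaling_automorphism:
  assumes "fps_nth f 0 = 1"
  obtains h where "scaling_automorphism T_gl4 f h"
proof -
  interpret c: ring_1_hom "cseries :: complex fps \<Rightarrow> Y_gl4 fps" by (rule ring_1_hom_cseries)
  have f': "fps_nth (inverse f) 0 = 1" using assms by simp
  have inv: "inverse f * f = 1" by (rule inverse_mult_eq_1) (simp add: assms)
  then have inv': "f * inverse f = 1" by (simp add: mult.commute)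
  obtain h where h: "alg_hom h" "\<And>i j. fps_map h (T_gl4 $ i $ j) = cseries f * T_gl4 $ i $ j"
    using gl4_scaling_hom[OF assms] by blast
  obtain k where k: "alg_hom k" "\<And>i j. fps_map k (T_gl4 $ i $ j) = cseries (inverse f) * T_gl4 $ i $ j"
    using gl4_scaling_hom[OF f'] by blast
  have "(h \<circ> k) x = x" for x
    by (rule gl4.hom_eqI[OF alg_hom_comp[OF h(1) k(1)] alg_hom_id])
      (simp add: fps_map_comp k(2) fps_map_cseries[OF h(1)] h(2) inv c.hom_one fps_eq_iff flip: mult.assoc c.hom_mult)
  moreover have "(k \<circ> h) x = x" for x
    by (rule gl4.hom_eqI[OF alg_hom_comp[OF k(1) h(1)] alg_hom_id])
      (simp add: fps_map_comp h(2) fps_map_cseries[OF k(1)] k(2) inv' c.hom_one fps_eq_iff flip: mult.assoc c.hom_mult)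
  ultimately have "bij h" by (intro o_bij[of k]) (auto simp: fun_eq_iff)
  with h show ?thesis by (intro that[of h]) (simp add: scaling_automorphism_def algebra_iso_on_UNIV)
qed

lemma minors_scale:
  "minors (map_matrix shift_one (\<chi> i j. cseries f * T $ i $ j)) (\<chi> i j. cseries f * T $ i $ j) $ k $ l
    = cseries (shift_one f * f) * fused_minors T $ k $ l"
proof -
  interpret c: ring_1_hom "cseries :: complex fps \<Rightarrow> 'a fps" by (rule ring_1_hom_cseries)
  have "shift_one (cseries f * A) * (cseries f * B) = cseries (shift_one f * f) * (shift_one A * B)" for A B :: "'a fps"
  proof -
    have "shift_one (cseries f * A) * (cseries f * B) = cseries (shift_one f) * (shift_one A * cseries f) * B"
      by (simp only: shift_one.hom_mult of_complex.shift_one_fps_map mult.assoc)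
    also have "\<dots> = cseries (shift_one f * f) * (shift_one A * B)"
      by (simp only: cseries_central[of f "shift_one A", symmetric] c.hom_mult mult.assoc)
    finally show ?thesis .
  qed
  then show ?thesis by (simp add: minors_nth right_diff_distrib)
qed

theorem propositionA11:
  fixes c :: complex
  assumes "c \<noteq> 0"
  shows "fused_left = fused_right \<and>
    (\<exists>\<phi> :: X_so6 \<Rightarrow> Y_gl4.
       acts_on_exterior_square_by c fused_left (map_matrix (fps_map \<phi>) T_so6) \<and>
       algebra_iso_on UNIV UNIV \<phi> \<and>
       algebra_iso_on Y_so6 Y_sl4 \<phi>)"
proof -
  obtain \<phi> where \<phi>: "alg_hom \<phi>"
    and N: "map_matrix (fps_map \<phi>) T_so6 = fused_minors T_gl4"
    using fusion_hom by blast
  interpret alg_hom \<phi> by fact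
  \<comment> \<open>An element in the kernel is a combination p of ordered products of preimages;
    its image is the same combination of monomials in the generators, whose independence forces p =
    0.\<close>
  have "x = 0" if "\<phi> x = 0" for x
  proof -
    obtain s p where sp: "x = mono_eval s p" "\<phi> \<circ> s = gen T_gl4"
      using X_so6_spanned[OF \<phi> N] by blast
    then have "mono_eval (gen T_gl4) p = 0" using that by (simp add: hom_mono_eval)
    then have "p = 0" by (rule mono_eval_gen_T_gl4_eq_0)
    then show ?thesis by (simp add: sp(1) mono_eval_def)
  qed
  then have inj: "inj \<phi>"
    by (intro injI) (metis hom_diff right_minus_eq)
  with fusion_hom_surj[OF \<phi> N] have bij: "bij \<phi>" by (simp add: bij_def)
  let ?\<psi> = "inv \<phi>"
  have \<psi>: "alg_hom ?\<psi>" by (rule alg_hom_inv[OF \<phi> bij])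
  have inv1: "?\<psi> (\<phi> x) = x" and inv2: "\<phi> (?\<psi> y) = y" for x y
    using bij by (simp_all add: bij_is_inj bij_is_surj surj_f_inv_f)
  \<comment> \<open>Quantum minors are quadratic in the generators, at u + 1 and at u, so scaling
    these by f scales the minors by f(u + 1) f(u).\<close>
  have conj: "scaling_automorphism T_so6 (shift_one f * f) (?\<psi> \<circ> k \<circ> \<phi>)"
    if k: "scaling_automorphism T_gl4 f k" for f k
  proof -
    have k': "alg_hom k" "bij k" "fps_map k (T_gl4 $ i $ j) = cseries f * T_gl4 $ i $ j" for i j
      using k by (auto simp: scaling_automorphism_def algebra_iso_on_UNIV)
    interpret k: alg_hom k by (rule k'(1))
    interpret K: ring_1_hom "fps_map k" by (rule k.ring_1_hom_fps_map)
    have kT: "map_matrix (fps_map k) T_gl4 = (\<chi> i j. cseries f * T_gl4 $ i $ j)"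
      by (simp add: vec_eq_iff k'(3))
    have kS: "map_matrix (fps_map k) (map_matrix shift_one T_gl4) = map_matrix shift_one (map_matrix (fps_map k) T_gl4)"
      by (simp add: vec_eq_iff k.shift_one_fps_map)
    have "fps_map (?\<psi> \<circ> k \<circ> \<phi>) (T_so6 $ i $ j) = cseries (shift_one f * f) * T_so6 $ i $ j" for i j
    proof -
      have \<phi>T: "fps_map \<phi> (T_so6 $ i $ j) = fused_minors T_gl4 $ i $ j"
        using arg_cong[OF N, of "\<lambda>M. M $ i $ j"] by simp
      have "fps_map k (fused_minors T_gl4 $ i $ j) = cseries (shift_one f * f) * fps_map \<phi> (T_so6 $ i $ j)"
        using arg_cong[OF map_minors[OF k.ring_1_hom_fps_map, of "map_matrix shift_one T_gl4" T_gl4], of "\<lambda>M. M $ i $ j"]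
        unfolding kS kT minors_scale \<phi>T by simp
      moreover have "fps_map ?\<psi> (fps_map \<phi> F) = F" for F
        by (rule fps_ext) (simp add: inv1)
      ultimately show ?thesis
        by (simp add: fps_map_comp \<phi>T[symmetric] fps_map_cseries[OF \<psi>])
    qed
    moreover have "alg_hom (?\<psi> \<circ> k \<circ> \<phi>)" by (intro alg_hom_comp \<psi> \<phi> k'(1))
    moreover have "bij (?\<psi> \<circ> k \<circ> \<phi>)" by (intro bij_comp bij k'(2) bij_imp_bij_inv)
    ultimately show ?thesis by (simp add: scaling_automorphism_def algebra_iso_on_UNIV)
  qed
  have iff: "\<phi> x \<in> Y_sl4 \<longleftrightarrow> x \<in> Y_so6" for x
  proof
    assume sl: "\<phi> x \<in> Y_sl4"
    show "x \<in> Y_so6"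
      unfolding Y_so6_def scaling_invariants_def
    proof clarify
      fix g h assume g: "fps_nth g 0 = (1 :: complex)" and h: "scaling_automorphism T_so6 g h"
      obtain f where f: "fps_nth f 0 = 1" "shift_one f * f = g" using shift_root_exists[OF g] .
      obtain k where k: "scaling_automorphism T_gl4 f k" using gl4_scaling_automorphism[OF f(1)] .
      \<comment> \<open>An automorphism is determined by its values on the generators, so
        \<open>h\<close> must be the conjugate of a scaling on the gl_4 side.\<close>
      have "h x = (?\<psi> \<circ> k \<circ> \<phi>) x"
        using h conj[OF k] unfolding f(2) scaling_automorphism_def algebra_iso_on_UNIV
        by (intro so6.hom_eqI[of h "?\<psi> \<circ> k \<circ> \<phi>"]) auto
      also have "k (\<phi> x) = \<phi> x"
        using sl k f(1) unfolding Y_sl4_def scaling_invariants_def by blast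
      then have "(?\<psi> \<circ> k \<circ> \<phi>) x = x" by (simp add: inv1)
      finally show "h x = x" .
    qed
  next
    assume so: "x \<in> Y_so6"
    show "\<phi> x \<in> Y_sl4"
      unfolding Y_sl4_def scaling_invariants_def
    proof clarify
      fix f k assume f: "fps_nth f 0 = (1 :: complex)" and k: "scaling_automorphism T_gl4 f k"
      have "fps_nth (shift_one f * f) 0 = 1" by (simp add: f shift_one_nth_0)
      with so conj[OF k] have "(?\<psi> \<circ> k \<circ> \<phi>) x = x"
        unfolding Y_so6_def scaling_invariants_def by blast
      then show "k (\<phi> x) = \<phi> x" by (metis comp_apply inv2)
    qed
  qed
  have "\<phi> ` Y_so6 = Y_sl4"
    using iff inv2 by (metis (no_types, lifting) image_iff subsetI subset_antisym)
  then have "algebra_iso_on Y_so6 Y_sl4 \<phi>"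
    using inj hom_one hom_add hom_mult hom_scaleC
    by (auto simp: algebra_iso_on_def algebra_hom_on_def bij_betw_def intro: inj_on_subset)
  moreover have "algebra_iso_on UNIV UNIV \<phi>"
    using \<phi> bij by (simp add: algebra_iso_on_UNIV)
  moreover have "acts_on_exterior_square_by c fused_left (map_matrix (fps_map \<phi>) T_so6)"
    unfolding N by (rule fused_left_acts)
  ultimately show ?thesis using fused_left_eq_right by blast
qed

end
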